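(* Let $k\ge2$ be an integer, let $\lambda\in[k-1,\infty)$, let $\nu:=(\lambda+1)/k$, and let $G_f:=W^{k,(\lambda,\ldots,\lambda)}(\mu)$. Then: (i) for any $a\in G_f$, $\psi(a)\in W^{k,(\nu,\ldots,\nu)}(\mu)$, where $\psi(a)(x):=\psi(a(x))$; (ii) the nonlinear superposition operator $\Psi_f:G_f\to W^{k,(\nu,\ldots,\nu)}(\mu)$, defined by $\Psi_f(a)(x)=\psi(a(x))$, is continuous.
   Context: $\mathbb{N}=\{1,2,\ldots\}$. Reference measure: fix $t\in(0,2]$ and a strictly increasing function $\theta:[0,\infty)\to[0,\infty)$, twice continuously differentiable on $(0,\infty)$, with $\lim_{z\downarrow0}\theta'(z)<\infty$, $\theta(0)=0$, and $\theta(z)=c+z^t$ for all $z\ge z_t$ (with $z>0$), where $z_t\ge0$ and $c\in\mathbb{R}$ are constants; if $t\in(1,2]$, both $\theta$ and $-\sqrt{\theta}$ are also required to be convex. For $d\in\mathbb{N}$, $\mu$ is the probability measure on the Lebesgue measurable subsets of $\mathbb{R}^d$ given by $\mu(dx)=r(x)\,dx$, $r=\exp(l)$, $l(x)=\sum_{i=1}^d(C-\theta(|x_i|))$, where $C\in\mathbb{R}$ is such that $\int_{\mathbb{R}}\exp(C-\theta(|z|))\,dz=1$. Sobolev spaces: for $\kappa\in[1,\infty)$, $W^{k,(\kappa,\ldots,\kappa)}(\mu)$ is the space of real-valued functions $a\in L^{\kappa}(\mu)$ having weak partial derivatives $D^sa\in L^{\kappa}(\mu)$ for all multi-indices $s$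 with $1\le|s|\le k$, with norm $\big(\sum_{0\le|s|\le k}\|D^sa\|_{L^{\kappa}(\mu)}^{\kappa}\big)^{1/\kappa}$. Deformed exponential: $\psi:\mathbb{R}\to(0,\infty)$ is the inverse of the diffeomorphism $\log_d:(0,\infty)\to\mathbb{R}$, $\log_d y=y-1+\log y$. *)

theory Defs
  imports "HOL-Analysis.Analysis"
begin

definition admissible_theta :: "real \<Rightarrow> (real \<Rightarrow> real) \<Rightarrow> bool" where
  "admissible_theta t \<theta> \<longleftrightarrow>
     strict_mono_on {0..} \<theta> \<and> \<theta> 0 = 0 \<and>
     \<theta> differentiable_on {0<..} \<and>
     deriv \<theta> differentiable_on {0<..} \<and>
     continuous_on {0<..} (deriv (deriv \<theta>)) \<and>
     (\<exists>L::real. (deriv \<theta> \<longlongrightarrow> L) (at_right 0)) \<and>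
     (\<exists>zt c. 0 \<le> zt \<and> (\<forall>z. zt \<le> z \<and> 0 < z \<longrightarrow> \<theta> z = c + z powr t)) \<and>
     (1 < t \<and> t \<le> 2 \<longrightarrow>
        convex_on {0..} \<theta> \<and> convex_on {0..} (\<lambda>z. - sqrt (\<theta> z)))"

definition ref_measure :: "real \<Rightarrow> (real \<Rightarrow> real) \<Rightarrow> (real ^ 'n) measure" where
  "ref_measure C \<theta> =
     density lebesgue (\<lambda>x. ennreal (exp (\<Sum>i\<in>UNIV. C - \<theta> \<bar>x $ i\<bar>)))"

text \<open>Multi-indices are functions \<open>s :: 'n \<Rightarrow> nat\<close> on the finite index type of the coordinates.\<close>

definition mi_order :: "('n::finite \<Rightarrow> nat) \<Rightarrow> nat" where
  "mi_order s = (\<Sum>i\<in>UNIV. s i)"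

lemma finite_mi_order_le: "finite {s :: 'n::finite \<Rightarrow> nat. mi_order s \<le> k}"
proof (rule finite_subset)
  show "{s :: 'n \<Rightarrow> nat. mi_order s \<le> k} \<subseteq> PiE UNIV (\<lambda>_. {..k})"
  proof
    fix s :: "'n \<Rightarrow> nat" assume "s \<in> {s. mi_order s \<le> k}"
    then have le: "(\<Sum>i\<in>UNIV. s i) \<le> k" by (simp add: mi_order_def)
    have "s i \<le> k" for i
      using member_le_sum[of i UNIV s] le by simp
    then show "s \<in> PiE UNIV (\<lambda>_. {..k})" by auto
  qed
  show "finite (PiE (UNIV :: 'n set) (\<lambda>_. {..k}))" by (intro finite_PiE) auto
qed

text \<open>\<open>all_derivs \<phi> \<Phi>\<close> says that \<open>\<phi>\<close> is infinitely differentiable and \<open>\<Phi> s\<close> is its classical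
  partial derivative of multi-index \<open>s\<close>: every \<open>\<Phi> s\<close> is differentiable, and its partial derivative
  in direction \<open>i\<close> is \<open>\<Phi> (s + e_i)\<close>. The family \<open>\<Phi>\<close> is determined by \<open>\<phi>\<close>, and no order of
  differentiation has to be chosen.\<close>

definition all_derivs ::
  "(real ^ 'n \<Rightarrow> real) \<Rightarrow> (('n \<Rightarrow> nat) \<Rightarrow> real ^ 'n \<Rightarrow> real) \<Rightarrow> bool" where
  "all_derivs \<phi> \<Phi> \<longleftrightarrow>
     \<Phi> (\<lambda>_. 0) = \<phi> \<and>
     (\<forall>s x. (\<Phi> s has_derivative (\<lambda>h. \<Sum>i\<in>UNIV. h $ i * \<Phi> (s(i := Suc (s i))) x)) (at x))"

definition locally_integrable :: "(real ^ 'n \<Rightarrow> real) \<Rightarrow> bool" where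
  "locally_integrable f \<longleftrightarrow> (\<forall>K. compact K \<longrightarrow> set_integrable lebesgue K f)"

text \<open>Weak derivatives are taken with respect to Lebesgue measure, not with respect to the
  weighted measure.\<close>

definition has_weak_deriv ::
  "(real ^ 'n \<Rightarrow> real) \<Rightarrow> ('n \<Rightarrow> nat) \<Rightarrow> (real ^ 'n \<Rightarrow> real) \<Rightarrow> bool" where
  "has_weak_deriv a s v \<longleftrightarrow>
     locally_integrable a \<and> locally_integrable v \<and>
     (\<forall>\<phi> \<Phi>. all_derivs \<phi> \<Phi> \<and> compact (closure {x. \<phi> x \<noteq> 0}) \<longrightarrow>
        (LINT x|lebesgue. a x * \<Phi> s x) = (- 1) ^ mi_order s * (LINT x|lebesgue. v x * \<phi> x))"

text \<open>The weak derivative is unique only up to Lebesgue null sets; \<open>weak_deriv\<close> picks a version.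
  Everything below depends only on its equivalence class.\<close>

definition weak_deriv :: "('n \<Rightarrow> nat) \<Rightarrow> (real ^ 'n \<Rightarrow> real) \<Rightarrow> real ^ 'n \<Rightarrow> real" where
  "weak_deriv s a = (SOME v. has_weak_deriv a s v)"

definition Lspace :: "'a measure \<Rightarrow> real \<Rightarrow> ('a \<Rightarrow> real) set" where
  "Lspace M p = {f \<in> borel_measurable M. integrable M (\<lambda>x. \<bar>f x\<bar> powr p)}"

text \<open>As in \<open>Lspace\<close>, the elements of \<open>sobolev M k p\<close> are functions rather than classes modulo
  null sets, so \<open>sobolev_norm M k p\<close> is a seminorm vanishing exactly on the functions that are
  zero almost everywhere.\<close>

definition sobolev :: "(real ^ 'n) measure \<Rightarrow> nat \<Rightarrow> real \<Rightarrow> (real ^ 'n \<Rightarrow> real) set" where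
  "sobolev M k p =
     {a \<in> Lspace M p. \<forall>s. 1 \<le> mi_order s \<and> mi_order s \<le> k \<longrightarrow>
        (\<exists>v \<in> Lspace M p. has_weak_deriv a s v)}"

definition sobolev_norm :: "(real ^ 'n) measure \<Rightarrow> nat \<Rightarrow> real \<Rightarrow> (real ^ 'n \<Rightarrow> real) \<Rightarrow> real" where
  "sobolev_norm M k p a =
     (\<Sum>s | mi_order s \<le> k. LINT x|M. \<bar>weak_deriv s a x\<bar> powr p) powr (1 / p)"

definition log_d :: "real \<Rightarrow> real" where
  "log_d y = y - 1 + ln y"

definition psi :: "real \<Rightarrow> real" where
  "psi = the_inv_into {0<..} log_d"

end

theory Submission
  imports Defs "HOL-Probability.Probability"
begin

text \<open>The density \<open>r\<close> lies between constant multiples of the smooth weight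
  \<open>\<rho>(x) = \<Prod>\<^sub>i exp (- (1 + x\<^sub>i\<^sup>2)\<^bsup>t/2\<^esup>)\<close>, so the two measures have the same Sobolev spaces with equivalent
  norms, and test functions are dense. For a test function \<open>c\<close> the chain rule expresses a derivative of
  order \<open>k\<close> of \<open>\<psi>(c)\<close> through terms \<open>\<psi>\<^bsup>(m)\<^esup>(c) D\<^bsup>u1\<^esup>c \<cdots> D\<^bsup>um\<^esup>c\<close>. If \<open>m < k\<close>, then \<open>m \<nu> \<le> \<lambda>\<close> and the \<open>\<nu>\<close>-th
  power of the term is dominated by the functions \<open>1 + \<bar>D\<^bsup>u\<^esup>c\<bar>\<^bsup>\<lambda>\<^esup>\<close>. If \<open>m = k\<close>, all factors are first
  derivatives and the power \<open>k \<nu> = \<lambda> + 1\<close> is one too high. This is repaired by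
  \<open>\<bar>\<psi>\<^bsup>(k)\<^esup>\<bar> \<le> K \<psi>''\<close> and integration by parts: \<open>\<psi>''(c) \<partial>\<^sub>ic \<bar>\<partial>\<^sub>ic\<bar>\<^bsup>\<lambda>\<^esup>\<close> is traded for the bounded function
  \<open>\<psi>'(c)\<close> times \<open>\<bar>\<partial>\<^sub>ic\<bar>\<^bsup>\<lambda> - 1\<^esup> \<partial>\<^sub>i\<^sup>2c\<close> and \<open>\<bar>\<partial>\<^sub>ic\<bar>\<^bsup>\<lambda>\<^esup> \<partial>\<^sub>i log \<rho>\<close>, and the unbounded drift \<open>\<partial>\<^sub>i log \<rho>\<close> is absorbed by a
  second integration by parts. Hence if test functions converge to \<open>a\<close> in \<open>W\<^bsup>k,\<lambda>\<^esup>\<close>, the integrals of the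
  dominating functions converge, and generalised dominated convergence gives convergence in \<open>L\<^bsup>\<nu>\<^esup>\<close> of
  every term. Passing to the limit in the weak formulation yields (i); approximating both \<open>a\<close> and a
  sequence converging to it by test functions yields (ii).\<close>

section \<open>Almost everywhere convergence with convergence of integrals\<close>

text \<open>The bound \<lambda> \<ge> k - 1 says exactly that \<nu> \<ge> 1. This gives (k - 1)
  \<nu> = \<lambda> + 1 - \<nu> \<le> \<lambda>, so only the terms with k first derivatives exceed
  the available integrability, and it gives \<psi>''^\<nu> \<le> \<psi>'' because 0 \<le> \<psi>''
  \<le> 1. The bound k \<ge> 2 puts the second derivative produced by the integration by parts into
  L^\<lambda>. The obstacle is a circularity: the norm supplies no majorant for \<psi>''(a) |D_i
  a|^(\<lambda>+1), so dominated convergence cannot prove it integrable. Its integral, however,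
  equals one with integrable terms only. This identity holds for test functions; with the power
  replaced by a bounded truncation it passes to a, and removing the truncation by Fatou's lemma
  gives integrability and convergence of the integrals. Positivity upgrades this to convergence in
  mean by Scheffe's lemma. Hence the notion \<open>L1conv\<close>, which couples a.e. and L1
  convergence: its instances serve as majorants that vary with the index. Since a.e. convergence is
  available only along subsequences, continuity is proved by contradiction.\<close>

definition L1conv :: "'a measure \<Rightarrow> (nat \<Rightarrow> 'a \<Rightarrow> real) \<Rightarrow> ('a \<Rightarrow> real) \<Rightarrow> bool" where
  "L1conv M f g \<longleftrightarrow> (\<forall>j. integrable M (f j)) \<and> integrable M g \<and>
     (AE x in M. (\<lambda>j. f j x) \<longlonglongrightarrow> g x) \<and> (\<lambda>j. LINT x|M. \<bar>f j x - g x\<bar>) \<longlonglongrightarrow> 0"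

lemma L1convD:
  assumes "L1conv M f g"
  shows "integrable M (f j)" "integrable M g" "AE x in M. (\<lambda>j. f j x) \<longlonglongrightarrow> g x"
    "(\<lambda>j. LINT x|M. \<bar>f j x - g x\<bar>) \<longlonglongrightarrow> 0"
  using assms by (auto simp: L1conv_def)

lemma L1conv_const: "integrable M g \<Longrightarrow> L1conv M (\<lambda>_. g) g"
  by (simp add: L1conv_def)

lemma tendsto_integral_of_norm:
  fixes f :: "nat \<Rightarrow> 'a \<Rightarrow> real"
  assumes "\<And>j. integrable M (f j)" "integrable M g" "(\<lambda>j. LINT x|M. \<bar>f j x - g x\<bar>) \<longlonglongrightarrow> 0"
  shows "(\<lambda>j. LINT x|M. f j x) \<longlonglongrightarrow> (LINT x|M. g x)"
proof -
  have "(\<lambda>j. (LINT x|M. f j x) - (LINT x|M. g x)) \<longlonglongrightarrow> 0"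
  proof (rule Lim_null_comparison[OF _ assms(3)])
    have "norm ((LINT x|M. f j x) - (LINT x|M. g x)) \<le> (LINT x|M. \<bar>f j x - g x\<bar>)" for j
    proof -
      have "(LINT x|M. f j x) - (LINT x|M. g x) = (LINT x|M. f j x - g x)"
        using assms by simp
      then show ?thesis using integral_abs_bound[of M "\<lambda>x. f j x - g x"] by simp
    qed
    then show "\<forall>\<^sub>F j in sequentially. norm ((LINT x|M. f j x) - (LINT x|M. g x)) \<le> (LINT x|M. \<bar>f j x - g x\<bar>)"
      by simp
  qed
  then show ?thesis by (simp add: LIM_zero_iff)
qed

lemma L1conv_integral: "L1conv M f g \<Longrightarrow> (\<lambda>j. LINT x|M. f j x) \<longlonglongrightarrow> (LINT x|M. g x)"
  by (rule tendsto_integral_of_norm) (auto simp: L1conv_def)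

lemma L1conv_add:
  assumes f: "L1conv M f1 g1" and g: "L1conv M f2 g2"
  shows "L1conv M (\<lambda>j x. f1 j x + f2 j x) (\<lambda>x. g1 x + g2 x)"
  unfolding L1conv_def
proof (intro conjI allI)
  note [simp] = L1convD(1,2)[OF f] L1convD(1,2)[OF g]
  show "integrable M (\<lambda>x. f1 j x + f2 j x)" for j by simp
  show "integrable M (\<lambda>x. g1 x + g2 x)" by simp
  show "AE x in M. (\<lambda>j. f1 j x + f2 j x) \<longlonglongrightarrow> g1 x + g2 x"
    using L1convD(3)[OF f] L1convD(3)[OF g] by eventually_elim (rule tendsto_add)
  have lim: "(\<lambda>j. (LINT x|M. \<bar>f1 j x - g1 x\<bar>) + (LINT x|M. \<bar>f2 j x - g2 x\<bar>)) \<longlonglongrightarrow> 0"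
    using tendsto_add[OF L1convD(4)[OF f] L1convD(4)[OF g]] by simp
  show "(\<lambda>j. LINT x|M. \<bar>f1 j x + f2 j x - (g1 x + g2 x)\<bar>) \<longlonglongrightarrow> 0"
  proof (rule tendsto_sandwich[OF _ _ tendsto_const lim])
    have "(LINT x|M. \<bar>f1 j x + f2 j x - (g1 x + g2 x)\<bar>)
        \<le> (LINT x|M. \<bar>f1 j x - g1 x\<bar> + \<bar>f2 j x - g2 x\<bar>)" for j
      by (rule integral_mono) auto
    then show "\<forall>\<^sub>F j in sequentially. (LINT x|M. \<bar>f1 j x + f2 j x - (g1 x + g2 x)\<bar>)
        \<le> (LINT x|M. \<bar>f1 j x - g1 x\<bar>) + (LINT x|M. \<bar>f2 j x - g2 x\<bar>)"
      by simp
  qed simp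
qed

lemma L1conv_cmult:
  assumes f: "L1conv M f g"
  shows "L1conv M (\<lambda>j x. c * f j x) (\<lambda>x. c * g x)"
  unfolding L1conv_def
proof (intro conjI allI)
  note [simp] = L1convD(1,2)[OF f]
  show "integrable M (\<lambda>x. c * f j x)" for j by simp
  show "integrable M (\<lambda>x. c * g x)" by simp
  show "AE x in M. (\<lambda>j. c * f j x) \<longlonglongrightarrow> c * g x"
    using L1convD(3)[OF f] by eventually_elim (intro tendsto_intros)
  have "(LINT x|M. \<bar>c * f j x - c * g x\<bar>) = \<bar>c\<bar> * (LINT x|M. \<bar>f j x - g x\<bar>)" for j
    by (simp add: abs_mult flip: right_diff_distrib)
  then show "(\<lambda>j. LINT x|M. \<bar>c * f j x - c * g x\<bar>) \<longlonglongrightarrow> 0"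
    using tendsto_mult_right_zero[OF L1convD(4)[OF f]] by simp
qed

text \<open>Clamping \<open>f j\<close> to \<open>[-g, g]\<close> costs at most \<open>\<bar>G j - g\<bar>\<close>; the clamped sequence is dominated.\<close>

lemma L1conv_dominated:
  assumes G: "L1conv M G g"
    and [measurable]: "\<And>j. f j \<in> borel_measurable M" "f' \<in> borel_measurable M"
    and lim: "AE x in M. (\<lambda>j. f j x) \<longlonglongrightarrow> f' x"
    and le: "\<And>j. AE x in M. \<bar>f j x\<bar> \<le> G j x"
  shows "L1conv M f f'"
proof -
  note [simp] = L1convD(1,2)[OF G]
  note [measurable] = borel_measurable_integrable[OF L1convD(2)[OF G]]
    borel_measurable_integrable[OF L1convD(1)[OF G]]
  have int_f: "integrable M (f j)" for j
    by (rule Bochner_Integration.integrable_bound[OF L1convD(1)[OF G, of j]]) (use le[of j] in auto)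
  have le': "AE x in M. \<forall>j. \<bar>f j x\<bar> \<le> G j x"
    using le by (simp add: AE_all_countable)
  have f'_le: "AE x in M. \<bar>f' x\<bar> \<le> g x"
    using le' lim L1convD(3)[OF G]
  proof eventually_elim
    case (elim x)
    show ?case
      by (rule LIMSEQ_le[OF tendsto_rabs[OF elim(2)] elim(3)]) (use elim(1) in auto)
  qed
  have int_f': "integrable M f'"
    by (rule Bochner_Integration.integrable_bound[OF L1convD(2)[OF G]]) (use f'_le in auto)
  define F where "F = (\<lambda>j x. max (- g x) (min (f j x) (g x)))"
  have [measurable]: "F j \<in> borel_measurable M" for j unfolding F_def by measurable
  have int_F: "integrable M (F j)" for j
    by (rule Bochner_Integration.integrable_bound[OF L1convD(2)[OF G]])
      (use f'_le in \<open>auto simp: F_def\<close>)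
  have F_lim: "AE x in M. (\<lambda>j. F j x) \<longlonglongrightarrow> f' x"
    using lim f'_le
  proof eventually_elim
    case (elim x)
    have "(\<lambda>j. F j x) \<longlonglongrightarrow> max (- g x) (min (f' x) (g x))"
      unfolding F_def by (intro tendsto_intros elim)
    then show ?case using elim by (simp add: abs_le_iff)
  qed
  have 1: "(\<lambda>j. LINT x|M. \<bar>F j x - f' x\<bar>) \<longlonglongrightarrow> (LINT x|M. 0)"
  proof (rule integral_dominated_convergence[where w="\<lambda>x. 2 * g x"])
    show "AE x in M. (\<lambda>j. \<bar>F j x - f' x\<bar>) \<longlonglongrightarrow> 0"
      using F_lim by eventually_elim (use tendsto_rabs_zero LIM_zero in blast)
    show "AE x in M. norm \<bar>F j x - f' x\<bar> \<le> 2 * g x" for j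
      using f'_le by eventually_elim (auto simp: F_def)
  qed auto
  have lim2: "(\<lambda>j. (LINT x|M. \<bar>G j x - g x\<bar>) + (LINT x|M. \<bar>F j x - f' x\<bar>)) \<longlonglongrightarrow> 0"
    using tendsto_add[OF L1convD(4)[OF G] 1] by simp
  have "(\<lambda>j. LINT x|M. \<bar>f j x - f' x\<bar>) \<longlonglongrightarrow> 0"
  proof (rule tendsto_sandwich[OF _ _ tendsto_const lim2])
    have "(LINT x|M. \<bar>f j x - f' x\<bar>)
        \<le> (LINT x|M. \<bar>G j x - g x\<bar> + \<bar>F j x - f' x\<bar>)" for j
    proof (rule integral_mono_AE)
      show "AE x in M. \<bar>f j x - f' x\<bar> \<le> \<bar>G j x - g x\<bar> + \<bar>F j x - f' x\<bar>"
        using le[of j] f'_le by eventually_elim (auto simp: F_def)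
    qed (use int_f int_f' int_F in auto)
    then show "\<forall>\<^sub>F j in sequentially. (LINT x|M. \<bar>f j x - f' x\<bar>)
        \<le> (LINT x|M. \<bar>G j x - g x\<bar>) + (LINT x|M. \<bar>F j x - f' x\<bar>)"
      using int_F int_f' by simp
  qed simp
  then show ?thesis using int_f int_f' lim by (simp add: L1conv_def)
qed

text \<open>An integral identity delivers only convergence of integrals; for nonnegative functions
  with an a.e. limit this already forces convergence in mean.\<close>

lemma L1conv_scheffe:
  assumes int: "\<And>j. integrable M (f j)" "integrable M g"
    and lim: "AE x in M. (\<lambda>j. f j x) \<longlonglongrightarrow> g x"
    and nn: "\<And>j x. 0 \<le> f j x" "\<And>x. 0 \<le> g x"
    and I: "(\<lambda>j. LINT x|M. f j x) \<longlonglongrightarrow> (LINT x|M. g x)"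
  shows "L1conv M f g"
proof -
  have eq: "(\<integral>\<^sup>+ x. norm (f j x) \<partial>M) = ennreal (LINT x|M. f j x)" for j
    using nn int by (simp add: nn_integral_eq_integral)
  have eq': "(\<integral>\<^sup>+ x. norm (g x) \<partial>M) = ennreal (LINT x|M. g x)"
    using nn int by (simp add: nn_integral_eq_integral)
  have "(\<lambda>j. \<integral>\<^sup>+ x. norm (f j x - g x) \<partial>M) \<longlonglongrightarrow> 0"
  proof (rule Scheffe_lemma1[OF int lim])
    have "(\<lambda>j. \<integral>\<^sup>+ x. norm (f j x) \<partial>M) \<longlonglongrightarrow> (\<integral>\<^sup>+ x. norm (g x) \<partial>M)"
      unfolding eq eq' using I by (rule tendsto_ennrealI)
    then show "limsup (\<lambda>j. \<integral>\<^sup>+ x. norm (f j x) \<partial>M) \<le> (\<integral>\<^sup>+ x. norm (g x) \<partial>M)"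
      by (simp add: lim_imp_Limsup)
  qed
  moreover have "(\<integral>\<^sup>+ x. norm (f j x - g x) \<partial>M) = ennreal (LINT x|M. \<bar>f j x - g x\<bar>)" for j
    using int by (simp add: nn_integral_eq_integral)
  ultimately have "(\<lambda>j. ennreal (LINT x|M. \<bar>f j x - g x\<bar>)) \<longlonglongrightarrow> ennreal 0" by simp
  then have "(\<lambda>j. LINT x|M. \<bar>f j x - g x\<bar>) \<longlonglongrightarrow> 0"
    by (subst (asm) tendsto_ennreal_iff) auto
  then show ?thesis using int lim by (simp add: L1conv_def)
qed

text \<open>Only the right-hand side comes with an integrable majorant. Through the identity it
  bounds the integrals of \<open>U m\<close> uniformly, so Fatou's lemma makes \<open>u\<close>
  integrable; then \<open>u\<close> itself dominates \<open>U m\<close>, and both sides pass to the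
  limit.\<close>

lemma integral_truncation_limit:
  fixes U :: "nat \<Rightarrow> 'a \<Rightarrow> real"
  assumes U: "\<And>m. integrable M (U m)" "u \<in> borel_measurable M"
    and U_lim: "\<And>x. (\<lambda>m. U m x) \<longlonglongrightarrow> u x" and U_le: "\<And>m x. 0 \<le> U m x" "\<And>m x. U m x \<le> u x"
    and V: "\<And>m. V m \<in> borel_measurable M" "v \<in> borel_measurable M"
    and V_lim: "\<And>x. (\<lambda>m. V m x) \<longlonglongrightarrow> v x"
    and V_le: "\<And>m x. \<bar>V m x\<bar> \<le> W x" and W: "integrable M W"
    and eq: "\<And>m. (LINT x|M. U m x) = (LINT x|M. V m x)"
  shows "integrable M u" "(LINT x|M. u x) = (LINT x|M. v x)"
proof -
  note [measurable] = U(2) V borel_measurable_integrable[OF U(1)]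
  have u_nn: "0 \<le> u x" for x using U_le order_trans by blast
  have "(\<integral>\<^sup>+ x. ennreal (u x) \<partial>M) = (\<integral>\<^sup>+ x. liminf (\<lambda>m. ennreal (U m x)) \<partial>M)"
    using U_lim by (intro nn_integral_cong) (metis tendsto_ennrealI lim_imp_Liminf sequentially_bot)
  also have "\<dots> \<le> liminf (\<lambda>m. \<integral>\<^sup>+ x. ennreal (U m x) \<partial>M)"
    by (rule nn_integral_liminf) auto
  also have "\<dots> \<le> liminf (\<lambda>m::nat. ennreal (LINT x|M. W x))"
  proof (intro Liminf_mono always_eventually allI)
    fix m
    have "(\<integral>\<^sup>+ x. ennreal (U m x) \<partial>M) = ennreal (LINT x|M. V m x)"
      using U_le eq U by (simp add: nn_integral_eq_integral)
    also have "\<dots> \<le> ennreal (LINT x|M. W x)"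
      by (intro ennreal_leI integral_mono Bochner_Integration.integrable_bound[OF W])
        (use V_le[THEN order_trans, OF abs_ge_self] V_le[THEN abs_le_D1] W in auto)
    finally show "(\<integral>\<^sup>+ x. ennreal (U m x) \<partial>M) \<le> ennreal (LINT x|M. W x)" .
  qed
  also have "\<dots> < \<infinity>" by (simp add: Liminf_const)
  finally show int: "integrable M u"
    using u_nn by (intro integrableI_nonneg) auto
  have "(\<lambda>m. LINT x|M. U m x) \<longlonglongrightarrow> (LINT x|M. u x)"
    by (rule integral_dominated_convergence[OF _ _ int]) (use U_lim U_le in auto)
  moreover have "(\<lambda>m. LINT x|M. V m x) \<longlonglongrightarrow> (LINT x|M. v x)"
    by (rule integral_dominated_convergence[OF _ _ W]) (use V_lim V_le in auto)
  ultimately show "(LINT x|M. u x) = (LINT x|M. v x)"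
    unfolding eq by (rule LIMSEQ_unique)
qed

section \<open>Convergence in mean of order \<open>p\<close>\<close>

lemma powr_add_le:
  fixes x y p :: real
  assumes "0 \<le> p" "0 \<le> x" "0 \<le> y"
  shows "(x + y) powr p \<le> 2 powr p * (x powr p + y powr p)"
proof -
  have "(x + y) powr p \<le> (2 * max x y) powr p"
    using assms by (intro powr_mono2) auto
  also have "\<dots> = 2 powr p * max x y powr p"
    using assms by (simp add: powr_mult)
  also have "\<dots> \<le> 2 powr p * (x powr p + y powr p)"
    by (auto simp: max_def)
  finally show ?thesis .
qed

lemma abs_add_powr_le:
  fixes x y p :: real
  assumes "0 \<le> p"
  shows "\<bar>x + y\<bar> powr p \<le> 2 powr p * (\<bar>x\<bar> powr p + \<bar>y\<bar> powr p)"
  using powr_add_le[OF assms, of "\<bar>x\<bar>" "\<bar>y\<bar>"] powr_mono2[OF assms, of "\<bar>x + y\<bar>" "\<bar>x\<bar> + \<bar>y\<bar>"]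
  by (smt (verit) abs_ge_zero abs_triangle_ineq)

lemma abs_diff_powr_le:
  fixes x y p :: real
  assumes "0 \<le> p"
  shows "\<bar>x - y\<bar> powr p \<le> 2 powr p * (\<bar>x\<bar> powr p + \<bar>y\<bar> powr p)"
  using abs_add_powr_le[OF assms, of x "-y"] by simp

lemma tendsto_abs_powr_zero:
  fixes p :: real
  assumes "0 < p" "(f \<longlongrightarrow> (0::real)) F"
  shows "((\<lambda>x. \<bar>f x\<bar> powr p) \<longlongrightarrow> 0) F"
  using tendsto_powr2[OF tendsto_rabs[OF assms(2)] tendsto_const[of p]] assms(1) by simp

lemma tendsto_abs_powr:
  fixes p :: real
  assumes "0 < p" "(f \<longlongrightarrow> (l::real)) F"
  shows "((\<lambda>x. \<bar>f x\<bar> powr p) \<longlongrightarrow> \<bar>l\<bar> powr p) F"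
  using tendsto_powr2[OF tendsto_rabs[OF assms(2)] tendsto_const[of p]] assms(1) by simp

lemma LspaceD:
  assumes "f \<in> Lspace M p"
  shows "f \<in> borel_measurable M" "integrable M (\<lambda>x. \<bar>f x\<bar> powr p)"
  using assms by (auto simp: Lspace_def)

lemma LspaceI:
  "f \<in> borel_measurable M \<Longrightarrow> integrable M (\<lambda>x. \<bar>f x\<bar> powr p) \<Longrightarrow> f \<in> Lspace M p"
  by (auto simp: Lspace_def)

lemma Lspace_bound:
  assumes "integrable M G" "f \<in> borel_measurable M" "AE x in M. \<bar>f x\<bar> powr p \<le> G x"
  shows "f \<in> Lspace M p"
  by (intro LspaceI assms Bochner_Integration.integrable_bound[OF assms(1)])
    (use assms in auto)

lemma Lspace_add:
  assumes "0 \<le> p" "f \<in> Lspace M p" "g \<in> Lspace M p"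
  shows "(\<lambda>x. f x + g x) \<in> Lspace M p"
  by (rule Lspace_bound[where G="\<lambda>x. 2 powr p * (\<bar>f x\<bar> powr p + \<bar>g x\<bar> powr p)"])
    (use assms(1) LspaceD[OF assms(2)] LspaceD[OF assms(3)] abs_add_powr_le[OF assms(1)] in auto)

lemma Lspace_cmult:
  assumes "f \<in> Lspace M p"
  shows "(\<lambda>x. c * f x) \<in> Lspace M p"
  using assms by (auto intro!: LspaceI dest: LspaceD simp: abs_mult powr_mult)

lemma Lspace_diff:
  assumes "0 \<le> p" "f \<in> Lspace M p" "g \<in> Lspace M p"
  shows "(\<lambda>x. f x - g x) \<in> Lspace M p"
  using Lspace_add[OF assms(1,2) Lspace_cmult[OF assms(3), of "-1"]] by simp

lemma Lspace_zero: "(\<lambda>x. 0) \<in> Lspace M p"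
  by (auto intro!: LspaceI)

text \<open>Membership is part of the notion because the Bochner integral of a non-integrable
  function is 0, so the limit alone would be meaningless.\<close>

definition Lpconv :: "'a measure \<Rightarrow> real \<Rightarrow> (nat \<Rightarrow> 'a \<Rightarrow> real) \<Rightarrow> ('a \<Rightarrow> real) \<Rightarrow> bool" where
  "Lpconv M p f g \<longleftrightarrow> (\<forall>j. f j \<in> Lspace M p) \<and> g \<in> Lspace M p \<and>
     (\<lambda>j. LINT x|M. \<bar>f j x - g x\<bar> powr p) \<longlonglongrightarrow> 0"

lemma LpconvD:
  assumes "Lpconv M p f g"
  shows "f j \<in> Lspace M p" "g \<in> Lspace M p" "(\<lambda>j. LINT x|M. \<bar>f j x - g x\<bar> powr p) \<longlonglongrightarrow> 0"
  using assms by (auto simp: Lpconv_def)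

text \<open>The p-th powers are dominated by a multiple of |f j - g|^p + |g|^p, whose first part
  tends to 0 in mean. This turns norm convergence of derivatives into majorants for
  \<open>L1conv_dominated\<close>.\<close>

lemma Lpconv_imp_L1conv_powr:
  assumes p: "0 < p" and f: "Lpconv M p f g" and lim: "AE x in M. (\<lambda>j. f j x) \<longlonglongrightarrow> g x"
  shows "L1conv M (\<lambda>j x. \<bar>f j x\<bar> powr p) (\<lambda>x. \<bar>g x\<bar> powr p)"
proof (rule L1conv_dominated[where G="\<lambda>j x. 2 powr p * (\<bar>f j x - g x\<bar> powr p + \<bar>g x\<bar> powr p)"])
  have [measurable]: "f j \<in> borel_measurable M" "g \<in> borel_measurable M" for j
    using LspaceD(1)[OF LpconvD(1)[OF f]] LspaceD(1)[OF LpconvD(2)[OF f]] by auto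
  have int: "integrable M (\<lambda>x. \<bar>f j x - g x\<bar> powr p)" for j
    by (rule LspaceD(2)[OF Lspace_diff[OF _ LpconvD(1,2)[OF f]]]) (use p in auto)
  have "L1conv M (\<lambda>j x. \<bar>f j x - g x\<bar> powr p) (\<lambda>x. 0)"
    unfolding L1conv_def using int LpconvD(3)[OF f] lim p
    by (auto elim!: eventually_mono intro!: tendsto_abs_powr_zero LIM_zero)
  then show "L1conv M (\<lambda>j x. 2 powr p * (\<bar>f j x - g x\<bar> powr p + \<bar>g x\<bar> powr p))
      (\<lambda>x. 2 powr p * (0 + \<bar>g x\<bar> powr p))"
    by (intro L1conv_cmult L1conv_add L1conv_const LspaceD(2)[OF LpconvD(2)[OF f]])
  show "AE x in M. (\<lambda>j. \<bar>f j x\<bar> powr p) \<longlonglongrightarrow> \<bar>g x\<bar> powr p"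
    using lim by eventually_elim (rule tendsto_abs_powr[OF p])
  show "(\<lambda>x. \<bar>f j x\<bar> powr p) \<in> borel_measurable M" "(\<lambda>x. \<bar>g x\<bar> powr p) \<in> borel_measurable M" for j
    by measurable
  show "AE x in M. \<bar>\<bar>f j x\<bar> powr p\<bar> \<le> 2 powr p * (\<bar>f j x - g x\<bar> powr p + \<bar>g x\<bar> powr p)" for j
    using abs_add_powr_le[of p "f j x - g x" "g x" for x] p by simp
qed

text \<open>Generalised dominated convergence is used twice: for the p-th powers themselves, and
  then for |f j - f'|^p with the majorant built from the first result.\<close>

lemma Lpconv_dominated:
  assumes p: "0 < p" and G: "L1conv M G g"
    and m[measurable]: "\<And>j. f j \<in> borel_measurable M" "f' \<in> borel_measurable M"
    and lim: "AE x in M. (\<lambda>j. f j x) \<longlonglongrightarrow> f' x"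
    and le: "\<And>j. AE x in M. \<bar>f j x\<bar> powr p \<le> G j x"
  shows "Lpconv M p f f'"
proof -
  have L: "L1conv M (\<lambda>j x. \<bar>f j x\<bar> powr p) (\<lambda>x. \<bar>f' x\<bar> powr p)"
    by (rule L1conv_dominated[OF G]) (use lim le in \<open>auto elim!: eventually_mono intro!: tendsto_abs_powr p\<close>)
  have "L1conv M (\<lambda>j x. \<bar>f j x - f' x\<bar> powr p) (\<lambda>x. 0)"
  proof (rule L1conv_dominated[where G="\<lambda>j x. 2 powr p * (\<bar>f j x\<bar> powr p + \<bar>f' x\<bar> powr p)"])
    show "L1conv M (\<lambda>j x. 2 powr p * (\<bar>f j x\<bar> powr p + \<bar>f' x\<bar> powr p))
       (\<lambda>x. 2 powr p * (\<bar>f' x\<bar> powr p + \<bar>f' x\<bar> powr p))"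
      by (intro L1conv_cmult L1conv_add L L1conv_const L1convD(2)[OF L])
    show "AE x in M. (\<lambda>j. \<bar>f j x - f' x\<bar> powr p) \<longlonglongrightarrow> 0"
      using lim by eventually_elim (intro tendsto_abs_powr_zero p LIM_zero)
    show "AE x in M. \<bar>\<bar>f j x - f' x\<bar> powr p\<bar> \<le> 2 powr p * (\<bar>f j x\<bar> powr p + \<bar>f' x\<bar> powr p)" for j
      using abs_diff_powr_le[of p "f j x" "f' x" for x] p by simp
  qed measurable
  from L1convD(4)[OF this] L1convD(1,2)[OF L] show ?thesis
    by (auto simp: Lpconv_def intro!: LspaceI)
qed

text \<open>Since only convergence to 0 is at stake, the quasi-triangle inequality with constant
  \<open>2 powr p\<close> can replace Minkowski's inequality. The lemma later exchanges a sequence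
  for nearby test functions.\<close>

lemma Lpconv_triangle:
  assumes p: "0 < p" and f: "Lpconv M p f g" and h: "\<And>j. h j \<in> Lspace M p"
    and lim: "(\<lambda>j. LINT x|M. \<bar>h j x - f j x\<bar> powr p) \<longlonglongrightarrow> 0"
  shows "Lpconv M p h g"
proof -
  note L = LpconvD(1,2)[OF f]
  note [simp] = LspaceD(2)[OF Lspace_diff[OF less_imp_le[OF p] L]]
    LspaceD(2)[OF Lspace_diff[OF less_imp_le[OF p] h L(1)]]
    LspaceD(2)[OF Lspace_diff[OF less_imp_le[OF p] h L(2)]]
  have lim2: "(\<lambda>j. 2 powr p * ((LINT x|M. \<bar>h j x - f j x\<bar> powr p) + (LINT x|M. \<bar>f j x - g x\<bar> powr p))) \<longlonglongrightarrow> 0"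
    using tendsto_mult_left[OF tendsto_add[OF lim LpconvD(3)[OF f]]] by simp
  have "(\<lambda>j. LINT x|M. \<bar>h j x - g x\<bar> powr p) \<longlonglongrightarrow> 0"
  proof (rule tendsto_sandwich[OF _ _ tendsto_const lim2])
    have "(LINT x|M. \<bar>h j x - g x\<bar> powr p)
        \<le> (LINT x|M. 2 powr p * (\<bar>h j x - f j x\<bar> powr p + \<bar>f j x - g x\<bar> powr p))" for j
    proof (rule integral_mono)
      show "\<bar>h j x - g x\<bar> powr p \<le> 2 powr p * (\<bar>h j x - f j x\<bar> powr p + \<bar>f j x - g x\<bar> powr p)" for x
        using abs_add_powr_le[of p "h j x - f j x" "f j x - g x"] p by auto
    qed auto
    then show "\<forall>\<^sub>F j in sequentially. (LINT x|M. \<bar>h j x - g x\<bar> powr p)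
      \<le> 2 powr p * ((LINT x|M. \<bar>h j x - f j x\<bar> powr p) + (LINT x|M. \<bar>f j x - g x\<bar> powr p))"
      by simp
  qed simp
  then show ?thesis using h L by (simp add: Lpconv_def)
qed

lemma Lpconv_subseq:
  assumes "Lpconv M p f g" "strict_mono r"
  shows "Lpconv M p (\<lambda>j. f (r j)) g"
  using assms LIMSEQ_subseq_LIMSEQ[OF LpconvD(3)[OF assms(1)] assms(2)]
  by (auto simp: Lpconv_def o_def)

lemma Lpconv_AE_subseq:
  assumes p: "0 < p" and f: "Lpconv M p f g"
  obtains r where "strict_mono r" "AE x in M. (\<lambda>j. f (r j) x) \<longlonglongrightarrow> g x"
proof -
  note L = LpconvD(1,2)[OF f]
  have "\<exists>r::nat\<Rightarrow>nat. strict_mono r \<and> (AE x in M. (\<lambda>j. \<bar>f (r j) x - g x\<bar> powr p) \<longlonglongrightarrow> 0)"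
    by (rule tendsto_L1_AE_subseq)
      (use LpconvD(3)[OF f] LspaceD(2)[OF Lspace_diff[OF less_imp_le[OF p] L]] in auto)
  then obtain r where r: "strict_mono r" "AE x in M. (\<lambda>j. \<bar>f (r j) x - g x\<bar> powr p) \<longlonglongrightarrow> 0"
    by blast
  have "AE x in M. (\<lambda>j. f (r j) x) \<longlonglongrightarrow> g x"
    using r(2)
  proof eventually_elim
    case (elim x)
    have "(\<lambda>j. \<bar>f (r j) x - g x\<bar>) \<longlonglongrightarrow> 0"
      using tendsto_abs_powr_zero[of "1/p", OF _ elim] p by (simp add: powr_powr)
    then show ?case by (simp add: LIM_zero_iff tendsto_rabs_zero_iff)
  qed
  with r show ?thesis using that by blast
qed

text \<open>All derivatives up to order k must converge a.e. along one and the same subsequence; the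
  induction thins it once for each index.\<close>

lemma Lpconv_AE_subseq_finite:
  assumes "finite A" "0 < p" "\<And>i. i \<in> A \<Longrightarrow> Lpconv M p (f i) (g i)"
  obtains r where "strict_mono r" "\<And>i. i \<in> A \<Longrightarrow> AE x in M. (\<lambda>j. f i (r j) x) \<longlonglongrightarrow> g i x"
proof -
  have "\<exists>r::nat\<Rightarrow>nat. strict_mono r \<and> (\<forall>i\<in>A. AE x in M. (\<lambda>j. f i (r j) x) \<longlonglongrightarrow> g i x)"
    using assms(1,3)
  proof (induction A rule: finite_induct)
    case empty
    show ?case using strict_mono_id by blast
  next
    case (insert i A)
    have "\<exists>r::nat\<Rightarrow>nat. strict_mono r \<and> (\<forall>i\<in>A. AE x in M. (\<lambda>j. f i (r j) x) \<longlonglongrightarrow> g i x)"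
      by (rule insert.IH) (rule insert.prems, rule insertI2)
    then obtain r :: "nat \<Rightarrow> nat" where r: "strict_mono r" "\<forall>i\<in>A. AE x in M. (\<lambda>j. f i (r j) x) \<longlonglongrightarrow> g i x"
      by blast
    have "Lpconv M p (\<lambda>j. f i (r j)) (g i)"
      by (rule Lpconv_subseq[OF insert.prems[OF insertI1] r(1)])
    then obtain r' where r': "strict_mono r'" "AE x in M. (\<lambda>j. f i (r (r' j)) x) \<longlonglongrightarrow> g i x"
      by (rule Lpconv_AE_subseq[OF assms(2)])
    have "AE x in M. (\<lambda>j. f i' (r (r' j)) x) \<longlonglongrightarrow> g i' x" if "i' \<in> insert i A" for i'
    proof (cases "i' = i")
      case False
      with that r have "AE x in M. (\<lambda>j. f i' (r j) x) \<longlonglongrightarrow> g i' x" by auto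
      then show ?thesis
        by eventually_elim (use LIMSEQ_subseq_LIMSEQ[OF _ r'(1)] in \<open>auto simp: o_def\<close>)
    qed (use r' in auto)
    moreover have "strict_mono (\<lambda>j. r (r' j))"
      using strict_mono_o[OF r(1) r'(1)] by (simp add: o_def)
    ultimately show ?case by (intro exI[of _ "\<lambda>j. r (r' j)"] conjI ballI)
  qed
  then show ?thesis using that by blast
qed

section \<open>The deformed exponential\<close>

lemma log_d_strict_mono: "strict_mono_on {0<..} log_d"
  by (auto simp: strict_mono_on_def log_d_def intro!: add_strict_mono)

lemma log_d_inj: "inj_on log_d {0<..}"
  using log_d_strict_mono strict_mono_on_imp_inj_on by blast

lemma log_d_surj: "\<exists>y>0. log_d y = x"
proof -
  \<comment> \<open>Endpoints for the intermediate value theorem: the logarithm alone contributes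
    -|x| - 1 and |x| + 1, and the linear part y - 1 has the helpful sign at each end.\<close>
  define a where "a = exp (- \<bar>x\<bar> - 1)"
  define b where "b = exp (\<bar>x\<bar> + 1)"
  have a: "0 < a" "a \<le> b" "a \<le> 1" "b \<ge> 1" by (auto simp: a_def b_def)
  have "log_d a = a - 1 + (- \<bar>x\<bar> - 1)" by (simp add: log_d_def a_def)
  then have "log_d a \<le> x" using a by simp
  moreover have "log_d b = b - 1 + (\<bar>x\<bar> + 1)" by (simp add: log_d_def b_def)
  then have "x \<le> log_d b" using a by simp
  moreover have "continuous_on {a..b} log_d"
    unfolding log_d_def using a by (intro continuous_intros) auto
  ultimately obtain y where "a \<le> y" "y \<le> b" "log_d y = x"
    using IVT'[of log_d a x b] a by auto
  then show ?thesis using a by (intro exI[of _ y]) auto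
qed

lemma psi_pos: "0 < psi x" and log_d_psi: "log_d (psi x) = x"
proof -
  obtain y where y: "y > 0" "log_d y = x" using log_d_surj by blast
  then have "psi x = y" unfolding psi_def using the_inv_into_f_f[OF log_d_inj, of y] by auto
  then show "0 < psi x" "log_d (psi x) = x" using y by auto
qed

lemma psi_has_real_derivative:
  "(psi has_real_derivative psi x / (1 + psi x)) (at x)"
proof -
  have D: "(log_d has_real_derivative 1 + 1 / y) (at y)" if "y > 0" for y
    unfolding log_d_def using that by (auto intro!: derivative_eq_intros)
  have "(psi has_real_derivative inverse (1 + 1 / psi x)) (at x)"
  proof (rule DERIV_inverse_function[where f=log_d and a="x - 1" and b="x + 1"])
    show "(log_d has_real_derivative 1 + 1 / psi x) (at (psi x))"
      by (rule D[OF psi_pos])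
    show "1 + 1 / psi x \<noteq> 0" using psi_pos[of x] by (smt (verit) divide_pos_pos)
    show "isCont psi x"
    proof -
      have "isCont psi (log_d (psi x))"
      proof (rule isCont_inverse_function2[where f=log_d and x="psi x" and a="psi x / 2" and b="2 * psi x"])
        fix z assume z: "psi x / 2 \<le> z" "z \<le> 2 * psi x"
        then have z0: "z > 0" using psi_pos[of x] by simp
        then show "psi (log_d z) = z"
          unfolding psi_def using the_inv_into_f_f[OF log_d_inj, of z] by auto
        show "isCont log_d z" using DERIV_isCont[OF D[OF z0]] .
      qed (use psi_pos[of x] in auto)
      then show ?thesis by (simp add: log_d_psi)
    qed
  qed (auto simp: log_d_psi)
  moreover have "inverse (1 + 1 / psi x) = psi x / (1 + psi x)"
    using psi_pos[of x] by (simp add: divide_simps)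
  ultimately show ?thesis by simp
qed

text \<open>With \<open>\<sigma> = 1 / (1 + \<psi>)\<close> one has \<open>\<psi>' = 1 - \<sigma>\<close> and \<open>\<sigma>' = -\<sigma>\<^sup>2 (1 - \<sigma>)\<close>, so every derivative
  of \<open>\<psi>\<close> is a polynomial in \<open>\<sigma>\<close>.\<close>

definition psi_sigma :: "real \<Rightarrow> real" where
  "psi_sigma x = 1 / (1 + psi x)"

text \<open>There is a shift by one: \<open>psi_poly n\<close> belongs to the derivative of order n
  + 1, since \<psi> = 1/\<sigma> - 1 is itself no polynomial in \<sigma>. The factor
  \<open>[:0, 0, -1, 1:]\<close> is \<sigma>' as a polynomial in \<sigma>.\<close>

fun psi_poly :: "nat \<Rightarrow> real poly" where
  "psi_poly 0 = [:1, -1:]"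
| "psi_poly (Suc n) = [:0, 0, -1, 1:] * pderiv (psi_poly n)"

fun psi_deriv :: "nat \<Rightarrow> real \<Rightarrow> real" where
  "psi_deriv 0 x = psi x"
| "psi_deriv (Suc n) x = poly (psi_poly n) (psi_sigma x)"

lemma psi_sigma_bounds: "0 < psi_sigma x" "psi_sigma x < 1"
  using psi_pos[of x] by (auto simp: psi_sigma_def divide_simps)

lemma psi_sigma_has_real_derivative:
  "(psi_sigma has_real_derivative - (psi_sigma x)\<^sup>2 * (1 - psi_sigma x)) (at x)"
proof -
  have "1 + psi x \<noteq> 0" using psi_pos[of x] by simp
  then show ?thesis
    unfolding psi_sigma_def
    by (auto intro!: derivative_eq_intros psi_has_real_derivative simp: divide_simps power2_eq_square)
qed

lemma psi_deriv_has_real_derivative: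
  "(psi_deriv n has_real_derivative psi_deriv (Suc n) x) (at x)"
proof (cases n)
  case 0
  have "psi x / (1 + psi x) = psi_deriv (Suc 0) x"
    using psi_pos[of x] by (simp add: psi_sigma_def divide_simps)
  then show ?thesis using psi_has_real_derivative[of x] 0 by (simp del: psi_deriv.simps(2) add: psi_deriv.simps(1)[abs_def])
next
  case (Suc m)
  have "((\<lambda>x. poly (psi_poly m) (psi_sigma x)) has_real_derivative
     poly (pderiv (psi_poly m)) (psi_sigma x) * (- (psi_sigma x)\<^sup>2 * (1 - psi_sigma x))) (at x)"
    by (rule DERIV_chain2[OF poly_DERIV psi_sigma_has_real_derivative])
  then show ?thesis
    by (simp add: Suc psi_deriv.simps(2)[abs_def] algebra_simps power2_eq_square)
qed

lemma continuous_psi_deriv: "continuous_on A (psi_deriv n)"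
  using psi_deriv_has_real_derivative by (meson DERIV_isCont continuous_at_imp_continuous_on)

lemma psi_deriv_1_bounds: "0 \<le> psi_deriv 1 x" "psi_deriv 1 x \<le> 1"
  using psi_sigma_bounds[of x] by auto

lemma psi_deriv_2: "psi_deriv 2 x = (psi_sigma x)\<^sup>2 * (1 - psi_sigma x)"
  by (simp add: numeral_2_eq_2 pderiv_pCons algebra_simps power2_eq_square)

lemma psi_deriv_2_bounds: "0 \<le> psi_deriv 2 x" "psi_deriv 2 x \<le> 1"
  using psi_sigma_bounds[of x] unfolding psi_deriv_2
  by (auto intro!: mult_nonneg_nonneg mult_le_one power_le_one)

lemma poly_unit_interval_bounded:
  obtains K :: real where "K > 0" "\<And>s. 0 \<le> s \<Longrightarrow> s \<le> 1 \<Longrightarrow> \<bar>poly p s\<bar> \<le> K"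
proof -
  have "bounded (poly p ` {0..1})"
    by (intro compact_imp_bounded compact_continuous_image continuous_intros) auto
  then obtain K where K: "K > 0" "\<forall>y\<in>poly p ` {0..1}. norm y \<le> K"
    by (auto simp: bounded_pos)
  show ?thesis by (rule that[OF K(1)]) (use K(2) in auto)
qed

lemma psi_deriv_Suc_bounded:
  obtains K where "K > 0" "\<And>x. \<bar>psi_deriv (Suc m) x\<bar> \<le> K"
proof -
  obtain K where K: "K > 0" "\<And>s. 0 \<le> s \<Longrightarrow> s \<le> 1 \<Longrightarrow> \<bar>poly (psi_poly m) s\<bar> \<le> K"
    using poly_unit_interval_bounded by blast
  show ?thesis
    by (rule that[OF K(1)]) (use K(2) psi_sigma_bounds in \<open>auto simp: less_imp_le\<close>)
qed

text \<open>From order two on, each derivative carries the factor \<sigma>' = -\<psi>'', and the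
  remaining polynomial in \<sigma> is bounded because \<sigma> stays in the unit interval.\<close>

lemma psi_deriv_le_psi_deriv_2:
  assumes "2 \<le> m"
  obtains K where "K > 0" "\<And>x. \<bar>psi_deriv m x\<bar> \<le> K * psi_deriv 2 x"
proof -
  obtain n where n: "m = Suc (Suc n)" using assms by (metis numeral_2_eq_2 Suc_le_D Suc_le_mono)
  obtain K where K: "K > 0" "\<And>s. 0 \<le> s \<Longrightarrow> s \<le> 1 \<Longrightarrow> \<bar>poly (pderiv (psi_poly n)) s\<bar> \<le> K"
    using poly_unit_interval_bounded by blast
  show ?thesis
  proof (rule that[OF K(1)])
    fix x
    let ?s = "psi_sigma x"
    have "psi_deriv m x = - (psi_deriv 2 x * poly (pderiv (psi_poly n)) ?s)"
      unfolding psi_deriv_2 by (simp add: n algebra_simps power2_eq_square)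
    then have "\<bar>psi_deriv m x\<bar> = psi_deriv 2 x * \<bar>poly (pderiv (psi_poly n)) ?s\<bar>"
      using psi_deriv_2_bounds(1)[of x] by (simp add: abs_mult)
    also have "\<dots> \<le> psi_deriv 2 x * K"
      using psi_deriv_2_bounds(1)[of x] K(2)[of ?s] psi_sigma_bounds[of x]
      by (intro mult_left_mono) auto
    finally show "\<bar>psi_deriv m x\<bar> \<le> K * psi_deriv 2 x" by (simp add: mult.commute)
  qed
qed

lemma psi_lipschitz: "\<bar>psi x - psi y\<bar> \<le> \<bar>x - y\<bar>"
proof -
  have "norm (psi x - psi y) \<le> 1 * norm (x - y)"
  proof (rule field_differentiable_bound[of UNIV])
    show "(psi has_field_derivative psi_deriv 1 z) (at z within UNIV)" for z
      using psi_deriv_has_real_derivative[of 0 z] by (simp add: psi_deriv.simps(1)[abs_def])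
    show "norm (psi_deriv 1 z) \<le> 1" for z
      using psi_deriv_1_bounds[of z] unfolding real_norm_def by linarith
  qed auto
  then show ?thesis by simp
qed

lemma psi_abs_le: "\<bar>psi x\<bar> \<le> psi 0 + \<bar>x\<bar>"
  using psi_lipschitz[of x 0] psi_pos[of 0] by linarith

lemma psi_deriv_measurable[measurable]: "psi_deriv n \<in> borel_measurable borel"
  by (intro borel_measurable_continuous_onI continuous_psi_deriv)

section \<open>Families of partial derivatives\<close>

definition mi_inc :: "'n \<Rightarrow> ('n \<Rightarrow> nat) \<Rightarrow> 'n \<Rightarrow> nat" where
  "mi_inc i s = s(i := Suc (s i))"

lemma mi_inc_apply: "mi_inc i s j = (if j = i then Suc (s j) else s j)"
  by (simp add: mi_inc_def)

lemma mi_order_0 [simp]: "mi_order (\<lambda>_. 0) = 0"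
  by (simp add: mi_order_def)

lemma mi_order_inc [simp]: "mi_order (mi_inc i s) = Suc (mi_order s)"
proof -
  have "mi_order (mi_inc i s) = (\<Sum>j\<in>UNIV. s j + (if j = i then 1 else 0))"
    unfolding mi_order_def by (intro sum.cong) (auto simp: mi_inc_apply)
  then show ?thesis by (simp add: sum.distrib mi_order_def)
qed

lemma mi_order_eq_0: "mi_order s = 0 \<longleftrightarrow> s = (\<lambda>_. 0)"
  by (auto simp: mi_order_def)

lemma mi_cases:
  fixes s :: "'n::finite \<Rightarrow> nat"
  obtains "s = (\<lambda>_. 0)" | i u where "s = mi_inc i u"
proof (cases "s = (\<lambda>_. 0)")
  case False
  then obtain i where "s i \<noteq> 0" by auto
  then have "s = mi_inc i (s(i := s i - 1))" by (auto simp: mi_inc_apply)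
  then show ?thesis using that by blast
qed (use that in auto)

lemma mi_induct [case_names zero inc]:
  fixes s :: "'n::finite \<Rightarrow> nat"
  assumes "P (\<lambda>_. 0)" "\<And>i s. P s \<Longrightarrow> P (mi_inc i s)"
  shows "P s"
proof (induction "mi_order s" arbitrary: s)
  case 0
  then show ?case using assms(1) mi_order_eq_0[of s] by simp
next
  case (Suc n)
  show ?case
  proof (cases s rule: mi_cases)
    case (2 i u)
    then show ?thesis using Suc.hyps(1)[of u] Suc.hyps(2) assms(2) by simp
  qed (use assms in auto)
qed

lemma all_derivsD:
  assumes "all_derivs \<phi> \<Phi>"
  shows "\<Phi> (\<lambda>_. 0) = \<phi>"
    "(\<Phi> s has_derivative (\<lambda>h. \<Sum>i\<in>UNIV. h $ i * \<Phi> (mi_inc i s) x)) (at x)"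
  using assms by (auto simp: all_derivs_def mi_inc_def)

lemma all_derivsI:
  assumes "\<Phi> (\<lambda>_. 0) = \<phi>"
    "\<And>s x. (\<Phi> s has_derivative (\<lambda>h. \<Sum>i\<in>UNIV. h $ i * \<Phi> (mi_inc i s) x)) (at x)"
  shows "all_derivs \<phi> \<Phi>"
  using assms by (auto simp: all_derivs_def mi_inc_def)

lemma all_derivs_shift:
  assumes "all_derivs \<phi> \<Phi>"
  shows "all_derivs (\<Phi> u) (\<lambda>s. \<Phi> (\<lambda>j. s j + u j))"
proof -
  have "(\<lambda>j. (mi_inc i s) j + u j) = mi_inc i (\<lambda>j. s j + u j)" for i s by (auto simp: mi_inc_apply)
  with all_derivsD(2)[OF assms] show ?thesis by (intro all_derivsI) auto
qed

lemma all_derivs_continuous: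
  assumes "all_derivs \<phi> \<Phi>"
  shows "continuous_on A (\<Phi> s)"
  using all_derivsD(2)[OF assms]
  by (meson has_derivative_continuous continuous_at_imp_continuous_on)

lemma all_derivs_measurable:
  assumes "all_derivs \<phi> \<Phi>"
  shows "\<Phi> s \<in> borel_measurable borel" "\<Phi> s \<in> borel_measurable lebesgue"
  using borel_measurable_continuous_onI[OF all_derivs_continuous[OF assms, of UNIV s]]
  by (auto intro: measurable_completion)

text \<open>Integration by parts in one direction needs no more than this derivative along an axis.
  Products and compositions stay within the notion without building a full family for
  \<open>all_derivs\<close>.\<close>

definition has_partial :: "'n \<Rightarrow> (real ^ 'n \<Rightarrow> real) \<Rightarrow> (real ^ 'n \<Rightarrow> real) \<Rightarrow> bool" where
  "has_partial i G G' \<longleftrightarrow> (\<forall>x. ((\<lambda>t. G (x + t *\<^sub>R axis i 1)) has_real_derivative G' x) (at 0))"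

lemma sum_axis: "(\<Sum>j\<in>UNIV. axis i 1 $ j * f j) = (f i :: real)"
proof -
  have "(\<Sum>j\<in>UNIV. axis i 1 $ j * f j) = (\<Sum>j\<in>UNIV. if j = i then f j else 0)"
    by (intro sum.cong) (auto simp: axis_def)
  then show ?thesis by simp
qed

lemma all_derivs_partial:
  assumes "all_derivs \<phi> \<Phi>"
  shows "has_partial i (\<Phi> s) (\<Phi> (mi_inc i s))"
  unfolding has_partial_def
proof
  fix x
  have 1: "((\<lambda>t. x + t *\<^sub>R axis i (1::real)) has_derivative (\<lambda>t. t *\<^sub>R axis i 1)) (at 0)"
    by (auto intro!: derivative_eq_intros)
  have "((\<lambda>t. \<Phi> s (x + t *\<^sub>R axis i 1)) has_derivative
      (\<lambda>t. \<Sum>j\<in>UNIV. (t *\<^sub>R axis i 1) $ j * \<Phi> (mi_inc j s) x)) (at 0)"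
    by (rule has_derivative_compose[OF 1, of "\<Phi> s"]) (use all_derivsD(2)[OF assms, of s x] in simp)
  moreover have "(\<lambda>t. \<Sum>j\<in>UNIV. (t *\<^sub>R axis i 1) $ j * \<Phi> (mi_inc j s) x) = (*) (\<Phi> (mi_inc i s) x)"
  proof
    fix t
    have "(\<Sum>j\<in>UNIV. (t *\<^sub>R axis i 1) $ j * \<Phi> (mi_inc j s) x)
        = t * (\<Sum>j\<in>UNIV. axis i 1 $ j * \<Phi> (mi_inc j s) x)"
      by (simp add: sum_distrib_left mult.assoc)
    then show "(\<Sum>j\<in>UNIV. (t *\<^sub>R axis i 1) $ j * \<Phi> (mi_inc j s) x) = \<Phi> (mi_inc i s) x * t"
      using sum_axis[of i "\<lambda>j. \<Phi> (mi_inc j s) x"] by simp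
  qed
  ultimately show "((\<lambda>t. \<Phi> s (x + t *\<^sub>R axis i 1)) has_real_derivative \<Phi> (mi_inc i s) x) (at 0)"
    by (simp add: has_field_derivative_def)
qed

lemma all_derivs_outside:
  assumes A: "all_derivs \<phi> \<Phi>" and U: "open U" and z: "\<And>x. x \<in> U \<Longrightarrow> \<phi> x = 0"
  shows "x \<in> U \<Longrightarrow> \<Phi> s x = 0"
proof (induction s arbitrary: x rule: mi_induct)
  case zero
  then show ?case using all_derivsD(1)[OF A] z by simp
next
  case (inc i s)
  have "(\<Phi> s has_derivative (\<lambda>h. 0)) (at x)"
    by (rule has_derivative_transform_within_open[OF has_derivative_const[of 0] U inc.prems])
      (simp add: inc.IH)
  from has_derivative_unique[OF this all_derivsD(2)[OF A, of s x]]
  have "(\<Sum>j\<in>UNIV. axis i 1 $ j * \<Phi> (mi_inc j s) x) = 0" by (rule fun_cong[symmetric])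
  then show ?case by (simp add: sum_axis)
qed

lemma compact_closure_iff_bounded:
  "compact (closure {x :: real ^ 'n. f x \<noteq> (0::real)}) \<longleftrightarrow> (\<exists>R. \<forall>x. f x \<noteq> 0 \<longrightarrow> norm x \<le> R)"
proof
  assume "compact (closure {x. f x \<noteq> 0})"
  then have "bounded {x. f x \<noteq> 0}" by (rule bounded_subset[OF compact_imp_bounded closure_subset])
  then show "\<exists>R. \<forall>x. f x \<noteq> 0 \<longrightarrow> norm x \<le> R" by (auto simp: bounded_iff)
next
  assume "\<exists>R. \<forall>x. f x \<noteq> 0 \<longrightarrow> norm x \<le> R"
  then have "bounded {x. f x \<noteq> 0}" by (auto simp: bounded_iff)
  then show "compact (closure {x. f x \<noteq> 0})" by (simp add: compact_closure)
qed

lemma bounded_of_compact_support: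
  fixes f :: "real ^ 'n \<Rightarrow> real"
  assumes "continuous_on UNIV f" "compact (closure {x. f x \<noteq> 0})"
  obtains B where "B > 0" "\<And>x. \<bar>f x\<bar> \<le> B"
proof -
  have "bounded (f ` closure {x. f x \<noteq> 0})"
    by (intro compact_imp_bounded compact_continuous_image continuous_on_subset[OF assms(1)] assms(2)) auto
  then obtain B where B: "B > 0" "\<And>y. y \<in> f ` closure {x. f x \<noteq> 0} \<Longrightarrow> norm y \<le> B"
    by (auto simp: bounded_pos)
  have "\<bar>f x\<bar> \<le> B" for x
  proof (cases "f x = 0")
    case False
    then have "x \<in> closure {x. f x \<noteq> 0}" by (intro subsetD[OF closure_subset]) simp
    then show ?thesis using B(2)[of "f x"] by auto
  qed (use B in auto)
  then show ?thesis using that B by blast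
qed

lemma all_derivs_cmult:
  assumes "all_derivs \<phi> \<Phi>"
  shows "all_derivs (\<lambda>x. c * \<phi> x) (\<lambda>s x. c * \<Phi> s x)"
proof (rule all_derivsI)
  show "(\<lambda>x. c * \<Phi> (\<lambda>_. 0) x) = (\<lambda>x. c * \<phi> x)" by (simp add: all_derivsD(1)[OF assms])
  show "((\<lambda>x. c * \<Phi> s x) has_derivative (\<lambda>h. \<Sum>i\<in>UNIV. h $ i * (c * \<Phi> (mi_inc i s) x))) (at x)" for s x
    using has_derivative_mult_right[OF all_derivsD(2)[OF assms, of s x], of c]
    by (simp add: sum_distrib_left algebra_simps)
qed

text \<open>Three uses: r = -1 reflects a convolution kernel, a large r shrinks a bump to a
  mollifier, and a small r stretches a bump to a cutoff whose derivatives are small.\<close>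

lemma all_derivs_affine:
  assumes "all_derivs \<phi> \<Phi>"
  shows "all_derivs (\<lambda>x. \<phi> (a + r *\<^sub>R x)) (\<lambda>s x. r ^ mi_order s * \<Phi> s (a + r *\<^sub>R x))"
proof (rule all_derivsI)
  show "(\<lambda>x. r ^ mi_order (\<lambda>_. 0) * \<Phi> (\<lambda>_. 0) (a + r *\<^sub>R x)) = (\<lambda>x. \<phi> (a + r *\<^sub>R x))"
    by (simp add: all_derivsD(1)[OF assms])
  fix s x
  have 1: "((\<lambda>x. a + r *\<^sub>R x) has_derivative (\<lambda>h. r *\<^sub>R h)) (at x)"
    by (auto intro!: derivative_eq_intros)
  have "((\<lambda>x. r ^ mi_order s * \<Phi> s (a + r *\<^sub>R x)) has_derivative
      (\<lambda>h. r ^ mi_order s * (\<Sum>i\<in>UNIV. (r *\<^sub>R h) $ i * \<Phi> (mi_inc i s) (a + r *\<^sub>R x)))) (at x)"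
    by (intro has_derivative_mult_right has_derivative_compose[OF 1 all_derivsD(2)[OF assms]])
  then show "((\<lambda>x. r ^ mi_order s * \<Phi> s (a + r *\<^sub>R x)) has_derivative
      (\<lambda>h. \<Sum>i\<in>UNIV. h $ i * (r ^ mi_order (mi_inc i s) * \<Phi> (mi_inc i s) (a + r *\<^sub>R x)))) (at x)"
    by (simp add: sum_distrib_left algebra_simps)
qed

section \<open>The Leibniz rule for multi-indices\<close>

definition mi_binom :: "('n::finite \<Rightarrow> nat) \<Rightarrow> ('n \<Rightarrow> nat) \<Rightarrow> real" where
  "mi_binom s u = (\<Prod>j\<in>UNIV. real (s j choose u j))"

lemma mi_binom_0 [simp]: "mi_binom s (\<lambda>_. 0) = 1"
  by (simp add: mi_binom_def)

lemma finite_mi_le: "finite {u :: 'n::finite \<Rightarrow> nat. u \<le> s}"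
proof (rule finite_subset)
  have "u j \<le> mi_order s" if "u \<le> s" for u j
    using that member_le_sum[of j UNIV s] by (auto simp: le_fun_def mi_order_def intro: order_trans)
  then have "mi_order u \<le> mi_order s" if "u \<le> s" for u
    using that by (auto simp: mi_order_def le_fun_def intro: sum_mono)
  then show "{u. u \<le> s} \<subseteq> {u. mi_order u \<le> mi_order s}" by auto
qed (rule finite_mi_order_le)

text \<open>Pascal's rule in coordinate i. The case distinction keeps the natural subtraction
  \<open>u i - 1\<close> from truncating at 0.\<close>

lemma mi_binom_inc:
  "mi_binom (mi_inc i s) u = mi_binom s u + (if u i = 0 then 0 else mi_binom s (u(i := u i - 1)))"
proof -
  define R where "R = (\<Prod>j\<in>UNIV - {i}. real (s j choose u j))"
  have eq: "mi_binom s' u' = real (s' i choose u' i) * R"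
    if "\<And>j. j \<noteq> i \<Longrightarrow> s' j = s j" "\<And>j. j \<noteq> i \<Longrightarrow> u' j = u j" for s' u'
    unfolding mi_binom_def R_def by (subst prod.remove[of _ i]) (use that in auto)
  show ?thesis
    by (cases "u i") (simp_all add: eq distrib_right mi_inc_apply)
qed

lemma mi_binom_eq_0: "u i > s i \<Longrightarrow> mi_binom s u = 0"
  unfolding mi_binom_def by (rule prod_zero) (auto intro!: bexI[of _ i])

text \<open>A closed formula is used because \<open>all_derivs\<close> asks for the entire family of
  derivatives at once.\<close>

definition leibniz :: "(('n::finite \<Rightarrow> nat) \<Rightarrow> 'a \<Rightarrow> real) \<Rightarrow> (('n \<Rightarrow> nat) \<Rightarrow> 'a \<Rightarrow> real) \<Rightarrow>
    ('n \<Rightarrow> nat) \<Rightarrow> 'a \<Rightarrow> real" where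
  "leibniz A B s x = (\<Sum>u | u \<le> s. mi_binom s u * (A u x * B (s - u) x))"

text \<open>Pascal's rule splits the sum in two. In the first, the terms outside u \<le> s vanish
  with their binomials; in the second, the shift of u by one in coordinate i is a bijection onto the
  same range. Each half lets one factor take the derivative.\<close>

lemma leibniz_inc:
  "leibniz A B (mi_inc i s) x =
    (\<Sum>u | u \<le> s. mi_binom s u * (A (mi_inc i u) x * B (s - u) x + A u x * B (mi_inc i (s - u)) x))"
proof -
  let ?S = "{u. u \<le> mi_inc i s}"
  define f where "f u = A u x * B (mi_inc i s - u) x" for u
  have le: "u \<le> mi_inc i s" if "u \<le> s" for u
    using that by (auto simp: le_fun_def mi_inc_apply intro: le_SucI)
  have "leibniz A B (mi_inc i s) x = (\<Sum>u\<in>?S. mi_binom s u * f u) +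
      (\<Sum>u\<in>?S. if u i = 0 then 0 else mi_binom s (u(i := u i - 1)) * f u)"
    unfolding leibniz_def f_def sum.distrib[symmetric]
    by (intro sum.cong) (auto simp: mi_binom_inc distrib_right)
  also have "(\<Sum>u\<in>?S. mi_binom s u * f u) = (\<Sum>u | u \<le> s. mi_binom s u * f u)"
  proof (rule sum.mono_neutral_right)
    show "\<forall>u\<in>?S - {u. u \<le> s}. mi_binom s u * f u = 0"
    proof
      fix u assume "u \<in> ?S - {u. u \<le> s}"
      then obtain j where "s j < u j" by (auto simp: le_fun_def not_le)
      then show "mi_binom s u * f u = 0" by (simp add: mi_binom_eq_0)
    qed
  qed (use le finite_mi_le in auto)
  also have "\<dots> = (\<Sum>u | u \<le> s. mi_binom s u * (A u x * B (mi_inc i (s - u)) x))"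
  proof (rule sum.cong)
    fix u assume "u \<in> {u. u \<le> s}"
    then have "mi_inc i s - u = mi_inc i (s - u)" by (auto simp: le_fun_def Suc_diff_le mi_inc_apply fun_eq_iff)
    then show "mi_binom s u * f u = mi_binom s u * (A u x * B (mi_inc i (s - u)) x)"
      by (simp add: f_def)
  qed simp
  also have "(\<Sum>u\<in>?S. if u i = 0 then 0 else mi_binom s (u(i := u i - 1)) * f u)
      = (\<Sum>u\<in>{u\<in>?S. u i \<noteq> 0}. mi_binom s (u(i := u i - 1)) * f u)"
    using finite_mi_le by (subst sum.inter_filter) (auto intro!: sum.cong)
  also have "\<dots> = (\<Sum>u | u \<le> s. mi_binom s u * (A (mi_inc i u) x * B (s - u) x))"
  proof (rule sum.reindex_bij_witness[where i="mi_inc i" and j="\<lambda>u. u(i := u i - 1)"])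
    fix u assume "u \<in> {u\<in>?S. u i \<noteq> 0}"
    then have u: "u \<le> mi_inc i s" "u i \<noteq> 0" by auto
    have inc: "mi_inc i (u(i := u i - 1)) = u" using u(2) by (auto simp: mi_inc_apply)
    then show "mi_inc i (u(i := u i - 1)) = u" .
    show "u(i := u i - 1) \<in> {u. u \<le> s}"
    proof -
      have le: "u j \<le> mi_inc i s j" for j using u(1) by (simp add: le_fun_def)
      have "(u(i := u i - 1)) j \<le> s j" for j
        using le[of j] by (cases "j = i") (auto simp: mi_inc_apply)
      then show ?thesis by (simp add: le_fun_def)
    qed
    have "mi_inc i s - u = s - u(i := u i - 1)" using u(2) by (auto simp: fun_eq_iff mi_inc_apply)
    then show "mi_binom s (u(i := u i - 1)) *
        (A (mi_inc i (u(i := u i - 1))) x * B (s - u(i := u i - 1)) x) = mi_binom s (u(i := u i - 1)) * f u"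
      by (simp only: f_def inc)
  next
    fix u assume "u \<in> {u. u \<le> s}"
    then show "mi_inc i u \<in> {u \<in> ?S. u i \<noteq> 0}" "(mi_inc i u)(i := mi_inc i u i - 1) = u"
      by (auto simp: le_fun_def mi_inc_apply)
  qed
  finally have eq: "leibniz A B (mi_inc i s) x =
      (\<Sum>u | u \<le> s. mi_binom s u * (A u x * B (mi_inc i (s - u)) x)) +
      (\<Sum>u | u \<le> s. mi_binom s u * (A (mi_inc i u) x * B (s - u) x))" .
  show ?thesis
    unfolding eq sum.distrib[symmetric] by (intro sum.cong refl) (simp add: distrib_left)
qed

lemma all_derivs_mult:
  assumes f: "all_derivs f A" and g: "all_derivs g B"
  shows "all_derivs (\<lambda>x. f x * g x) (leibniz A B)"
proof (rule all_derivsI)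
  have "{u :: 'a \<Rightarrow> nat. u \<le> (\<lambda>_. 0)} = {\<lambda>_. 0}" by (auto simp: le_fun_def)
  then show "leibniz A B (\<lambda>_. 0) = (\<lambda>x. f x * g x)"
    using all_derivsD(1)[OF f] all_derivsD(1)[OF g] by (auto simp: leibniz_def fun_diff_def)
  fix s x
  let ?DA = "\<lambda>u h. \<Sum>i\<in>UNIV. h $ i * A (mi_inc i u) x"
  let ?DB = "\<lambda>u h. \<Sum>i\<in>UNIV. h $ i * B (mi_inc i u) x"
  have "((\<lambda>x. \<Sum>u | u \<le> s. mi_binom s u * (A u x * B (s - u) x)) has_derivative
      (\<lambda>h. \<Sum>u | u \<le> s. mi_binom s u * (A u x * ?DB (s - u) h + ?DA u h * B (s - u) x))) (at x)"
    by (intro has_derivative_sum has_derivative_mult_right has_derivative_mult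
        all_derivsD(2)[OF f] all_derivsD(2)[OF g])
  moreover have "(\<Sum>u | u \<le> s. mi_binom s u * (A u x * ?DB (s - u) h + ?DA u h * B (s - u) x))
      = (\<Sum>i\<in>UNIV. h $ i * leibniz A B (mi_inc i s) x)" for h
    unfolding leibniz_inc sum_distrib_left
    by (subst sum.swap) (simp add: sum_distrib_left sum_distrib_right sum.distrib algebra_simps)
  ultimately show "(leibniz A B s has_derivative (\<lambda>h. \<Sum>i\<in>UNIV. h $ i * leibniz A B (mi_inc i s) x)) (at x)"
    unfolding leibniz_def[of A B s, abs_def] by simp
qed

lemma all_derivs_coord:
  fixes F :: "nat \<Rightarrow> real \<Rightarrow> real" and i :: "'n::finite"
  assumes F: "\<And>n x. (F n has_real_derivative F (Suc n) x) (at x)"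
  shows "all_derivs (\<lambda>x. F 0 (x $ i)) (\<lambda>s x. if \<forall>j. j \<noteq> i \<longrightarrow> s j = 0 then F (s i) (x $ i) else 0)"
proof (rule all_derivsI)
  fix s :: "'n \<Rightarrow> nat" and x :: "real ^ 'n"
  let ?\<Phi> = "\<lambda>s (x::real^'n). if \<forall>j. j \<noteq> i \<longrightarrow> s j = 0 then F (s i) (x $ i) else 0"
  show "(?\<Phi> s has_derivative (\<lambda>h. \<Sum>j\<in>UNIV. h $ j * ?\<Phi> (mi_inc j s) x)) (at x)"
  proof (cases "\<forall>j. j \<noteq> i \<longrightarrow> s j = 0")
    case True
    have "((\<lambda>x. F (s i) (x $ i)) has_derivative (\<lambda>h. F (Suc (s i)) (x $ i) * (h $ i))) (at x)"
    proof (rule has_derivative_compose[where f="\<lambda>x. x $ i" and g="F (s i)" and f'="\<lambda>h. h $ i" and g'="(*) (F (Suc (s i)) (x $ i))"])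
      show "(F (s i) has_derivative (*) (F (Suc (s i)) (x $ i))) (at (x $ i))"
        using F by (simp add: has_field_derivative_def)
      show "((\<lambda>x. x $ i) has_derivative (\<lambda>h. h $ i)) (at x)"
        by (intro bounded_linear_imp_has_derivative bounded_linear_vec_nth)
    qed
    moreover have "(\<Sum>j\<in>UNIV. h $ j * ?\<Phi> (mi_inc j s) x) = F (Suc (s i)) (x $ i) * (h $ i)" for h :: "real^'n"
    proof -
      have "(\<Sum>j\<in>UNIV. h $ j * ?\<Phi> (mi_inc j s) x) = (\<Sum>j\<in>UNIV. if j = i then h $ i * F (Suc (s i)) (x $ i) else 0)"
        using True by (intro sum.cong) (auto simp: mi_inc_apply)
      then show ?thesis by simp
    qed
    ultimately show ?thesis using True by simp
  next
    case False
    then have "\<not> (\<forall>j. j \<noteq> i \<longrightarrow> mi_inc k s j = 0)" for k by (auto simp: mi_inc_apply)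
    then have sum0: "(\<Sum>j\<in>UNIV. h $ j * ?\<Phi> (mi_inc j s) x) = 0" for h :: "real^'n"
      by (intro sum.neutral ballI) (simp only: if_False mult_zero_right)
    show ?thesis unfolding sum0 if_not_P[OF False] by (rule has_derivative_const)
  qed
qed auto

lemma all_derivs_const: "all_derivs (\<lambda>x::real^'n. c) (\<lambda>s x. if s = (\<lambda>_. 0) then c else 0)"
proof -
  have "mi_inc i s \<noteq> (\<lambda>_. 0)" for i :: 'n and s by (metis mi_inc_apply nat.distinct(1))
  then show ?thesis by (intro all_derivsI) auto
qed

lemma all_derivs_prod:
  assumes "finite A" "\<And>i. i \<in> A \<Longrightarrow> \<exists>\<Phi>. all_derivs (f i) \<Phi>"
  shows "\<exists>\<Phi>. all_derivs (\<lambda>x. \<Prod>i\<in>A. f i x) \<Phi>"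
  using assms
proof (induction A rule: finite_induct)
  case empty
  then show ?case using all_derivs_const[of 1] by auto
next
  case (insert i A)
  obtain \<Phi> where "all_derivs (\<lambda>x. \<Prod>i\<in>A. f i x) \<Phi>" using insert by blast
  moreover obtain \<Psi> where "all_derivs (f i) \<Psi>" using insert.prems by blast
  ultimately have "all_derivs (\<lambda>x. f i x * (\<Prod>i\<in>A. f i x)) (leibniz \<Psi> \<Phi>)" by (intro all_derivs_mult)
  then show ?case using insert(1,2) by auto
qed

section \<open>Bump functions\<close>

text \<open>With y = 1/x, differentiating p(y) exp(-y) with respect to x gives y^2 (p(y) - p'(y))
  exp(-y). Thus \<open>flat_exp n\<close> is the n-th derivative of exp(-1/x) extended by 0.\<close>

fun flat_exp_poly :: "nat \<Rightarrow> real poly" where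
  "flat_exp_poly 0 = 1"
| "flat_exp_poly (Suc n) = [:0, 0, 1:] * (flat_exp_poly n - pderiv (flat_exp_poly n))"

definition flat_exp :: "nat \<Rightarrow> real \<Rightarrow> real" where
  "flat_exp n x = (if x > 0 then poly (flat_exp_poly n) (inverse x) * exp (- inverse x) else 0)"

lemma poly_exp_tendsto_0: "((\<lambda>y::real. poly p y * exp (- y)) \<longlongrightarrow> 0) at_top"
proof -
  have "((\<lambda>y::real. \<Sum>i\<le>degree p. coeff p i * (y ^ i / exp y)) \<longlongrightarrow> (\<Sum>i\<le>degree p. coeff p i * 0)) at_top"
    by (intro tendsto_intros tendsto_power_div_exp_0)
  moreover have "poly p y * exp (- y) = (\<Sum>i\<le>degree p. coeff p i * (y ^ i / exp y))" for y
    by (simp add: poly_altdef sum_distrib_right exp_minus divide_inverse mult.assoc)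
  ultimately show ?thesis by simp
qed

lemma flat_exp_has_real_derivative: "(flat_exp n has_real_derivative flat_exp (Suc n) x) (at x)"
proof -
  consider "x < 0" | "x > 0" | "x = 0" by linarith
  then show ?thesis
  proof cases
    case 1
    have "((\<lambda>_. 0) has_real_derivative 0) (at x)" by simp
    then have "(flat_exp n has_real_derivative 0) (at x)"
      by (rule has_field_derivative_transform_within_open[where S="{..<0}"]) (use 1 in \<open>auto simp: flat_exp_def\<close>)
    then show ?thesis using 1 by (simp add: flat_exp_def)
  next
    case 2
    let ?p = "flat_exp_poly n"
    have "((\<lambda>x. poly ?p (inverse x)) has_real_derivative poly (pderiv ?p) (inverse x) * (- (inverse x ^ Suc (Suc 0)))) (at x)"
      using 2 by (intro DERIV_chain2[OF poly_DERIV] DERIV_inverse) auto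
    moreover have "((\<lambda>x. exp (- inverse x)) has_real_derivative exp (- inverse x) * (inverse x ^ Suc (Suc 0))) (at x)"
      using 2 by (auto intro!: derivative_eq_intros simp: power2_eq_square)
    ultimately have "((\<lambda>x. poly ?p (inverse x) * exp (- inverse x)) has_real_derivative flat_exp (Suc n) x) (at x)"
      by (rule DERIV_cong[OF DERIV_mult]) (use 2 in \<open>simp add: flat_exp_def algebra_simps\<close>)
    then show ?thesis
      by (rule has_field_derivative_transform_within_open[where S="{0<..}"]) (use 2 in \<open>auto simp: flat_exp_def\<close>)
  next
    case 3
    have "((\<lambda>h. flat_exp n h / h) \<longlongrightarrow> 0) (at_left 0)"
      by (rule tendsto_eventually) (auto simp: flat_exp_def eventually_at_left_field intro!: exI[of _ "-1"])
    moreover have "((\<lambda>h. flat_exp n h / h) \<longlongrightarrow> 0) (at_right 0)"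
    proof -
      \<comment> \<open>Dividing by h multiplies by y = 1/h, so the difference quotient at 0 is
        again a polynomial times exp(-y), which tends to 0.\<close>
      have "((\<lambda>h. poly ([:0, 1:] * flat_exp_poly n) (inverse h) * exp (- inverse h)) \<longlongrightarrow> 0) (at_right (0::real))"
        by (rule filterlim_compose[OF poly_exp_tendsto_0 filterlim_inverse_at_top_right])
      then show ?thesis
      proof (rule Lim_transform_eventually)
        show "\<forall>\<^sub>F h in at_right 0. poly ([:0, 1:] * flat_exp_poly n) (inverse h) * exp (- inverse h) = flat_exp n h / h"
          unfolding eventually_at_right_field
          by (intro exI[of _ 1]) (auto simp: flat_exp_def divide_simps)
      qed
    qed
    ultimately have "((\<lambda>h. flat_exp n h / h) \<longlongrightarrow> 0) (at 0)"
      by (rule filterlim_split_at)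
    then show ?thesis
      using 3 by (simp add: has_field_derivative_iff flat_exp_def)
  qed
qed

lemma bump_exists:
  obtains \<eta> :: "real ^ 'n \<Rightarrow> real" and H
  where "all_derivs \<eta> H" "\<And>x. 0 \<le> \<eta> x" "0 < \<eta> 0" "\<And>x i. \<eta> x \<noteq> 0 \<Longrightarrow> \<bar>x $ i\<bar> < 1"
proof -
  \<comment> \<open>Each coordinate contributes a factor flat_exp(1 + x_i) flat_exp(1 - x_i),
    nonzero exactly for |x_i| < 1. The affine way of writing it is the one that
    \<open>all_derivs_affine\<close> expects.\<close>
  define \<eta> where "\<eta> = (\<lambda>x::real^'n. \<Prod>i\<in>UNIV. flat_exp 0 ((axis i 1 + 1 *\<^sub>R x) $ i) * flat_exp 0 ((axis i 1 + (-1) *\<^sub>R x) $ i))"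
  have "\<exists>\<Phi>. all_derivs \<eta> \<Phi>"
    unfolding \<eta>_def
  proof (rule all_derivs_prod)
    fix i :: 'n
    note D = all_derivs_coord[of flat_exp i, OF flat_exp_has_real_derivative]
    show "\<exists>\<Phi>. all_derivs (\<lambda>x. flat_exp 0 ((axis i 1 + 1 *\<^sub>R x) $ i) * flat_exp 0 ((axis i 1 + (-1) *\<^sub>R x) $ i)) \<Phi>"
      using all_derivs_mult[OF all_derivs_affine[OF D] all_derivs_affine[OF D]] by blast
  qed simp
  then obtain H where "all_derivs \<eta> H" by blast
  moreover have "0 \<le> \<eta> x" for x
    unfolding \<eta>_def by (intro prod_nonneg) (auto simp: flat_exp_def)
  moreover have "0 < \<eta> 0"
    unfolding \<eta>_def by (intro prod_pos) (auto simp: flat_exp_def)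
  moreover have "\<bar>x $ i\<bar> < 1" if "\<eta> x \<noteq> 0" for x i
  proof (rule ccontr)
    assume "\<not> \<bar>x $ i\<bar> < 1"
    then have "flat_exp 0 ((axis i 1 + 1 *\<^sub>R x) $ i) * flat_exp 0 ((axis i 1 + (-1) *\<^sub>R x) $ i) = 0"
      by (auto simp: flat_exp_def)
    then have "\<eta> x = 0" unfolding \<eta>_def by (intro prod_zero) auto
    then show False using that by simp
  qed
  ultimately show ?thesis using that by blast
qed

section \<open>Integration by parts\<close>

text \<open>An explicit radius is easier to carry through products and derivatives than compactness
  of a closure; the two are linked by \<open>compact_closure_iff_supp_in\<close>.\<close>

definition supp_in :: "real \<Rightarrow> (real ^ 'n \<Rightarrow> real) \<Rightarrow> bool" where
  "supp_in R f \<longleftrightarrow> (\<forall>x. f x \<noteq> 0 \<longrightarrow> norm x \<le> R)"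

lemma supp_inD: "supp_in R f \<Longrightarrow> norm x > R \<Longrightarrow> f x = 0"
  by (auto simp: supp_in_def not_le)

lemma supp_in_mult: "supp_in R f \<Longrightarrow> supp_in R (\<lambda>x. f x * g x)" "supp_in R f \<Longrightarrow> supp_in R (\<lambda>x. g x * f x)"
  by (auto simp: supp_in_def)

lemma compact_closure_iff_supp_in:
  "compact (closure {x. f x \<noteq> 0}) \<longleftrightarrow> (\<exists>R. supp_in R f)"
  using compact_closure_iff_bounded[of f] by (simp add: supp_in_def)

lemma all_derivs_supp_in:
  assumes "all_derivs \<phi> \<Phi>" "supp_in R \<phi>"
  shows "supp_in R (\<Phi> s)"
  unfolding supp_in_def
proof (intro allI impI)
  fix x assume nz: "\<Phi> s x \<noteq> 0"
  show "norm x \<le> R"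
  proof (rule ccontr)
    assume "\<not> norm x \<le> R"
    then have "x \<in> - cball 0 R" by simp
    then have "\<Phi> s x = 0"
      by (rule all_derivs_outside[OF assms(1), of "- cball 0 R", rotated 2])
        (use supp_inD[OF assms(2)] in auto)
    then show False using nz by simp
  qed
qed

lemma continuous_supp_in_bounded:
  assumes "continuous_on UNIV f" "supp_in R f"
  obtains B where "B > 0" "\<And>x. \<bar>f x\<bar> \<le> B"
  using bounded_of_compact_support[OF assms(1)] assms(2) compact_closure_iff_supp_in by blast

lemma integrable_lborel_supp_in:
  fixes f :: "real ^ 'n \<Rightarrow> real"
  assumes [measurable]: "f \<in> borel_measurable borel" and "\<And>x. \<bar>f x\<bar> \<le> B" "supp_in R f"
  shows "integrable lborel f"
proof (rule Bochner_Integration.integrable_bound[where f="\<lambda>x. B * indicator (cball 0 R) x"])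
  show "integrable lborel (\<lambda>x::real^'n. B * indicator (cball 0 R) x)"
    using emeasure_bounded_finite[OF bounded_cball[of "0::real^'n" R]] by (intro integrable_mult_right integrable_real_indicator) auto
  show "AE x in lborel. norm (f x) \<le> norm (B * indicator (cball 0 R) x)"
  proof (rule AE_I2)
    fix x
    show "norm (f x) \<le> norm (B * indicator (cball 0 R) x)"
      using assms(2)[of x] supp_inD[OF assms(3), of x] by (cases "norm x \<le> R") (auto simp: abs_mult)
  qed
qed simp

lemma integrable_lborel_continuous_supp_in:
  assumes "continuous_on UNIV f" "supp_in R f"
  shows "integrable lborel f"
  using continuous_supp_in_bounded[OF assms] integrable_lborel_supp_in[OF _ _ assms(2)]
    borel_measurable_continuous_onI[OF assms(1)] by metis

lemma lborel_integral_translate: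
  fixes f :: "'a::euclidean_space \<Rightarrow> real"
  assumes "f \<in> borel_measurable borel"
  shows "(LINT x|lborel. f (c + x)) = (LINT x|lborel. f x)"
  using integral_distr[of "(+) c" lborel borel f] assms lborel_distr_plus[of c] by simp

lemma lborel_integrable_translate:
  fixes f :: "'a::euclidean_space \<Rightarrow> real"
  assumes "integrable lborel f"
  shows "integrable lborel (\<lambda>x. f (c + x))"
  by (rule integrable_distr[of _ lborel borel]) (use assms in \<open>auto simp: lborel_distr_plus\<close>)

lemma has_partial_at:
  assumes "has_partial i G G'"
  shows "((\<lambda>t. G (x + t *\<^sub>R axis i 1)) has_real_derivative G' (x + t *\<^sub>R axis i 1)) (at t)"
proof -
  have "((\<lambda>u. G (x + t *\<^sub>R axis i 1 + u *\<^sub>R axis i 1)) has_real_derivative G' (x + t *\<^sub>R axis i 1)) (at 0)"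
    using assms unfolding has_partial_def by blast
  then have "((\<lambda>u. G (x + (u + t) *\<^sub>R axis i 1)) has_real_derivative G' (x + t *\<^sub>R axis i 1)) (at 0)"
    by (simp add: algebra_simps)
  then show ?thesis using DERIV_shift[of "\<lambda>u. G (x + u *\<^sub>R axis i 1)" _ 0 t] by simp
qed

lemma has_partial_supp_in:
  assumes "has_partial i G G'" "supp_in R G"
  shows "supp_in R G'"
  unfolding supp_in_def
proof (intro allI impI)
  fix x assume nz: "G' x \<noteq> 0"
  show "norm x \<le> R"
  proof (rule ccontr)
    assume "\<not> norm x \<le> R"
    then have "\<forall>\<^sub>F t in nhds 0. R < norm (x + t *\<^sub>R axis i (1::real))"
      by (intro order_tendstoD(1)[where y="norm x"]) (auto intro!: tendsto_eq_intros filterlim_ident)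
    then have "\<forall>\<^sub>F t in nhds 0. G (x + t *\<^sub>R axis i 1) = 0"
      by eventually_elim (rule supp_inD[OF assms(2)])
    then have "((\<lambda>t. G (x + t *\<^sub>R axis i 1)) has_real_derivative 0) (at 0)"
      by (subst DERIV_cong_ev[OF refl _ refl, where g="\<lambda>_. 0"]) auto
    then show False using assms(1) nz DERIV_unique unfolding has_partial_def by blast
  qed
qed

text \<open>Difference quotients of \<open>G\<close> integrate to zero by translation invariance.\<close>

lemma integral_partial_eq_0:
  assumes P: "has_partial i G G'" and c: "continuous_on UNIV G" "continuous_on UNIV G'" and R: "supp_in R G"
  shows "(LINT x|lborel. G' x) = 0"
proof -
  let ?e = "axis i (1::real)"
  have R': "supp_in R G'" by (rule has_partial_supp_in[OF P R])
  obtain B where B: "B > 0" "\<And>x. \<bar>G' x\<bar> \<le> B" using continuous_supp_in_bounded[OF c(2) R'] by blast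
  note [measurable] = borel_measurable_continuous_onI[OF c(1)] borel_measurable_continuous_onI[OF c(2)]
  \<comment> \<open>Steps of length at most 1 move the support by at most 1, hence the dominating
    ball of radius R + 1 below.\<close>
  define h where "h n = inverse (real (Suc n))" for n
  have h: "h n > 0" "h n \<le> 1" "h n \<noteq> 0" for n by (auto simp: h_def divide_simps)
  define D where "D n x = (G (h n *\<^sub>R ?e + x) - G x) / h n" for n x
  have "(\<lambda>n. LINT x|lborel. D n x) \<longlonglongrightarrow> (LINT x|lborel. G' x)"
  proof (rule integral_dominated_convergence[where w="\<lambda>x. B * indicator (cball 0 (R + 1)) x"])
    show "integrable lborel (\<lambda>x::real^'a. B * indicator (cball 0 (R + 1)) x)"
      using emeasure_bounded_finite[OF bounded_cball[of "0::real^'a" "R + 1"]]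
      by (intro integrable_mult_right integrable_real_indicator) auto
    have "(\<lambda>n. D n x) \<longlonglongrightarrow> G' x" for x
    proof -
      have "((\<lambda>t. (G (x + t *\<^sub>R ?e) - G x) / t) \<longlongrightarrow> G' x) (at 0)"
        using P by (simp add: has_partial_def has_field_derivative_iff)
      moreover have "filterlim h (at 0) sequentially"
        unfolding filterlim_at h_def using LIMSEQ_inverse_real_of_nat by auto
      ultimately have "(\<lambda>n. (G (x + h n *\<^sub>R ?e) - G x) / h n) \<longlonglongrightarrow> G' x"
        by (rule filterlim_compose)
      then show ?thesis by (simp add: D_def add.commute)
    qed
    then show "AE x in lborel. (\<lambda>n. D n x) \<longlonglongrightarrow> G' x" by simp
    show "AE x in lborel. norm (D n x) \<le> B * indicator (cball 0 (R + 1)) x" for n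
    proof (rule AE_I2)
      fix x
      obtain t where "G (x + h n *\<^sub>R ?e) - G (x + 0 *\<^sub>R ?e) = (h n - 0) * G' (x + t *\<^sub>R ?e)"
        using MVT2[of 0 "h n" "\<lambda>t. G (x + t *\<^sub>R ?e)" "\<lambda>t. G' (x + t *\<^sub>R ?e)"] has_partial_at[OF P] h by blast
      then have eq: "D n x = G' (x + t *\<^sub>R ?e)"
        using h(3)[of n] by (simp add: D_def add.commute)
      show "norm (D n x) \<le> B * indicator (cball 0 (R + 1)) x"
      proof (cases "norm x \<le> R + 1")
        case True
        then show ?thesis using B(2) eq by simp
      next
        case False
        have "norm (h n *\<^sub>R ?e) \<le> 1" using h[of n] by (simp add: norm_axis_1)
        then have "norm (h n *\<^sub>R ?e + x) > R" "norm x > R"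
          using False norm_triangle_ineq4[of "h n *\<^sub>R ?e + x" "h n *\<^sub>R ?e"] by auto
        then show ?thesis using False supp_inD[OF R] by (simp add: D_def)
      qed
    qed
  qed (auto simp: D_def)
  moreover have "(LINT x|lborel. D n x) = 0" for n
  proof -
    have int: "integrable lborel G" by (rule integrable_lborel_continuous_supp_in[OF c(1) R])
    then have "(LINT x|lborel. D n x) = ((LINT x|lborel. G (h n *\<^sub>R ?e + x)) - (LINT x|lborel. G x)) / h n"
      unfolding D_def using lborel_integrable_translate[OF int] by simp
    then show ?thesis using lborel_integral_translate[of G "h n *\<^sub>R ?e"] by simp
  qed
  ultimately show ?thesis by (simp add: LIMSEQ_const_iff)
qed

lemma has_partial_mult:
  assumes "has_partial i f f'" "has_partial i g g'"
  shows "has_partial i (\<lambda>x. f x * g x) (\<lambda>x. f' x * g x + f x * g' x)"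
  unfolding has_partial_def
proof
  fix x
  show "((\<lambda>t. f (x + t *\<^sub>R axis i 1) * g (x + t *\<^sub>R axis i 1)) has_real_derivative f' x * g x + f x * g' x) (at 0)"
    using DERIV_mult[of "\<lambda>t. f (x + t *\<^sub>R axis i 1)" "f' x" 0 UNIV "\<lambda>t. g (x + t *\<^sub>R axis i 1)" "g' x"] assms
    by (simp add: has_partial_def algebra_simps)
qed

lemma has_partial_compose:
  assumes "has_partial i f f'" "\<And>y. (g has_real_derivative g' y) (at y)"
  shows "has_partial i (\<lambda>x. g (f x)) (\<lambda>x. g' (f x) * f' x)"
  unfolding has_partial_def
proof
  fix x
  show "((\<lambda>t. g (f (x + t *\<^sub>R axis i 1))) has_real_derivative g' (f x) * f' x) (at 0)"
    using DERIV_chain2[of g "g' (f x)" "\<lambda>t. f (x + t *\<^sub>R axis i 1)" 0] assms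
    by (simp add: has_partial_def)
qed

lemma integral_by_parts_partial:
  assumes f: "has_partial i f f'" "continuous_on UNIV f" "continuous_on UNIV f'"
    and g: "has_partial i g g'" "continuous_on UNIV g" "continuous_on UNIV g'" "supp_in R g"
  shows "(LINT x|lborel. f x * g' x) = - (LINT x|lborel. f' x * g x)"
proof -
  have "(LINT x|lborel. f' x * g x + f x * g' x) = 0"
    by (rule integral_partial_eq_0[OF has_partial_mult[OF f(1) g(1)]])
      (use f g in \<open>auto intro!: continuous_intros supp_in_mult\<close>)
  moreover have "integrable lborel (\<lambda>x. f' x * g x)"
    by (rule integrable_lborel_continuous_supp_in[of _ R]) (use f g in \<open>auto intro!: continuous_intros supp_in_mult\<close>)
  moreover have "integrable lborel (\<lambda>x. f x * g' x)"
    by (rule integrable_lborel_continuous_supp_in[of _ R])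
      (use f g has_partial_supp_in[OF g(1,4)] in \<open>auto intro!: continuous_intros supp_in_mult\<close>)
  ultimately show ?thesis by simp
qed

section \<open>Locally integrable functions\<close>

lemma locally_integrableD:
  assumes "locally_integrable f"
  shows "integrable lebesgue (\<lambda>x. indicator (cball 0 R) x * f x)"
  using assms compact_cball[of 0 R] by (auto simp: locally_integrable_def set_integrable_def)

lemma borel_measurable_if_cballs:
  fixes f :: "real ^ 'n \<Rightarrow> real"
  assumes "\<And>R. (\<lambda>x. indicator (cball 0 R) x * f x) \<in> borel_measurable lebesgue"
  shows "f \<in> borel_measurable lebesgue"
proof (rule borel_measurable_LIMSEQ_real)
  show "(\<lambda>n. indicator (cball 0 (real n)) x * f x) \<longlonglongrightarrow> f x" for x :: "real ^ 'n"
  proof (rule tendsto_eventually)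
    obtain N :: nat where "norm x \<le> real N" using real_arch_simple by blast
    then have "indicator (cball 0 (real n)) x * f x = f x" if "n \<ge> N" for n
    proof -
      have "norm x \<le> real n" using \<open>norm x \<le> real N\<close> that by (simp add: order_trans)
      then show ?thesis by simp
    qed
    then show "\<forall>\<^sub>F n in sequentially. indicator (cball 0 (real n)) x * f x = f x"
      using eventually_sequentially by blast
  qed
qed (rule assms)

lemma locally_integrable_measurable:
  assumes "locally_integrable f"
  shows "f \<in> borel_measurable lebesgue"
  by (rule borel_measurable_if_cballs) (use locally_integrableD[OF assms] in auto)

lemma locally_integrableI:
  fixes f :: "real ^ 'n \<Rightarrow> real"
  assumes "\<And>R. integrable lebesgue (\<lambda>x. indicator (cball 0 R) x * f x)"
  shows "locally_integrable f"
  unfolding locally_integrable_def set_integrable_def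
proof (intro allI impI)
  fix K :: "(real ^ 'n) set" assume K: "compact K"
  then obtain R where R: "\<And>x. x \<in> K \<Longrightarrow> norm x \<le> R" using compact_imp_bounded bounded_iff by metis
  have [measurable]: "K \<in> sets lebesgue" using K by (auto intro!: borel_closed dest: compact_imp_closed)
  have "f \<in> borel_measurable lebesgue"
    by (rule borel_measurable_if_cballs) (use assms in auto)
  then show "integrable lebesgue (\<lambda>x. indicat_real K x *\<^sub>R f x)"
    by (intro Bochner_Integration.integrable_bound[OF assms[of R]] AE_I2)
      (use R in \<open>auto simp: indicator_def\<close>)
qed

lemma locally_integrable_mult_integrable:
  assumes a: "locally_integrable a" and g: "g \<in> borel_measurable lebesgue" "\<And>x. \<bar>g x\<bar> \<le> B" "supp_in R g"
  shows "integrable lebesgue (\<lambda>x. a x * g x)"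
proof (rule Bochner_Integration.integrable_bound[where f="\<lambda>x. B * (indicator (cball 0 R) x * a x)"])
  show "integrable lebesgue (\<lambda>x. B * (indicator (cball 0 R) x * a x))"
    by (intro integrable_mult_right locally_integrableD a)
  show "AE x in lebesgue. norm (a x * g x) \<le> norm (B * (indicator (cball 0 R) x * a x))"
  proof (rule AE_I2)
    fix x
    show "norm (a x * g x) \<le> norm (B * (indicator (cball 0 R) x * a x))"
    proof (cases "norm x \<le> R")
      case True
      then show ?thesis using mult_right_mono[of "\<bar>g x\<bar>" "\<bar>B\<bar>" "\<bar>a x\<bar>"] g(2)[of x]
        by (simp add: abs_mult mult.commute)
    qed (use supp_inD[OF g(3)] in auto)
  qed
qed (use g(1) locally_integrable_measurable[OF a] in measurable)

lemma locally_integrable_mult_continuous: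
  assumes "locally_integrable a" "continuous_on UNIV g" "supp_in R g"
  shows "integrable lebesgue (\<lambda>x. a x * g x)"
proof -
  obtain B where "\<And>x. \<bar>g x\<bar> \<le> B" using continuous_supp_in_bounded[OF assms(2,3)] by blast
  moreover have "g \<in> borel_measurable lebesgue"
    using borel_measurable_continuous_onI[OF assms(2)] by (intro measurable_completion) simp
  ultimately show ?thesis
    by (intro locally_integrable_mult_integrable[OF assms(1) _ _ assms(3)])
qed

lemma has_weak_deriv_iff:
  "has_weak_deriv a s v \<longleftrightarrow> locally_integrable a \<and> locally_integrable v \<and>
     (\<forall>\<phi> \<Phi> R. all_derivs \<phi> \<Phi> \<longrightarrow> supp_in R \<phi> \<longrightarrow>
        (LINT x|lebesgue. a x * \<Phi> s x) = (- 1) ^ mi_order s * (LINT x|lebesgue. v x * \<phi> x))"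
  unfolding has_weak_deriv_def compact_closure_iff_supp_in by blast

section \<open>Convolution with test functions\<close>

definition conv :: "(real ^ 'n \<Rightarrow> real) \<Rightarrow> (real ^ 'n \<Rightarrow> real) \<Rightarrow> real ^ 'n \<Rightarrow> real" where
  "conv a \<eta> x = (LINT y|lebesgue. a y * \<eta> (x - y))"

lemma supp_in_reflect:
  assumes "supp_in R \<eta>"
  shows "supp_in (norm x + R) (\<lambda>y. \<eta> (x - y))"
  unfolding supp_in_def
proof (intro allI impI)
  fix y assume "\<eta> (x - y) \<noteq> 0"
  then have "norm (x - y) \<le> R" using supp_inD[OF assms, of "x - y"] by force
  then show "norm y \<le> norm x + R" using norm_triangle_ineq2[of y x] by (simp add: norm_minus_commute)
qed

lemma conv_integrable:
  assumes "locally_integrable a" "continuous_on UNIV \<eta>" "supp_in R \<eta>"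
  shows "integrable lebesgue (\<lambda>y. a y * \<eta> (x - y))"
  by (rule locally_integrable_mult_continuous[OF assms(1) _ supp_in_reflect[OF assms(3)]])
    (intro continuous_on_compose2[OF assms(2)] continuous_intros, auto)

lemma all_derivs_line:
  assumes "all_derivs \<eta> H"
  shows "((\<lambda>t. H s (z + t *\<^sub>R h)) has_real_derivative (\<Sum>i\<in>UNIV. h $ i * H (mi_inc i s) (z + t *\<^sub>R h))) (at t)"
proof -
  have 1: "((\<lambda>t. z + t *\<^sub>R h) has_derivative (\<lambda>t. t *\<^sub>R h)) (at t)"
    by (auto intro!: derivative_eq_intros)
  have eq: "(\<lambda>u. \<Sum>i\<in>UNIV. (u *\<^sub>R h) $ i * H (mi_inc i s) (z + t *\<^sub>R h))
      = (*) (\<Sum>i\<in>UNIV. h $ i * H (mi_inc i s) (z + t *\<^sub>R h))"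
    by (auto simp: fun_eq_iff sum_distrib_left mult_ac)
  show ?thesis
    using has_derivative_compose[OF 1 all_derivsD(2)[OF assms], of s] unfolding eq has_field_derivative_def .
qed

lemma all_derivs_lipschitz:
  fixes \<eta> :: "real ^ 'n \<Rightarrow> real"
  assumes H: "all_derivs \<eta> H" and R: "supp_in R \<eta>"
  obtains L where "L \<ge> 0" "\<And>z h. \<bar>H s (z + h) - H s z\<bar> \<le> L * norm h"
proof -
  have "\<exists>B>0. \<forall>x. \<bar>H (mi_inc i s) x\<bar> \<le> B" for i
    using continuous_supp_in_bounded[OF all_derivs_continuous[OF H] all_derivs_supp_in[OF H R]] by metis
  then obtain B where B: "\<And>i. B i > 0" "\<And>i x. \<bar>H (mi_inc i s) x\<bar> \<le> B i" by metis
  show ?thesis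
  proof (rule that[of "\<Sum>i\<in>UNIV. B i"])
    show "(\<Sum>i\<in>UNIV. B i) \<ge> 0" using B(1) by (intro sum_nonneg) (simp add: less_imp_le)
    fix z h :: "real ^ 'n"
    obtain t where "H s (z + 1 *\<^sub>R h) - H s (z + 0 *\<^sub>R h) = (1 - 0) * (\<Sum>i\<in>UNIV. h $ i * H (mi_inc i s) (z + t *\<^sub>R h))"
      using MVT2[of 0 1 "\<lambda>t. H s (z + t *\<^sub>R h)" "\<lambda>t. \<Sum>i\<in>UNIV. h $ i * H (mi_inc i s) (z + t *\<^sub>R h)"]
        all_derivs_line[OF H] by auto
    then have "\<bar>H s (z + h) - H s z\<bar> \<le> (\<Sum>i\<in>UNIV. \<bar>h $ i * H (mi_inc i s) (z + t *\<^sub>R h)\<bar>)"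
      by simp
    also have "\<dots> \<le> (\<Sum>i\<in>UNIV. B i * norm h)"
    proof (rule sum_mono)
      fix i
      show "\<bar>h $ i * H (mi_inc i s) (z + t *\<^sub>R h)\<bar> \<le> B i * norm h"
        unfolding abs_mult mult.commute[of "\<bar>h $ i\<bar>"]
        by (intro mult_mono B component_le_norm_cart less_imp_le[OF B(1)]) auto
    qed
    finally show "\<bar>H s (z + h) - H s z\<bar> \<le> (\<Sum>i\<in>UNIV. B i) * norm h" by (simp add: sum_distrib_right)
  qed
qed

text \<open>Compact support bounds the second derivatives, so the gradient is globally Lipschitz.
  The remainder bound is uniform in z, which lets it pass under a convolution integral.\<close>

lemma all_derivs_taylor:
  fixes \<eta> :: "real ^ 'n \<Rightarrow> real"
  assumes H: "all_derivs \<eta> H" and R: "supp_in R \<eta>"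
  obtains L where "L \<ge> 0"
    "\<And>z h. \<bar>H s (z + h) - H s z - (\<Sum>i\<in>UNIV. h $ i * H (mi_inc i s) z)\<bar> \<le> L * norm h * norm h"
proof -
  have "\<exists>L\<ge>0. \<forall>z h. \<bar>H (mi_inc i s) (z + h) - H (mi_inc i s) z\<bar> \<le> L * norm h" for i
    using all_derivs_lipschitz[OF H R, of "mi_inc i s"] by metis
  then obtain L where L: "\<And>i. L i \<ge> 0" "\<And>i z h. \<bar>H (mi_inc i s) (z + h) - H (mi_inc i s) z\<bar> \<le> L i * norm h"
    by metis
  show ?thesis
  proof (rule that[of "\<Sum>i\<in>UNIV. L i"])
    show "(\<Sum>i\<in>UNIV. L i) \<ge> 0" using L(1) by (intro sum_nonneg)
    fix z h :: "real ^ 'n"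
    have "\<exists>t>0. t < 1 \<and> H s (z + 1 *\<^sub>R h) - H s (z + 0 *\<^sub>R h) = (1 - 0) * (\<Sum>i\<in>UNIV. h $ i * H (mi_inc i s) (z + t *\<^sub>R h))"
      using MVT2[of 0 1 "\<lambda>t. H s (z + t *\<^sub>R h)" "\<lambda>t. \<Sum>i\<in>UNIV. h $ i * H (mi_inc i s) (z + t *\<^sub>R h)"]
        all_derivs_line[OF H] by auto
    then obtain t where t: "t > 0" "t < 1" "H s (z + h) - H s z = (\<Sum>i\<in>UNIV. h $ i * H (mi_inc i s) (z + t *\<^sub>R h))"
      by auto
    then have "H s (z + h) - H s z - (\<Sum>i\<in>UNIV. h $ i * H (mi_inc i s) z)
        = (\<Sum>i\<in>UNIV. h $ i * (H (mi_inc i s) (z + t *\<^sub>R h) - H (mi_inc i s) z))"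
      by (simp add: sum_subtractf right_diff_distrib)
    also have "\<bar>\<dots>\<bar> \<le> (\<Sum>i\<in>UNIV. \<bar>h $ i * (H (mi_inc i s) (z + t *\<^sub>R h) - H (mi_inc i s) z)\<bar>)"
      by (rule sum_abs)
    also have "\<dots> \<le> (\<Sum>i\<in>UNIV. norm h * (L i * norm h))"
    proof (rule sum_mono)
      fix i
      have "\<bar>H (mi_inc i s) (z + t *\<^sub>R h) - H (mi_inc i s) z\<bar> \<le> L i * norm (t *\<^sub>R h)" by (rule L)
      also have "\<dots> \<le> L i * norm h" using t by (intro mult_left_mono L) (simp add: mult_left_le_one_le)
      finally show "\<bar>h $ i * (H (mi_inc i s) (z + t *\<^sub>R h) - H (mi_inc i s) z)\<bar> \<le> norm h * (L i * norm h)"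
        unfolding abs_mult by (intro mult_mono component_le_norm_cart) auto
    qed
    finally show "\<bar>H s (z + h) - H s z - (\<Sum>i\<in>UNIV. h $ i * H (mi_inc i s) z)\<bar> \<le> (\<Sum>i\<in>UNIV. L i) * norm h * norm h"
      by (simp add: sum_distrib_right sum_distrib_left mult_ac)
  qed
qed

text \<open>Differentiation under the integral uses the uniform quadratic remainder instead of
  dominated convergence. For norm h \<le> 1 the remainder vanishes for y outside the ball of radius
  norm x + R + 1, so local integrability of \<open>a\<close> is enough.\<close>

lemma conv_has_derivative:
  fixes \<eta> :: "real ^ 'n \<Rightarrow> real"
  assumes a: "locally_integrable a" and H: "all_derivs \<eta> H" and R: "supp_in R \<eta>"
  shows "(conv a (H s) has_derivative (\<lambda>h. \<Sum>i\<in>UNIV. h $ i * conv a (H (mi_inc i s)) x)) (at x)"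
proof -
  obtain L where L: "L \<ge> 0"
    "\<And>z h. \<bar>H s (z + h) - H s z - (\<Sum>i\<in>UNIV. h $ i * H (mi_inc i s) z)\<bar> \<le> L * norm h * norm h"
    using all_derivs_taylor[OF H R] by blast
  define I where "I = (LINT y|lebesgue. \<bar>indicator (cball 0 (norm x + R + 1)) y * a y\<bar>)"
  note int = conv_integrable[OF a all_derivs_continuous[OF H] all_derivs_supp_in[OF H R]]
  have supp: "supp_in R (H s)" for s by (rule all_derivs_supp_in[OF H R])
  let ?D = "\<lambda>h. \<Sum>i\<in>UNIV. h $ i * conv a (H (mi_inc i s)) x"
  let ?E = "\<lambda>h z. H s (z + h) - H s z - (\<Sum>i\<in>UNIV. h $ i * H (mi_inc i s) z)"
  have bound: "\<bar>conv a (H s) (x + h) - conv a (H s) x - ?D h\<bar> \<le> L * norm h * norm h * I"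
    if h: "norm h \<le> 1" for h
  proof -
    have eq: "a y * ?E h (x - y) = a y * H s (x + h - y) - a y * H s (x - y)
        - (\<Sum>i\<in>UNIV. h $ i * (a y * H (mi_inc i s) (x - y)))" for y
      by (simp add: algebra_simps sum_distrib_left)
    have int1: "integrable lebesgue (\<lambda>y. a y * ?E h (x - y))"
      unfolding eq by (intro Bochner_Integration.integrable_diff Bochner_Integration.integrable_sum integrable_mult_right int)
    have "conv a (H s) (x + h) - conv a (H s) x - ?D h = (LINT y|lebesgue. a y * ?E h (x - y))"
      unfolding conv_def eq using int by simp
    also have "\<bar>\<dots>\<bar> \<le> (LINT y|lebesgue. \<bar>a y * ?E h (x - y)\<bar>)"
      by (rule integral_abs_bound)
    also have "\<dots> \<le> (LINT y|lebesgue. (L * norm h * norm h) * \<bar>indicator (cball 0 (norm x + R + 1)) y * a y\<bar>)"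
    proof (rule integral_mono)
      show "integrable lebesgue (\<lambda>y. (L * norm h * norm h) * \<bar>indicator (cball 0 (norm x + R + 1)) y * a y\<bar>)"
        by (intro integrable_mult_right integrable_abs locally_integrableD a)
      show "\<bar>a y * ?E h (x - y)\<bar> \<le> (L * norm h * norm h) * \<bar>indicator (cball 0 (norm x + R + 1)) y * a y\<bar>" for y
      proof (cases "norm y \<le> norm x + R + 1")
        case True
        then show ?thesis using mult_left_mono[OF L(2)[of "x - y" h], of "\<bar>a y\<bar>"] by (simp add: abs_mult mult_ac)
      next
        case False
        then have 1: "norm (x - y) > R + 1" using norm_triangle_ineq3[of x y] by simp
        have "norm (x - y + h) > R" using 1 h norm_triangle_ineq2[of "x - y" "- h"] by simp
        moreover have "norm (x - y) > R" using 1 by simp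
        ultimately have "?E h (x - y) = 0" using supp_inD[OF supp] by simp
        then show ?thesis using L(1) by (simp add: mult_nonneg_nonneg)
      qed
    qed (use int1 in auto)
    finally show ?thesis by (simp add: I_def)
  qed
  show ?thesis
    unfolding has_derivative_at
  proof (intro conjI)
    show "bounded_linear ?D"
      by (intro bounded_linear_sum bounded_linear_mult_left[THEN bounded_linear_compose] bounded_linear_vec_nth)
    show "((\<lambda>h. norm (conv a (H s) (x + h) - conv a (H s) x - ?D h) / norm h) \<longlongrightarrow> 0) (at 0)"
    proof (rule Lim_null_comparison[where g="\<lambda>h. L * I * norm h"])
      have "\<forall>\<^sub>F h in at (0::real^'n). norm h < 1 \<and> h \<noteq> 0"
        by (auto simp: eventually_at intro!: exI[of _ 1])
      then show "\<forall>\<^sub>F h in at 0. norm (norm (conv a (H s) (x + h) - conv a (H s) x - ?D h) / norm h) \<le> L * I * norm h"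
      proof eventually_elim
        case (elim h)
        then show ?case using bound[of h] by (simp add: divide_simps mult_ac)
      qed
      show "((\<lambda>h. L * I * norm h) \<longlongrightarrow> 0) (at (0::real^'n))"
        by (auto intro!: tendsto_eq_intros)
    qed
  qed
qed

lemma all_derivs_conv:
  assumes "locally_integrable a" "all_derivs \<eta> H" "supp_in R \<eta>"
  shows "all_derivs (conv a \<eta>) (\<lambda>s. conv a (H s))"
  by (intro all_derivsI conv_has_derivative[OF assms]) (simp add: all_derivsD(1)[OF assms(2)])

text \<open>The reflected kernel y \<mapsto> \<eta>(x - y) is an admissible test function, and the
  sign from reflecting its derivative cancels the sign in the definition of the weak
  derivative.\<close>

lemma conv_weak_deriv:
  assumes a: "has_weak_deriv a s v" and H: "all_derivs \<eta> H" and R: "supp_in R \<eta>"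
  shows "conv a (H s) x = conv v \<eta> x"
proof -
  have "all_derivs (\<lambda>y. \<eta> (x + (-1) *\<^sub>R y)) (\<lambda>s y. (-1) ^ mi_order s * H s (x + (-1) *\<^sub>R y))"
    by (rule all_derivs_affine[OF H])
  moreover have "supp_in (norm x + R) (\<lambda>y. \<eta> (x + (-1) *\<^sub>R y))"
    using supp_in_reflect[OF R] by simp
  ultimately have "(LINT y|lebesgue. a y * ((-1) ^ mi_order s * H s (x + (-1) *\<^sub>R y)))
      = (-1) ^ mi_order s * (LINT y|lebesgue. v y * \<eta> (x + (-1) *\<^sub>R y))"
    using a unfolding has_weak_deriv_iff by blast
  then have "(-1) ^ mi_order s * conv a (H s) x = (-1) ^ mi_order s * conv v \<eta> x"
    by (simp add: conv_def mult.left_commute[of "a _"])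
  then show ?thesis by simp
qed

section \<open>Mollification\<close>

definition mollifier ::
  "(nat \<Rightarrow> real ^ 'n \<Rightarrow> real) \<Rightarrow> (nat \<Rightarrow> ('n \<Rightarrow> nat) \<Rightarrow> real ^ 'n \<Rightarrow> real) \<Rightarrow> bool" where
  "mollifier \<eta> H \<longleftrightarrow> (\<forall>n. all_derivs (\<eta> n) (H n) \<and> (\<forall>x. 0 \<le> \<eta> n x) \<and>
     supp_in (1 / real (Suc n)) (\<eta> n) \<and> (LINT x|lborel. \<eta> n x) = 1)"

lemma mollifierD:
  assumes "mollifier \<eta> H"
  shows "all_derivs (\<eta> n) (H n)" "0 \<le> \<eta> n x" "supp_in (1 / real (Suc n)) (\<eta> n)"
    "(LINT x|lborel. \<eta> n x) = 1"
  using assms by (auto simp: mollifier_def)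

lemma mollifier_continuous: "mollifier \<eta> H \<Longrightarrow> continuous_on A (\<eta> n)"
  using all_derivs_continuous[of "\<eta> n" "H n" A "\<lambda>_. 0"] all_derivsD(1)[of "\<eta> n" "H n"]
  by (simp add: mollifierD)

lemma mollifier_supp_in_1: "mollifier \<eta> H \<Longrightarrow> supp_in 1 (\<eta> n)"
proof -
  assume "mollifier \<eta> H"
  moreover have "1 / real (Suc n) \<le> 1" by simp
  ultimately show ?thesis using mollifierD(3)[of \<eta> H n] unfolding supp_in_def by (meson order_trans)
qed

lemma integral_continuous_pos:
  fixes f :: "real ^ 'n \<Rightarrow> real"
  assumes c: "continuous_on UNIV f" and "\<And>x. 0 \<le> f x" and "0 < f 0" and R: "supp_in R f"
  shows "0 < (LINT x|lborel. f x)"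
proof -
  have int: "integrable lborel f" by (rule integrable_lborel_continuous_supp_in[OF c R])
  have "(LINT x|lborel. f x) \<noteq> 0"
  proof
    assume "(LINT x|lborel. f x) = 0"
    then have "AE x in lborel. f x = 0"
      using integral_nonneg_eq_0_iff_AE[OF int] assms(2) by simp
    then have ae: "AE x in lborel. x \<notin> {x. f x > 0}" by eventually_elim simp
    have "open {x. f x > 0}" using c by (intro open_Collect_less continuous_intros)
    moreover have "0 \<in> {x. f x > 0}" using assms(3) by simp
    ultimately obtain e where e: "e > 0" "ball 0 e \<subseteq> {x. f x > 0}" using open_contains_ball by blast
    have "AE x in lborel. x \<notin> ball (0::real^'n) e" using ae by eventually_elim (use e in auto)
    then have "emeasure lborel (ball (0::real^'n) e) = 0" by (subst (asm) AE_iff_null_sets[symmetric]) auto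
    then show False using emeasure_lborel_ball_finite[of "0::real^'n" e] e(1)
      by (simp add: emeasure_ball unit_ball_vol_pos less_imp_neq[symmetric])
  qed
  moreover have "0 \<le> (LINT x|lborel. f x)" using assms(2) by (simp add: Bochner_Integration.integral_nonneg)
  ultimately show ?thesis by simp
qed

lemma mollifier_exists:
  obtains \<eta> :: "nat \<Rightarrow> real ^ 'n \<Rightarrow> real" and H where "mollifier \<eta> H"
proof -
  obtain \<beta> :: "real ^ 'n \<Rightarrow> real" and B where B: "all_derivs \<beta> B" "\<And>x. 0 \<le> \<beta> x" "0 < \<beta> 0"
    "\<And>x i. \<beta> x \<noteq> 0 \<Longrightarrow> \<bar>x $ i\<bar> < 1"
    using bump_exists by blast
  \<comment> \<open>The bump lives in the unit cube, whose points have norm at most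
    \<open>CARD('n)\<close>; the extra factor brings the support into a Euclidean ball of radius
    1/(n + 1).\<close>
  define r where "r n = real (Suc n) * real CARD('n)" for n
  have r: "r n > 0" for n by (simp add: r_def)
  define f where "f n x = \<beta> (0 + r n *\<^sub>R x)" for n x
  define F where "F n s x = r n ^ mi_order s * B s (0 + r n *\<^sub>R x)" for n s x
  have F: "all_derivs (f n) (F n)" for n
    using all_derivs_affine[OF B(1), of 0 "r n"] by (simp add: f_def[abs_def] F_def[abs_def])
  have f_cont: "continuous_on UNIV (f n)" for n
    using all_derivs_continuous[OF F, of UNIV n "\<lambda>_. 0"] all_derivsD(1)[OF F] by simp
  have supp: "supp_in (1 / real (Suc n)) (f n)" for n
    unfolding supp_in_def
  proof (intro allI impI)
    fix x assume "f n x \<noteq> 0"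
    then have "\<bar>(r n *\<^sub>R x) $ i\<bar> < 1" for i using B(4)[of "r n *\<^sub>R x" i] by (simp add: f_def)
    then have "(\<Sum>i\<in>UNIV. \<bar>(r n *\<^sub>R x) $ i\<bar>) \<le> (\<Sum>i\<in>(UNIV::'n set). 1)"
      by (intro sum_mono less_imp_le)
    then have "norm (r n *\<^sub>R x) \<le> real CARD('n)"
      using norm_le_l1_cart[of "r n *\<^sub>R x"] by simp
    then have "real CARD('n) * (real (Suc n) * norm x) \<le> real CARD('n) * 1"
      using r[of n] by (simp add: r_def abs_mult mult_ac)
    then have "real (Suc n) * norm x \<le> 1" by (subst (asm) mult_le_cancel_left_pos) auto
    then show "norm x \<le> 1 / real (Suc n)" by (simp add: field_simps)
  qed
  have pos: "0 < (LINT x|lborel. f n x)" for n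
    by (rule integral_continuous_pos[OF f_cont _ _ supp]) (use B in \<open>auto simp: f_def\<close>)
  define c where "c n = 1 / (LINT x|lborel. f n x)" for n
  have "mollifier (\<lambda>n x. c n * f n x) (\<lambda>n s x. c n * F n s x)"
    unfolding mollifier_def
  proof (intro allI conjI)
    fix n
    show "all_derivs (\<lambda>x. c n * f n x) (\<lambda>s x. c n * F n s x)" by (rule all_derivs_cmult[OF F])
    show "supp_in (1 / real (Suc n)) (\<lambda>x. c n * f n x)" by (rule supp_in_mult(2)[OF supp])
    show "(LINT x|lborel. c n * f n x) = 1" using pos[of n] by (simp add: c_def)
    show "0 \<le> c n * f n x" for x using pos[of n] B(2) by (simp add: c_def f_def)
  qed
  then show ?thesis using that by blast
qed

section \<open>Convergence of mollifications in L1\<close>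

lemma lborel_integral_reflect:
  fixes f :: "real ^ 'n \<Rightarrow> real"
  assumes [measurable]: "f \<in> borel_measurable borel"
  shows "(LINT y|lborel. f (x - y)) = (LINT y|lborel. f y)"
proof -
  have "(LINT y|lborel. f y) = (LINT y|distr lborel borel (\<lambda>y. x + (-1) *\<^sub>R y). f y)"
    by (subst lborel_affine[of "-1" x]) (simp_all add: density_1)
  also have "\<dots> = (LINT y|lborel. f (x + (-1) *\<^sub>R y))" by (rule integral_distr) auto
  finally show ?thesis by simp
qed

lemma lborel_integral_lebesgue:
  fixes f :: "real ^ 'n \<Rightarrow> real"
  assumes "f \<in> borel_measurable borel"
  shows "(LINT x|lebesgue. f x) = (LINT x|lborel. f x)"
  by (rule integral_completion) (use assms in simp)

lemma mollifier_integral_reflect: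
  assumes "mollifier \<eta> H"
  shows "(LINT y|lebesgue. \<eta> n (x - y)) = 1" "integrable lebesgue (\<lambda>y. \<eta> n (x - y))"
proof -
  have [measurable]: "\<eta> n \<in> borel_measurable borel"
    by (intro borel_measurable_continuous_onI mollifier_continuous[OF assms])
  show 1: "(LINT y|lebesgue. \<eta> n (x - y)) = 1"
    using lborel_integral_reflect[of "\<eta> n" x] mollifierD(4)[OF assms] by (simp add: lborel_integral_lebesgue)
  \<comment> \<open>A non-integrable function would have integral 0, so the value 1 proves
    integrability.\<close>
  then show "integrable lebesgue (\<lambda>y. \<eta> n (x - y))"
    using not_integrable_integral_eq by fastforce
qed

text \<open>Fubini's theorem with a kernel of mass 1. It is applied on \<open>lborel\<close>;
  Lebesgue measurable functions are reached later through Borel representatives, which have the same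
  convolutions.\<close>

lemma conv_L1_bound:
  fixes w :: "real ^ 'n \<Rightarrow> real"
  assumes w: "integrable lborel w" and \<eta>: "mollifier \<eta> H"
  shows "integrable lborel (conv w (\<eta> n))"
    "(LINT x|lborel. \<bar>conv w (\<eta> n) x\<bar>) \<le> (LINT x|lborel. \<bar>w x\<bar>)"
proof -
  have [measurable]: "\<eta> n \<in> borel_measurable borel"
    by (intro borel_measurable_continuous_onI mollifier_continuous[OF \<eta>])
  have [measurable]: "w \<in> borel_measurable borel" using w by simp
  have nn: "0 \<le> \<eta> n x" for x by (rule mollifierD(2)[OF \<eta>])
  have one: "(LINT x|lborel. \<eta> n (x - y)) = 1" for y
    using lborel_integral_translate[of "\<eta> n" "- y"] mollifierD(4)[OF \<eta>] by simp
  have int_\<eta>: "integrable lborel (\<lambda>x. \<eta> n (x - y))" for y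
    using one[of y] not_integrable_integral_eq by fastforce
  have conv: "conv w (\<eta> n) x = (LINT y|lborel. w y * \<eta> n (x - y))" for x
    unfolding conv_def by (intro lborel_integral_lebesgue) measurable
  define f where "f = (\<lambda>(y, x). w y * \<eta> n (x - y))"
  have f_meas[measurable]: "f \<in> borel_measurable (lborel \<Otimes>\<^sub>M lborel)"
    unfolding f_def by measurable
  have int_f: "integrable (lborel \<Otimes>\<^sub>M lborel) f"
  proof (rule lborel_pair.Fubini_integrable[OF f_meas])
    have "(LINT x|lborel. norm (f (y, x))) = \<bar>w y\<bar>" for y
      using nn one by (simp add: f_def abs_mult)
    then show "integrable lborel (\<lambda>y. LINT x|lborel. norm (f (y, x)))" using w by simp
    show "AE y in lborel. integrable lborel (\<lambda>x. f (y, x))"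
      using int_\<eta> by (simp add: f_def)
  qed
  have "integrable lborel (\<lambda>x. LINT y|lborel. f (y, x))"
    by (rule lborel_pair.integrable_snd) (use int_f in \<open>simp add: split_beta'\<close>)
  then show int: "integrable lborel (conv w (\<eta> n))"
    unfolding conv[abs_def] by (simp add: f_def)
  have int_absf: "integrable (lborel \<Otimes>\<^sub>M lborel) (\<lambda>z. \<bar>f z\<bar>)" using int_f by simp
  have "(LINT x|lborel. \<bar>conv w (\<eta> n) x\<bar>) \<le> (LINT x|lborel. LINT y|lborel. \<bar>f (y, x)\<bar>)"
  proof (rule integral_mono)
    show "integrable lborel (\<lambda>x. LINT y|lborel. \<bar>f (y, x)\<bar>)"
      by (rule lborel_pair.integrable_snd) (use int_absf in \<open>simp add: split_beta'\<close>)
    show "\<bar>conv w (\<eta> n) x\<bar> \<le> (LINT y|lborel. \<bar>f (y, x)\<bar>)" for x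
      unfolding conv by (simp add: f_def integral_abs_bound)
  qed (use int in auto)
  also have "\<dots> = (LINT y|lborel. LINT x|lborel. \<bar>f (y, x)\<bar>)"
    using lborel_pair.Fubini_integral[of "\<lambda>y x. \<bar>f (y, x)\<bar>"] int_absf by (simp add: split_beta')
  also have "\<dots> = (LINT y|lborel. \<bar>w y\<bar>)"
    using nn one by (simp add: f_def abs_mult)
  finally show "(LINT x|lborel. \<bar>conv w (\<eta> n) x\<bar>) \<le> (LINT x|lborel. \<bar>w x\<bar>)" .
qed

text \<open>Multiplying by a continuous cutoff and clamping the values makes \<open>v\<close>
  bounded with bounded support at small cost. Both operations preserve continuity, so they can
  afterwards be applied to any continuous approximation.\<close>

lemma L1_dense_continuous:
  fixes v :: "real ^ 'n \<Rightarrow> real"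
  assumes v: "integrable lborel v" and e: "e > 0"
  obtains g R where "continuous_on UNIV g" "supp_in R g" "(LINT x|lborel. \<bar>v x - g x\<bar>) < e"
proof -
  have [measurable]: "v \<in> borel_measurable borel" using v by simp
  define cut where "cut m x = max 0 (min 1 (real m + 1 - norm x))" for m :: nat and x :: "real ^ 'n"
  have cut: "0 \<le> cut m x" "cut m x \<le> 1" "supp_in (real m + 1) (cut m)" for m x
    by (auto simp: cut_def supp_in_def)
  have cut_cont: "continuous_on UNIV (cut m)" for m
    unfolding cut_def by (intro continuous_intros)
  have [measurable]: "cut m \<in> borel_measurable borel" for m
    by (intro borel_measurable_continuous_onI cut_cont)
  define clamp where "clamp m y = max (- real m) (min y (real m))" for m :: nat and y :: real
  have clamp: "\<bar>clamp m y\<bar> \<le> \<bar>y\<bar>" "\<bar>clamp m y\<bar> \<le> real m" for m y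
    by (auto simp: clamp_def)
  define V where "V m x = cut m x * clamp m (v x)" for m x
  have [measurable]: "V m \<in> borel_measurable borel" for m
    unfolding V_def clamp_def by measurable
  have V_le: "\<bar>V m x\<bar> \<le> \<bar>v x\<bar>" for m x
    using mult_mono[OF cut(2) clamp(1)] cut by (simp add: V_def abs_mult)
  have V_int: "integrable lborel (V m)" for m
    by (rule Bochner_Integration.integrable_bound[OF v]) (use V_le in auto)
  have "(\<lambda>m. LINT x|lborel. \<bar>v x - V m x\<bar>) \<longlonglongrightarrow> (LINT x::real^'n|lborel. (0::real))"
  proof (rule integral_dominated_convergence[where w="\<lambda>x. 2 * \<bar>v x\<bar>"])
    have "(\<lambda>m. \<bar>v x - V m x\<bar>) \<longlonglongrightarrow> 0" for x
    proof (rule tendsto_eventually)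
      obtain N :: nat where N: "max (norm x) \<bar>v x\<bar> \<le> real N" using real_arch_simple by blast
      have "\<bar>v x - V m x\<bar> = 0" if "m \<ge> N" for m
      proof -
        have "norm x \<le> real m" "\<bar>v x\<bar> \<le> real m" using N that by auto
        then show ?thesis by (simp add: V_def cut_def clamp_def)
      qed
      then show "\<forall>\<^sub>F m in sequentially. \<bar>v x - V m x\<bar> = 0" using eventually_sequentially by blast
    qed
    then show "AE x in lborel. (\<lambda>m. \<bar>v x - V m x\<bar>) \<longlonglongrightarrow> 0" by simp
    show "AE x in lborel. norm \<bar>v x - V m x\<bar> \<le> 2 * \<bar>v x\<bar>" for m
    proof (rule AE_I2)
      fix x
      show "norm \<bar>v x - V m x\<bar> \<le> 2 * \<bar>v x\<bar>" using V_le[of m x] by simp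
    qed
  qed (use v in auto)
  then have "\<forall>\<^sub>F m in sequentially. (LINT x|lborel. \<bar>v x - V m x\<bar>) < e / 2"
    using order_tendstoD(2)[of _ "0::real" sequentially "e/2"] e by simp
  then obtain m where m: "(LINT x|lborel. \<bar>v x - V m x\<bar>) < e / 2"
    using eventually_happens' sequentially_bot by blast
  \<comment> \<open>This provides continuous functions converging a.e. to \<open>v\<close>, without
    any bound. Passing them through the same cutoff and clamp at level m supplies the
    majorant.\<close>
  have "v measurable_on UNIV"
    by (rule lebesgue_measurable_imp_measurable_on) (auto intro: measurable_completion)
  then obtain N \<gamma> where N: "negligible N" "\<And>n. continuous_on UNIV (\<gamma> n)" "\<And>x. x \<notin> N \<Longrightarrow> (\<lambda>n. \<gamma> n x) \<longlonglongrightarrow> v x"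
    unfolding measurable_on_def by auto
  have [measurable]: "\<gamma> n \<in> borel_measurable borel" for n :: nat
    by (intro borel_measurable_continuous_onI N)
  have "AE x in lebesgue. x \<notin> N"
    using N(1) by (intro AE_not_in) (simp add: negligible_iff_null_sets)
  then have "AE x in lebesgue. (\<lambda>n. \<gamma> n x) \<longlonglongrightarrow> v x"
    by eventually_elim (rule N(3))
  then have ae: "AE x in lborel. (\<lambda>n. \<gamma> n x) \<longlonglongrightarrow> v x"
    by (subst (asm) AE_completion_iff) auto
  define g where "g n x = cut m x * clamp m (\<gamma> n x)" for n x
  have g_cont: "continuous_on UNIV (g n)" for n
    unfolding g_def clamp_def by (intro continuous_intros cut_cont N)
  have [measurable]: "g n \<in> borel_measurable borel" for n
    by (intro borel_measurable_continuous_onI g_cont)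
  have g_supp: "supp_in (real m + 1) (g n)" for n
    unfolding g_def by (rule supp_in_mult(1)[OF cut(3)])
  have g_int: "integrable lborel (g n)" for n by (rule integrable_lborel_continuous_supp_in[OF g_cont g_supp])
  have "(\<lambda>n. LINT x|lborel. \<bar>V m x - g n x\<bar>) \<longlonglongrightarrow> (LINT x::real^'n|lborel. (0::real))"
  proof (rule integral_dominated_convergence[where w="\<lambda>x. (2 * real m) * cut m x"])
    show "integrable lborel (\<lambda>x. (2 * real m) * cut m x)"
      by (intro integrable_mult_right integrable_lborel_continuous_supp_in[OF cut_cont cut(3)])
    show "AE x in lborel. (\<lambda>n. \<bar>V m x - g n x\<bar>) \<longlonglongrightarrow> 0"
      using ae
    proof eventually_elim
      case (elim x)
      have "(\<lambda>n. g n x) \<longlonglongrightarrow> V m x" unfolding g_def V_def clamp_def by (intro tendsto_intros elim)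
      then show ?case using tendsto_rabs_zero[OF LIM_zero] by (simp add: abs_minus_commute)
    qed
    show "AE x in lborel. norm \<bar>V m x - g n x\<bar> \<le> (2 * real m) * cut m x" for n
    proof (rule AE_I2)
      fix x
      have "V m x - g n x = cut m x * (clamp m (v x) - clamp m (\<gamma> n x))"
        by (simp add: V_def g_def algebra_simps)
      moreover have "\<bar>clamp m (v x) - clamp m (\<gamma> n x)\<bar> \<le> 2 * real m"
        using clamp(2)[of m "v x"] clamp(2)[of m "\<gamma> n x"] by linarith
      ultimately show "norm \<bar>V m x - g n x\<bar> \<le> (2 * real m) * cut m x"
        using cut(1)[of m x] by (simp add: abs_mult mult.commute[of "2 * real m"] mult_left_mono)
    qed
  qed auto
  then have "\<forall>\<^sub>F n in sequentially. (LINT x|lborel. \<bar>V m x - g n x\<bar>) < e / 2"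
    using order_tendstoD(2)[of _ "0::real" sequentially "e/2"] e by simp
  then obtain n where n: "(LINT x|lborel. \<bar>V m x - g n x\<bar>) < e / 2"
    using eventually_happens' sequentially_bot by blast
  have "(LINT x|lborel. \<bar>v x - g n x\<bar>) \<le> (LINT x|lborel. \<bar>v x - V m x\<bar> + \<bar>V m x - g n x\<bar>)"
    by (rule integral_mono) (use v V_int g_int in auto)
  also have "\<dots> = (LINT x|lborel. \<bar>v x - V m x\<bar>) + (LINT x|lborel. \<bar>V m x - g n x\<bar>)"
    using v V_int g_int by simp
  also have "\<dots> < e" using m n by simp
  finally show ?thesis using that[OF g_cont g_supp] by blast
qed

lemma conv_continuous_tendsto:
  fixes g :: "real ^ 'n \<Rightarrow> real"
  assumes g: "continuous_on UNIV g" "supp_in R g" and \<eta>: "mollifier \<eta> H"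
  shows "(\<lambda>n. LINT x|lborel. \<bar>conv g (\<eta> n) x - g x\<bar>) \<longlonglongrightarrow> 0"
proof -
  obtain B where B: "B > 0" "\<And>x. \<bar>g x\<bar> \<le> B" using continuous_supp_in_bounded[OF g] by blast
  have [measurable]: "g \<in> borel_measurable borel" by (intro borel_measurable_continuous_onI g)
  have int_g: "integrable lborel g" by (rule integrable_lborel_continuous_supp_in[OF g])
  have [measurable]: "conv g (\<eta> n) \<in> borel_measurable borel" for n
    using borel_measurable_integrable[OF conv_L1_bound(1)[OF int_g \<eta>]] by simp
  have int: "integrable lebesgue (\<lambda>y. g y * \<eta> n (x - y))" for n x
  proof -
    have "integrable lebesgue (\<lambda>y. B * \<eta> n (x - y))"
      using mollifier_integral_reflect(2)[OF \<eta>] by simp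
    then show ?thesis
    proof (rule Bochner_Integration.integrable_bound)
      show "(\<lambda>y. g y * \<eta> n (x - y)) \<in> borel_measurable lebesgue"
        using borel_measurable_integrable[OF mollifier_integral_reflect(2)[OF \<eta>, of n x]]
        by (intro borel_measurable_times) (auto intro: measurable_completion)
      show "AE y in lebesgue. norm (g y * \<eta> n (x - y)) \<le> norm (B * \<eta> n (x - y))"
        using B by (intro AE_I2) (auto simp: abs_mult intro!: mult_right_mono)
    qed
  qed
  \<comment> \<open>Averaging against \<open>\<eta> n\<close> sees only values within distance 1/(n
    + 1). The estimate is used three times: with continuity at x, with the global bound 2 B, and
    with 0 away from the support.\<close>
  have close: "\<bar>conv g (\<eta> n) x - g x\<bar> \<le> \<epsilon>"
    if "\<And>y. norm (x - y) \<le> 1 / real (Suc n) \<Longrightarrow> \<bar>g y - g x\<bar> \<le> \<epsilon>" for \<epsilon> n x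
  proof -
    have "conv g (\<eta> n) x - g x = (LINT y|lebesgue. g y * \<eta> n (x - y)) - (LINT y|lebesgue. g x * \<eta> n (x - y))"
      using mollifier_integral_reflect(1)[OF \<eta>] by (simp add: conv_def)
    also have "\<dots> = (LINT y|lebesgue. g y * \<eta> n (x - y) - g x * \<eta> n (x - y))"
      using int mollifier_integral_reflect(2)[OF \<eta>] by simp
    also have "\<bar>\<dots>\<bar> \<le> (LINT y|lebesgue. \<bar>g y * \<eta> n (x - y) - g x * \<eta> n (x - y)\<bar>)"
      by (rule integral_abs_bound)
    also have "\<dots> \<le> (LINT y|lebesgue. \<epsilon> * \<eta> n (x - y))"
    proof (rule integral_mono)
      fix y
      have "g y * \<eta> n (x - y) - g x * \<eta> n (x - y) = (g y - g x) * \<eta> n (x - y)" by (simp add: algebra_simps)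
      then show "\<bar>g y * \<eta> n (x - y) - g x * \<eta> n (x - y)\<bar> \<le> \<epsilon> * \<eta> n (x - y)"
        using that[of y] supp_inD[OF mollifierD(3)[OF \<eta>], of n "x - y"] mollifierD(2)[OF \<eta>, of n "x - y"]
        by (cases "norm (x - y) \<le> 1 / real (Suc n)") (auto simp: abs_mult intro!: mult_right_mono)
    qed (use int mollifier_integral_reflect(2)[OF \<eta>] in auto)
    also have "\<dots> = \<epsilon>" using mollifier_integral_reflect(1)[OF \<eta>] by simp
    finally show ?thesis .
  qed
  have "(\<lambda>n. LINT x|lborel. \<bar>conv g (\<eta> n) x - g x\<bar>) \<longlonglongrightarrow> (LINT x::real^'n|lborel. (0::real))"
  proof (rule integral_dominated_convergence[where w="\<lambda>x. (2 * B) * indicator (cball 0 (R + 1)) x"])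
    show "integrable lborel (\<lambda>x::real^'n. (2 * B) * indicator (cball 0 (R + 1)) x)"
      using emeasure_bounded_finite[OF bounded_cball[of "0::real^'n" "R + 1"]]
      by (intro integrable_mult_right integrable_real_indicator) auto
    have "(\<lambda>n. \<bar>conv g (\<eta> n) x - g x\<bar>) \<longlonglongrightarrow> 0" for x
    proof (rule LIMSEQ_I)
      fix e :: real assume "e > 0"
      moreover have "isCont g x" using g(1) by (simp add: continuous_on_eq_continuous_at)
      ultimately obtain d where d: "d > 0" "\<And>y. norm (y - x) < d \<Longrightarrow> norm (g y - g x) < e / 2"
        unfolding continuous_at_eps_delta dist_norm using half_gt_zero by blast
      obtain N where N: "1 / real (Suc N) < d" using d(1) nat_approx_posE by blast
      have "norm (\<bar>conv g (\<eta> n) x - g x\<bar> - 0) < e" if "n \<ge> N" for n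
      proof -
        have "1 / real (Suc n) \<le> 1 / real (Suc N)" using that by (simp add: frac_le)
        then have "\<bar>conv g (\<eta> n) x - g x\<bar> \<le> e / 2"
          using d(2) N by (intro close) (auto simp: norm_minus_commute intro!: less_imp_le)
        then show ?thesis using \<open>e > 0\<close> by simp
      qed
      then show "\<exists>N. \<forall>n\<ge>N. norm (\<bar>conv g (\<eta> n) x - g x\<bar> - 0) < e" by blast
    qed
    then show "AE x in lborel. (\<lambda>n. \<bar>conv g (\<eta> n) x - g x\<bar>) \<longlonglongrightarrow> 0" by simp
    show "AE x in lborel. norm \<bar>conv g (\<eta> n) x - g x\<bar> \<le> (2 * B) * indicator (cball 0 (R + 1)) x" for n
    proof (rule AE_I2)
      fix x
      show "norm \<bar>conv g (\<eta> n) x - g x\<bar> \<le> (2 * B) * indicator (cball 0 (R + 1)) x"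
      proof (cases "norm x \<le> R + 1")
        case True
        have "\<bar>g y - g x\<bar> \<le> 2 * B" for y using B(2)[of x] B(2)[of y] by linarith
        then have "\<bar>conv g (\<eta> n) x - g x\<bar> \<le> 2 * B" by (rule close)
        then show ?thesis using True by simp
      next
        case False
        have "\<bar>conv g (\<eta> n) x - g x\<bar> \<le> 0"
        proof (rule close)
          fix y assume "norm (x - y) \<le> 1 / real (Suc n)"
          then have "norm (x - y) \<le> 1" by (rule order_trans) simp
          then have "norm y > R" using False norm_triangle_ineq2[of x y] by simp
          then show "\<bar>g y - g x\<bar> \<le> 0" using False supp_inD[OF g(2)] by simp
        qed
        then show ?thesis using False by simp
      qed
    qed
  qed auto
  then show ?thesis by simp
qed

lemma locally_integrable_integrable:
  assumes "integrable lebesgue f"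
  shows "locally_integrable f"
  by (rule locally_integrableI) (use assms integrable_mult_indicator[of "cball 0 _" lebesgue f] in auto)

lemma conv_diff:
  assumes "locally_integrable v" "locally_integrable w" "continuous_on UNIV \<eta>" "supp_in R \<eta>"
  shows "conv (\<lambda>x. v x - w x) \<eta> x = conv v \<eta> x - conv w \<eta> x"
  using conv_integrable[OF assms(1,3,4)] conv_integrable[OF assms(2,3,4)]
  by (simp add: conv_def left_diff_distrib)

lemma conv_L1_tendsto_borel:
  fixes v :: "real ^ 'n \<Rightarrow> real"
  assumes v: "integrable lborel v" and \<eta>: "mollifier \<eta> H"
  shows "(\<lambda>n. LINT x|lborel. \<bar>conv v (\<eta> n) x - v x\<bar>) \<longlonglongrightarrow> 0"
proof (rule LIMSEQ_I)
  fix e :: real assume e: "e > 0"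
  obtain g R where g: "continuous_on UNIV g" "supp_in R g" "(LINT x|lborel. \<bar>v x - g x\<bar>) < e / 3"
    using L1_dense_continuous[OF v, of "e/3"] e by auto
  have int_g: "integrable lborel g" by (rule integrable_lborel_continuous_supp_in[OF g(1,2)])
  then have int_d: "integrable lborel (\<lambda>x. v x - g x)" using v by simp
  have li: "locally_integrable v" "locally_integrable g"
    using v int_g by (auto intro!: locally_integrable_integrable simp: integrable_completion)
  obtain N where N: "\<And>n. n \<ge> N \<Longrightarrow> (LINT x|lborel. \<bar>conv g (\<eta> n) x - g x\<bar>) < e / 3"
    using order_tendstoD(2)[OF conv_continuous_tendsto[OF g(1,2) \<eta>], of "e/3"] e
    by (auto simp: eventually_sequentially)
  have "(LINT x|lborel. \<bar>conv v (\<eta> n) x - v x\<bar>) < e" if "n \<ge> N" for n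
  proof -
    note c = conv_L1_bound[OF int_d \<eta>, of n] conv_L1_bound(1)[OF int_g \<eta>, of n] conv_L1_bound(1)[OF v \<eta>, of n]
    have "(LINT x|lborel. \<bar>conv v (\<eta> n) x - v x\<bar>)
        \<le> (LINT x|lborel. \<bar>conv (\<lambda>x. v x - g x) (\<eta> n) x\<bar> + \<bar>conv g (\<eta> n) x - g x\<bar> + \<bar>v x - g x\<bar>)"
    proof (rule integral_mono)
      show "\<bar>conv v (\<eta> n) x - v x\<bar> \<le> \<bar>conv (\<lambda>x. v x - g x) (\<eta> n) x\<bar> + \<bar>conv g (\<eta> n) x - g x\<bar> + \<bar>v x - g x\<bar>" for x
        using conv_diff[OF li mollifier_continuous[OF \<eta>] mollifierD(3)[OF \<eta>], of n x] by linarith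
    qed (use c v int_g in auto)
    also have "\<dots> = (LINT x|lborel. \<bar>conv (\<lambda>x. v x - g x) (\<eta> n) x\<bar>) + (LINT x|lborel. \<bar>conv g (\<eta> n) x - g x\<bar>)
        + (LINT x|lborel. \<bar>v x - g x\<bar>)"
      using c v int_g by simp
    also have "\<dots> < e" using c(2) g(3) N[OF that] by linarith
    finally show ?thesis .
  qed
  then show "\<exists>N. \<forall>n\<ge>N. norm ((LINT x|lborel. \<bar>conv v (\<eta> n) x - v x\<bar>) - 0) < e"
    by (auto simp: Bochner_Integration.integral_nonneg)
qed

lemma conv_L1_tendsto:
  fixes v :: "real ^ 'n \<Rightarrow> real"
  assumes v: "integrable lebesgue v" and \<eta>: "mollifier \<eta> H"
  shows "integrable lebesgue (conv v (\<eta> n))"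
    "(\<lambda>n. LINT x|lebesgue. \<bar>conv v (\<eta> n) x - v x\<bar>) \<longlonglongrightarrow> 0"
proof -
  obtain w where w[measurable]: "w \<in> borel_measurable borel" and "AE x in lborel. v x = w x"
    using completion_ex_borel_measurable_real[OF borel_measurable_integrable[OF v]] by auto
  then have ae: "AE x in lebesgue. v x = w x" by (intro AE_completion)
  have "integrable lebesgue w"
    using v ae w by (subst integrable_cong_AE[of w lebesgue v]) (auto intro: measurable_completion borel_measurable_integrable)
  then have int_w: "integrable lborel w" by (simp add: integrable_completion)
  have [measurable]: "v \<in> borel_measurable lebesgue" using v by auto
  have [measurable]: "\<eta> n \<in> borel_measurable borel" for n
    by (intro borel_measurable_continuous_onI mollifier_continuous[OF \<eta>])
  have eq: "conv v (\<eta> n) = conv w (\<eta> n)" for n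
  proof
    fix x
    show "conv v (\<eta> n) x = conv w (\<eta> n) x"
      unfolding conv_def
    proof (rule integral_cong_AE)
      have [measurable]: "(\<lambda>y. \<eta> n (x - y)) \<in> borel_measurable lebesgue"
        using mollifier_integral_reflect(2)[OF \<eta>] by (rule borel_measurable_integrable)
      have [measurable]: "w \<in> borel_measurable lebesgue" by (rule measurable_completion) simp
      show "(\<lambda>y. v y * \<eta> n (x - y)) \<in> borel_measurable lebesgue" "(\<lambda>y. w y * \<eta> n (x - y)) \<in> borel_measurable lebesgue"
        by measurable
      show "AE y in lebesgue. v y * \<eta> n (x - y) = w y * \<eta> n (x - y)" using ae by eventually_elim simp
    qed
  qed
  note c = conv_L1_bound(1)[OF int_w \<eta>]
  have [measurable]: "conv w (\<eta> n) \<in> borel_measurable borel" for n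
    using borel_measurable_integrable[OF c] by simp
  have [measurable]: "conv w (\<eta> n) \<in> borel_measurable lebesgue" "w \<in> borel_measurable lebesgue" for n
    by (auto intro: measurable_completion)
  show "integrable lebesgue (conv v (\<eta> n))" unfolding eq using c by (simp add: integrable_completion)
  have "(LINT x|lebesgue. \<bar>conv v (\<eta> n) x - v x\<bar>) = (LINT x|lebesgue. \<bar>conv w (\<eta> n) x - w x\<bar>)" for n
    unfolding eq by (rule integral_cong_AE) (use ae in auto)
  also have "(LINT x|lebesgue. \<bar>conv w (\<eta> n) x - w x\<bar>) = (LINT x|lborel. \<bar>conv w (\<eta> n) x - w x\<bar>)" for n
    by (rule lborel_integral_lebesgue) measurable
  finally show "(\<lambda>n. LINT x|lebesgue. \<bar>conv v (\<eta> n) x - v x\<bar>) \<longlonglongrightarrow> 0"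
    using conv_L1_tendsto_borel[OF int_w \<eta>] by simp
qed

text \<open>The supporting line for Jensen's inequality. Convexity is invoked on the open half-line,
  so the point 0 is checked by hand.\<close>

lemma powr_above_tangent:
  fixes m t p :: real
  assumes "1 \<le> p" "0 < m" "0 \<le> t"
  shows "m powr p + p * m powr (p - 1) * (t - m) \<le> t powr p"
proof (cases "t = 0")
  case True
  have "m powr p + p * m powr (p - 1) * (t - m) = m powr p - p * m powr p"
    using True assms by (simp add: powr_diff)
  moreover have "m powr p \<le> p * m powr p" using assms by simp
  ultimately have "m powr p + p * m powr (p - 1) * (t - m) \<le> 0" by linarith
  then show ?thesis by (rule order_trans) simp
next
  case False
  have "((\<lambda>x. x powr p) has_real_derivative p * m powr (p - 1)) (at m within {0<..})"
    by (rule has_field_derivative_at_within[OF has_real_derivative_powr[OF assms(2)]])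
  then have "t powr p - m powr p \<ge> p * m powr (p - 1) * (t - m)"
    using convex_on_imp_above_tangent[OF powr_convex[OF assms(1)], of m t "p * m powr (p - 1)"] assms False
    by (auto simp: is_interval_connected interior_open connected_Ioi)
  then show ?thesis by simp
qed

lemma locally_integrable_abs: "locally_integrable f \<Longrightarrow> locally_integrable (\<lambda>x. \<bar>f x\<bar>)"
  by (rule locally_integrableI)
    (use integrable_abs[OF locally_integrableD] in \<open>fastforce simp: abs_mult\<close>)

lemma abs_le_one_plus_powr:
  fixes x p :: real
  assumes "1 \<le> p"
  shows "\<bar>x\<bar> \<le> 1 + \<bar>x\<bar> powr p"
proof (cases "\<bar>x\<bar> \<le> 1")
  case False
  then show ?thesis using powr_mono[OF assms, of "\<bar>x\<bar>"] by simp
qed (simp add: add_increasing2)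

lemma locally_integrable_powr_imp:
  fixes v :: "real ^ 'n \<Rightarrow> real"
  assumes p: "1 \<le> p" and m: "v \<in> borel_measurable lebesgue" and v: "locally_integrable (\<lambda>x. \<bar>v x\<bar> powr p)"
  shows "locally_integrable v"
proof (rule locally_integrableI)
  fix R
  let ?B = "cball (0::real^'n) R"
  have "integrable lebesgue (\<lambda>x. indicator ?B x + indicator ?B x * \<bar>v x\<bar> powr p)"
    using emeasure_bounded_finite[OF bounded_cball[of "0::real^'n" R]]
    by (intro Bochner_Integration.integrable_add integrable_real_indicator locally_integrableD[OF v]) auto
  then show "integrable lebesgue (\<lambda>x. indicator ?B x * v x)"
  proof (rule Bochner_Integration.integrable_bound)
    show "(\<lambda>x. indicator ?B x * v x) \<in> borel_measurable lebesgue"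
      by (intro borel_measurable_times borel_measurable_indicator m) auto
    have "\<bar>v x\<bar> \<le> \<bar>1 + \<bar>v x\<bar> powr p\<bar>" for x
      using abs_le_one_plus_powr[OF p, of "v x"] by linarith
    then show "AE x in lebesgue. norm (indicator ?B x * v x) \<le> norm (indicator ?B x + indicator ?B x * \<bar>v x\<bar> powr p)"
      by (intro AE_I2) (auto simp: indicator_def)
  qed
qed

text \<open>Jensen's inequality for the probability density \<open>y \<mapsto> \<eta> n (x - y)\<close>, by the tangent line at
  the mean.\<close>

lemma conv_jensen:
  fixes v :: "real ^ 'n \<Rightarrow> real"
  assumes p: "1 \<le> p" and m: "v \<in> borel_measurable lebesgue" and v: "locally_integrable (\<lambda>x. \<bar>v x\<bar> powr p)"
    and \<eta>: "mollifier \<eta> H"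
  shows "\<bar>conv v (\<eta> n) x\<bar> powr p \<le> conv (\<lambda>x. \<bar>v x\<bar> powr p) (\<eta> n) x"
proof -
  let ?k = "\<lambda>y. \<eta> n (x - y)"
  define M where "M = conv (\<lambda>x. \<bar>v x\<bar>) (\<eta> n) x"
  have nn: "0 \<le> ?k y" for y by (rule mollifierD(2)[OF \<eta>])
  have li: "locally_integrable v" by (rule locally_integrable_powr_imp[OF p m v])
  note int = conv_integrable[OF _ mollifier_continuous[OF \<eta>] mollifierD(3)[OF \<eta>], of _ n x]
  note int_k = mollifier_integral_reflect(2)[OF \<eta>, of n x]
  have "\<bar>conv v (\<eta> n) x\<bar> \<le> (LINT y|lebesgue. \<bar>v y * ?k y\<bar>)"
    unfolding conv_def by (rule integral_abs_bound)
  also have "\<dots> = M" using nn by (simp add: M_def conv_def abs_mult)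
  finally have le: "\<bar>conv v (\<eta> n) x\<bar> \<le> M" .
  show ?thesis
  proof (cases "M = 0")
    case True
    then have "conv v (\<eta> n) x = 0" using le by simp
    then show ?thesis using nn by (simp add: conv_def Bochner_Integration.integral_nonneg)
  next
    case False
    then have M: "M > 0" using le by linarith
    have eq: "(M powr p + p * M powr (p - 1) * (\<bar>v y\<bar> - M)) * ?k y
        = (M powr p - p * M powr (p - 1) * M) * ?k y + p * M powr (p - 1) * (\<bar>v y\<bar> * ?k y)" for y
      by (simp add: algebra_simps)
    have "\<bar>conv v (\<eta> n) x\<bar> powr p \<le> M powr p" using le p by (intro powr_mono2) auto
    also have "\<dots> = (LINT y|lebesgue. (M powr p + p * M powr (p - 1) * (\<bar>v y\<bar> - M)) * ?k y)"
      unfolding eq using int[OF locally_integrable_abs[OF li]] int_k mollifier_integral_reflect(1)[OF \<eta>, of n x]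
      by (simp add: M_def[unfolded conv_def, symmetric])
    also have "\<dots> \<le> (LINT y|lebesgue. \<bar>v y\<bar> powr p * ?k y)"
    proof (rule integral_mono)
      show "integrable lebesgue (\<lambda>y. (M powr p + p * M powr (p - 1) * (\<bar>v y\<bar> - M)) * ?k y)"
        unfolding eq using int[OF locally_integrable_abs[OF li]] int_k by simp
      show "integrable lebesgue (\<lambda>y. \<bar>v y\<bar> powr p * ?k y)" by (rule int[OF v])
      show "(M powr p + p * M powr (p - 1) * (\<bar>v y\<bar> - M)) * ?k y \<le> \<bar>v y\<bar> powr p * ?k y" for y
        by (intro mult_right_mono nn powr_above_tangent p M) simp
    qed
    finally show ?thesis by (simp add: conv_def)
  qed
qed

lemma conv_cutoff:
  assumes \<eta>: "mollifier \<eta> H" and x: "norm x \<le> R"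
  shows "conv (\<lambda>y. indicator (cball 0 (R + 1)) y * v y) (\<eta> n) x = conv v (\<eta> n) x"
  unfolding conv_def
proof (rule Bochner_Integration.integral_cong[OF refl])
  fix y
  show "indicator (cball 0 (R + 1)) y * v y * \<eta> n (x - y) = v y * \<eta> n (x - y)"
  proof (cases "norm y \<le> R + 1")
    case False
    then have "norm (x - y) > 1" using x norm_triangle_ineq3[of x y] by simp
    then show ?thesis using supp_inD[OF mollifier_supp_in_1[OF \<eta>]] by simp
  qed simp
qed

text \<open>Mollifications of \<open>w\<close> and of |w|^p both converge in L1. By Jensen's
  inequality the latter dominate the p-th powers of the former, so convergence in L^p follows from
  the case p = 1 and varying majorants. The cutoff at R + 1 is invisible on the ball of radius
  R.\<close>

lemma mollification_Lp_local:
  fixes v :: "'i \<Rightarrow> real ^ 'n \<Rightarrow> real"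
  assumes I: "finite I" and p: "1 \<le> p" and \<eta>: "mollifier \<eta> H"
    and m: "\<And>u. u \<in> I \<Longrightarrow> v u \<in> borel_measurable lebesgue"
    and v: "\<And>u. u \<in> I \<Longrightarrow> locally_integrable (\<lambda>x. \<bar>v u x\<bar> powr p)"
  obtains r where "strict_mono r"
    "\<And>u. u \<in> I \<Longrightarrow> Lpconv lebesgue p (\<lambda>n x. indicator (cball 0 R) x * conv (v u) (\<eta> (r n)) x)
      (\<lambda>x. indicator (cball 0 R) x * v u x)"
proof -
  define w where "w u x = indicator (cball 0 (R + 1)) x * v u x" for u x
  define q where "q u x = \<bar>w u x\<bar> powr p" for u x
  \<comment> \<open>The Boolean tag merges both families into one, so that a single subsequence
    serves them all.\<close>
  define f where "f = (\<lambda>(u, b). if b then w u else q u)"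
  have q_eq: "q u x = indicator (cball 0 (R + 1)) x * \<bar>v u x\<bar> powr p" for u x
    by (auto simp: q_def w_def indicator_def)
  have int: "integrable lebesgue (w u)" "integrable lebesgue (q u)" if "u \<in> I" for u
    unfolding w_def[abs_def] q_eq[abs_def]
    by (intro locally_integrableD locally_integrable_powr_imp[OF p m v] v that)+
  have int_f: "integrable lebesgue (f i)" if "i \<in> I \<times> UNIV" for i
    using that int by (auto simp: f_def)
  have "Lpconv lebesgue 1 (\<lambda>n. conv (f i) (\<eta> n)) (f i)" if i: "i \<in> I \<times> UNIV" for i
    using conv_L1_tendsto[OF int_f[OF i] \<eta>] int_f[OF i]
    by (auto simp: Lpconv_def intro!: LspaceI)
  then obtain r where r: "strict_mono r"
    "\<And>i. i \<in> I \<times> UNIV \<Longrightarrow> AE x in lebesgue. (\<lambda>n. conv (f i) (\<eta> (r n)) x) \<longlonglongrightarrow> f i x"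
    by (rule Lpconv_AE_subseq_finite[of "I \<times> UNIV", rotated 2]) (use I in auto)
  have "Lpconv lebesgue p (\<lambda>n x. indicator (cball 0 R) x * conv (v u) (\<eta> (r n)) x)
      (\<lambda>x. indicator (cball 0 R) x * v u x)" if u: "u \<in> I" for u
  proof (rule Lpconv_dominated)
    have ae: "AE x in lebesgue. (\<lambda>n. conv (w u) (\<eta> (r n)) x) \<longlonglongrightarrow> w u x"
      "AE x in lebesgue. (\<lambda>n. conv (q u) (\<eta> (r n)) x) \<longlonglongrightarrow> q u x"
      using r(2)[of "(u, True)"] r(2)[of "(u, False)"] u by (auto simp: f_def)
    have ind: "indicator (cball 0 R) x * conv (v u) (\<eta> n) x = indicator (cball 0 R) x * conv (w u) (\<eta> n) x" for n x
      using conv_cutoff[OF \<eta>, of x R "v u" n] by (auto simp: w_def[abs_def] indicator_def)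
    have [measurable]: "conv (w u) (\<eta> n) \<in> borel_measurable lebesgue" for n
      using conv_L1_tendsto(1)[OF int(1)[OF u] \<eta>] by auto
    show "L1conv lebesgue (\<lambda>n. conv (q u) (\<eta> (r n))) (q u)"
      unfolding L1conv_def
      using conv_L1_tendsto(1)[OF int(2)[OF u] \<eta>] int(2)[OF u] ae(2)
        LIMSEQ_subseq_LIMSEQ[OF conv_L1_tendsto(2)[OF int(2)[OF u] \<eta>] r(1)] by (auto simp: o_def)
    show "(\<lambda>x. indicator (cball 0 R) x * conv (v u) (\<eta> (r n)) x) \<in> borel_measurable lebesgue" for n
      unfolding ind by (intro borel_measurable_times borel_measurable_indicator) auto
    show "(\<lambda>x. indicator (cball 0 R) x * v u x) \<in> borel_measurable lebesgue"
      by (intro borel_measurable_times borel_measurable_indicator m u) auto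
    have ind': "indicator (cball 0 R) x * w u x = indicator (cball 0 R) x * v u x" for x :: "real ^ 'n"
      by (auto simp: w_def indicator_def)
    show "AE x in lebesgue. (\<lambda>n. indicator (cball 0 R) x * conv (v u) (\<eta> (r n)) x) \<longlonglongrightarrow> indicator (cball 0 R) x * v u x"
      unfolding ind ind'[symmetric] using ae(1) by eventually_elim (intro tendsto_intros)
    have li_q: "locally_integrable (\<lambda>x. \<bar>w u x\<bar> powr p)"
      using locally_integrable_integrable[OF int(2)[OF u]] by (simp add: q_def[abs_def])
    have "\<bar>indicator (cball 0 R) x * conv (v u) (\<eta> (r n)) x\<bar> powr p \<le> conv (q u) (\<eta> (r n)) x" for n x
    proof -
      have "\<bar>indicator (cball 0 R) x * conv (w u) (\<eta> (r n)) x\<bar> powr p \<le> \<bar>conv (w u) (\<eta> (r n)) x\<bar> powr p"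
        by (auto simp: indicator_def)
      also have "\<dots> \<le> conv (q u) (\<eta> (r n)) x"
        unfolding q_def by (rule conv_jensen[OF p borel_measurable_integrable[OF int(1)[OF u]] li_q \<eta>])
      finally show ?thesis unfolding ind .
    qed
    then show "AE x in lebesgue. \<bar>indicator (cball 0 R) x * conv (v u) (\<eta> (r n)) x\<bar> powr p \<le> conv (q u) (\<eta> (r n)) x" for n
      by simp
  qed (use p in simp)
  then show ?thesis using that r(1) by blast
qed

text \<open>Convolving either version with a mollifier gives the same function, the classical
  derivative of the mollified \<open>a\<close>. The difference thus has vanishing mollifications,
  which converge locally in mean to the difference itself.\<close>

lemma has_weak_deriv_unique:
  fixes v w :: "real ^ 'n \<Rightarrow> real"
  assumes v: "has_weak_deriv a s v" and w: "has_weak_deriv a s w"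
  shows "AE x in lebesgue. v x = w x"
proof -
  obtain \<eta> :: "nat \<Rightarrow> real ^ 'n \<Rightarrow> real" and H where \<eta>: "mollifier \<eta> H" using mollifier_exists by blast
  have li: "locally_integrable v" "locally_integrable w" using v w by (auto simp: has_weak_deriv_def)
  define z where "z x = v x - w x" for x
  have z_li: "locally_integrable z"
  proof (rule locally_integrableI)
    fix R
    have "(\<lambda>x. indicator (cball 0 R) x * z x)
        = (\<lambda>x. indicator (cball 0 R) x * v x - indicator (cball 0 R) x * w x)"
      by (simp add: z_def algebra_simps)
    then show "integrable lebesgue (\<lambda>x. indicator (cball 0 R) x * z x)"
      using locally_integrableD[OF li(1)] locally_integrableD[OF li(2)] by simp
  qed
  have z0: "conv z (\<eta> n) x = 0" for n x
    unfolding z_def using conv_diff[OF li mollifier_continuous[OF \<eta>] mollifierD(3)[OF \<eta>], of n x]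
      conv_weak_deriv[OF v mollifierD(1)[OF \<eta>] mollifierD(3)[OF \<eta>]]
      conv_weak_deriv[OF w mollifierD(1)[OF \<eta>] mollifierD(3)[OF \<eta>]] by simp
  have "AE x in lebesgue. indicator (cball 0 (real R)) x * z x = 0" for R :: nat
  proof -
    have "locally_integrable (\<lambda>x. \<bar>z x\<bar> powr 1)" using locally_integrable_abs[OF z_li] by simp
    then obtain r where r: "strict_mono r" "Lpconv lebesgue 1 (\<lambda>n x. indicator (cball 0 (real R)) x * conv z (\<eta> (r n)) x)
      (\<lambda>x. indicator (cball 0 (real R)) x * z x)"
      using mollification_Lp_local[of "{()}" 1 \<eta> H "\<lambda>_. z" "real R"] \<eta> locally_integrable_measurable[OF z_li] by auto
    have "(LINT x|lebesgue. \<bar>indicator (cball 0 (real R)) x * z x\<bar>) = 0"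
      using LpconvD(3)[OF r(2)] by (simp add: z0 LIMSEQ_const_iff)
    then have "AE x in lebesgue. \<bar>indicator (cball 0 (real R)) x * z x\<bar> = 0"
      using integral_nonneg_eq_0_iff_AE[OF integrable_abs[OF locally_integrableD[OF z_li]]] by simp
    then show ?thesis by simp
  qed
  then have "AE x in lebesgue. \<forall>R::nat. indicator (cball 0 (real R)) x * z x = 0"
    unfolding AE_all_countable by blast
  then show ?thesis
  proof eventually_elim
    case (elim x)
    obtain R :: nat where "norm x \<le> real R" using real_arch_simple by blast
    then show ?case using elim[rule_format, of R] by (simp add: z_def)
  qed
qed

section \<open>A smooth weight\<close>

text \<open>Powers of the Japanese bracket \<open>\<langle>z\<rangle> = sqrt (1 + z\<^sup>2)\<close> and their first two derivatives. The weight
  \<open>exp (- \<langle>z\<rangle>\<^sup>t)\<close> is smooth, unlike \<open>exp (- \<theta> \<bar>z\<bar>)\<close>, which has a kink at \<open>0\<close>, but comparable to it.\<close>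

definition jp :: "real \<Rightarrow> real \<Rightarrow> real" where
  "jp t z = (1 + z\<^sup>2) powr (t / 2)"

definition jp' :: "real \<Rightarrow> real \<Rightarrow> real" where
  "jp' t z = t * z * (1 + z\<^sup>2) powr (t / 2 - 1)"

definition jp'' :: "real \<Rightarrow> real \<Rightarrow> real" where
  "jp'' t z = t * (1 + z\<^sup>2) powr (t / 2 - 1) + t * z * ((t / 2 - 1) * (2 * z) * (1 + z\<^sup>2) powr (t / 2 - 2))"

definition rho :: "real \<Rightarrow> real ^ 'n \<Rightarrow> real" where
  "rho t x = (\<Prod>i\<in>UNIV. exp (- jp t (x $ i)))"

definition rho_measure :: "real \<Rightarrow> (real ^ 'n) measure" where
  "rho_measure t = density lebesgue (\<lambda>x. ennreal (rho t x))"

lemma one_plus_sq_pos: "1 + z\<^sup>2 > (0::real)" "1 + z\<^sup>2 \<noteq> (0::real)" "1 + z\<^sup>2 \<ge> (1::real)"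
  using zero_le_power2[of z] by linarith+

lemma one_plus_sq_powr_has_real_derivative:
  "((\<lambda>z. (1 + z\<^sup>2) powr p) has_real_derivative p * (2 * z) * (1 + z\<^sup>2) powr (p - 1)) (at z)"
  by (rule DERIV_cong[OF DERIV_powr[where g="\<lambda>z. 1 + z\<^sup>2" and f="\<lambda>_. p" and r=0 and m="2 * z"]])
    (use one_plus_sq_pos(1)[of z] in \<open>auto intro!: derivative_eq_intros simp: powr_diff field_simps\<close>)

lemma jp_has_real_derivative: "(jp t has_real_derivative jp' t z) (at z)"
  unfolding jp_def[abs_def] jp'_def
  by (rule DERIV_cong[OF one_plus_sq_powr_has_real_derivative]) simp

lemma jp'_has_real_derivative: "(jp' t has_real_derivative jp'' t z) (at z)"
  unfolding jp'_def[abs_def] jp''_def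
  by (rule DERIV_cong[OF DERIV_mult[OF DERIV_cmult[OF DERIV_ident, of t] one_plus_sq_powr_has_real_derivative]])
    (simp add: algebra_simps)

lemma continuous_one_plus_sq_powr: "continuous_on A (\<lambda>z::real. (1 + z\<^sup>2) powr p)"
  by (intro continuous_intros) (use one_plus_sq_pos in auto)

lemma continuous_jp: "continuous_on A (jp t)" "continuous_on A (jp' t)" "continuous_on A (jp'' t)"
  unfolding jp_def jp'_def jp''_def by (intro continuous_intros continuous_one_plus_sq_powr)+

lemma abs_le_one_plus_sq_powr: "\<bar>z :: real\<bar> \<le> (1 + z\<^sup>2) powr (1/2)"
proof -
  have "\<bar>z\<bar> \<le> sqrt (1 + z\<^sup>2)" by (rule real_le_rsqrt) simp
  then show ?thesis using one_plus_sq_pos(1)[of z] by (simp add: powr_half_sqrt)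
qed

context
  fixes t :: real
  assumes t: "0 < t" "t \<le> 2"
begin

lemma jp'_quadratic_bound: "\<bar>jp' t z\<bar> \<le> 2 * (1 + z\<^sup>2)"
proof -
  have "\<bar>jp' t z\<bar> = t * \<bar>z\<bar> * (1 + z\<^sup>2) powr (t / 2 - 1)"
    using t by (simp add: jp'_def abs_mult)
  also have "\<dots> \<le> 2 * (1 + z\<^sup>2) powr (1/2) * (1 + z\<^sup>2) powr 0"
    using t one_plus_sq_pos[of z] by (intro mult_mono powr_mono abs_le_one_plus_sq_powr) auto
  also have "\<dots> \<le> 2 * (1 + z\<^sup>2) powr 1"
    using one_plus_sq_pos[of z] powr_mono[of "1/2" 1 "1 + z\<^sup>2"] by simp
  finally show ?thesis using one_plus_sq_pos[of z] by simp
qed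

text \<open>The restriction t \<le> 2 makes the relevant exponents nonpositive. Boundedness of this
  second derivative later bounds the derivative of the field \<open>drift\<close>.\<close>

lemma jp''_bound: "\<bar>jp'' t z\<bar> \<le> 6"
proof -
  have le1: "(1 + z\<^sup>2) powr p \<le> 1" if "p \<le> 0" for p
    using powr_mono[OF that, of "1 + z\<^sup>2"] one_plus_sq_pos[of z] by simp
  have "z\<^sup>2 * (1 + z\<^sup>2) powr (t / 2 - 2) \<le> (1 + z\<^sup>2) powr 1 * (1 + z\<^sup>2) powr (t / 2 - 2)"
    using one_plus_sq_pos[of z] by (intro mult_right_mono) auto
  also have "\<dots> \<le> 1" using t by (subst powr_add[symmetric]) (intro le1, simp)
  finally have a: "z\<^sup>2 * (1 + z\<^sup>2) powr (t / 2 - 2) \<le> 1" .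
  have "\<bar>jp'' t z\<bar> \<le> \<bar>t * (1 + z\<^sup>2) powr (t / 2 - 1)\<bar> + \<bar>(t * (t - 2)) * (z\<^sup>2 * (1 + z\<^sup>2) powr (t / 2 - 2))\<bar>"
    unfolding jp''_def by (rule order_trans[OF abs_triangle_ineq]) (simp add: algebra_simps power2_eq_square)
  also have "\<dots> \<le> 2 * 1 + 4 * 1"
  proof (rule add_mono)
    show "\<bar>t * (1 + z\<^sup>2) powr (t / 2 - 1)\<bar> \<le> 2 * 1"
      unfolding abs_mult using t le1[of "t / 2 - 1"] by (intro mult_mono) auto
    have "\<bar>t * (t - 2)\<bar> \<le> 2 * 2" unfolding abs_mult using t by (intro mult_mono) auto
    then show "\<bar>(t * (t - 2)) * (z\<^sup>2 * (1 + z\<^sup>2) powr (t / 2 - 2))\<bar> \<le> 4 * 1"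
      unfolding abs_mult[of "t * (t - 2)"] using a by (intro mult_mono) auto
  qed
  finally show ?thesis by simp
qed

lemma jp_decay:
  obtains K where "K \<ge> 0" "\<And>z. exp (- jp t z) * (1 + \<bar>jp' t z\<bar>) \<le> K * inverse (1 + z\<^sup>2)"
proof -
  \<comment> \<open>The exponent 4/t arises from (1 + z^2)^2 = (jp t z)^(4/t). One factor 1 + z^2
    absorbs the growth of \<open>jp'\<close>, the other yields the integrable decay.\<close>
  obtain N :: nat where N: "4 / t \<le> real N" using real_arch_simple by blast
  have *: "exp (- jp t z) * (1 + \<bar>jp' t z\<bar>) \<le> (3 * fact N) * inverse (1 + z\<^sup>2)" for z
  proof -
    let ?q = "1 + z\<^sup>2"
    note q = one_plus_sq_pos[of z]
    have jp1: "jp t z \<ge> 1" unfolding jp_def using t q(3) by (simp add: ge_one_powr_ge_zero)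
    have "?q\<^sup>2 = ?q powr 2" using q by (simp add: powr_numeral)
    also have "\<dots> = jp t z powr (4 / t)" unfolding jp_def powr_powr using t by simp
    also have "\<dots> \<le> jp t z powr real N" using N jp1 by (intro powr_mono) auto
    also have "\<dots> = jp t z ^ N" using jp1 by (simp add: powr_realpow)
    finally have 1: "?q\<^sup>2 \<le> jp t z ^ N" .
    have "jp t z ^ N / fact N \<le> exp (jp t z)"
    proof -
      have "(\<Sum>n\<in>{N}. jp t z ^ n /\<^sub>R fact n) \<le> (\<Sum>n. jp t z ^ n /\<^sub>R fact n)"
        using jp1 by (intro sum_le_suminf summable_exp_generic) auto
      then show ?thesis by (simp add: exp_def divide_inverse mult.commute)
    qed
    then have 2: "jp t z ^ N * exp (- jp t z) \<le> fact N"
      by (simp add: exp_minus divide_simps mult.commute)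
    have "(exp (- jp t z) * (1 + \<bar>jp' t z\<bar>)) * ?q \<le> (exp (- jp t z) * (3 * ?q)) * ?q"
    proof (intro mult_right_mono mult_left_mono)
      show "1 + \<bar>jp' t z\<bar> \<le> 3 * ?q" using add_mono[OF q(3) jp'_quadratic_bound[of z]] by simp
    qed (use q in auto)
    also have "\<dots> = 3 * (?q\<^sup>2 * exp (- jp t z))" by (simp add: power2_eq_square)
    also have "\<dots> \<le> 3 * (jp t z ^ N * exp (- jp t z))" using 1 by (intro mult_left_mono mult_right_mono) auto
    also have "\<dots> \<le> 3 * fact N" using 2 by simp
    finally show ?thesis using q(1) pos_le_divide_eq[OF q(1)] by (simp add: divide_inverse)
  qed
  show ?thesis by (rule that[OF _ *]) simp
qed

end

section \<open>Integrability of the product weight\<close>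

lemma prod_Basis_vec: "(\<Prod>b\<in>Basis. f (x \<bullet> b)) = (\<Prod>i\<in>UNIV. f ((x :: real ^ 'n) $ i))"
proof -
  have B: "(Basis :: (real ^ 'n) set) = (\<lambda>i. axis i 1) ` UNIV"
    by (auto simp: Basis_vec_def)
  have inj: "inj (\<lambda>i::'n. axis i (1::real))" by (auto simp: inj_on_def axis_eq_axis)
  show ?thesis unfolding B prod.reindex[OF inj] by (simp add: inner_axis)
qed

lemma integrable_lborel_vec_prod:
  fixes f :: "real \<Rightarrow> real"
  assumes f: "integrable lborel f" "\<And>z. 0 \<le> f z"
  shows "integrable lborel (\<lambda>x::real^'n. \<Prod>i\<in>UNIV. f (x $ i))"
proof (rule integrableI_nonneg)
  have [measurable]: "f \<in> borel_measurable borel" using f by simp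
  show "(\<lambda>x::real^'n. \<Prod>i\<in>UNIV. f (x $ i)) \<in> borel_measurable lborel"
    by (intro borel_measurable_prod) measurable
  show "AE x in lborel. 0 \<le> (\<Prod>i\<in>UNIV. f ((x::real^'n) $ i))" using f(2) by (simp add: prod_nonneg)
  have "(\<integral>\<^sup>+ x. ennreal (\<Prod>i\<in>UNIV. f ((x::real^'n) $ i)) \<partial>lborel)
      = (\<integral>\<^sup>+ x. (\<Prod>b\<in>Basis. ennreal (f ((x::real^'n) \<bullet> b))) \<partial>lborel)"
    using f(2) by (simp add: prod_ennreal prod_Basis_vec)
  also have "\<dots> = (\<Prod>b\<in>(Basis::(real^'n) set). (\<integral>\<^sup>+ x. ennreal (f x) \<partial>lborel))"
    by (rule nn_integral_lborel_prod) auto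
  also have "\<dots> < \<infinity>"
    using f by (simp add: nn_integral_eq_integral power_less_top_ennreal)
  finally show "(\<integral>\<^sup>+ x. ennreal (\<Prod>i\<in>UNIV. f ((x::real^'n) $ i)) \<partial>lborel) < \<infinity>" .
qed

lemma integrable_inverse_one_plus_sq: "integrable lborel (\<lambda>z::real. inverse (1 + z\<^sup>2))"
  using integrable_I0i_1_div_plus_square integrable_inverse_1_plus_square
  by (simp add: set_integrable_def)

lemma rho_pos: "0 < rho t x"
  by (simp add: rho_def prod_pos)

lemma rho_nonneg [simp]: "0 \<le> rho t x" "\<bar>rho t x\<bar> = rho t x"
  using rho_pos[of t x] by simp_all

lemma rho_le_1: "rho t x \<le> 1"
  unfolding rho_def by (intro prod_le_1) (auto simp: jp_def)

lemma rho_continuous: "continuous_on A (rho t)"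
  unfolding rho_def by (intro continuous_intros continuous_on_compose2[OF continuous_jp(1)[of UNIV]]) auto

lemma rho_measurable [measurable]: "rho t \<in> borel_measurable borel" "rho t \<in> borel_measurable lebesgue"
proof -
  show "rho t \<in> borel_measurable borel" by (intro borel_measurable_continuous_onI rho_continuous)
  then show "rho t \<in> borel_measurable lebesgue" by (intro measurable_completion) simp
qed

lemma rho_eq_exp: "rho t x = exp (- (\<Sum>i\<in>UNIV. jp t (x $ i)))"
  by (simp add: rho_def exp_sum[symmetric] sum_negf)

lemma nth_plus_axis: "(x + u *\<^sub>R axis i 1) $ j = (if j = i then x $ i + u else (x :: real ^ 'n) $ j)"
  by (simp add: axis_def)

lemma has_partial_coord:
  assumes "\<And>z. (f has_real_derivative f' z) (at z)"
  shows "has_partial i (\<lambda>x. f (x $ i)) (\<lambda>x. f' (x $ i))"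
  unfolding has_partial_def nth_plus_axis
proof
  fix x :: "real ^ 'a"
  show "((\<lambda>u. f (if i = i then x $ i + u else x $ i)) has_real_derivative f' (x $ i)) (at 0)"
    using DERIV_shift[of f "f' (x $ i)" 0 "x $ i"] assms[of "x $ i"] by (simp add: add.commute)
qed

lemma has_partial_rho: "has_partial i (rho t) (\<lambda>x. - jp' t (x $ i) * rho t x)"
proof -
  define q where "q x = (\<Prod>j\<in>UNIV - {i}. exp (- jp t (x $ j)))" for x :: "real ^ 'a"
  have rho: "rho t x = exp (- jp t (x $ i)) * q x" for x
    unfolding rho_def q_def by (subst prod.remove[of _ i]) auto
  have "q (x + u *\<^sub>R axis i 1) = q x" for x u
    unfolding q_def nth_plus_axis by (intro prod.cong) auto
  then have q: "has_partial i q (\<lambda>_. 0)" by (simp add: has_partial_def)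
  have "((\<lambda>z. exp (- jp t z)) has_real_derivative exp (- jp t z) * - jp' t z) (at z)" for z
    by (auto intro!: derivative_eq_intros jp_has_real_derivative)
  from has_partial_mult[OF has_partial_coord[OF this] q]
  show ?thesis unfolding rho by (simp add: rho[abs_def] mult_ac)
qed

lemma rho_integrable:
  fixes i :: "'n::finite"
  assumes t: "0 < t" "t \<le> 2"
  shows "integrable lborel (\<lambda>x::real^'n. rho t x * (1 + \<bar>jp' t (x $ i)\<bar>))"
proof -
  obtain K where K: "K \<ge> 0" "\<And>z. exp (- jp t z) * (1 + \<bar>jp' t z\<bar>) \<le> K * inverse (1 + z\<^sup>2)"
    using jp_decay[OF t] by blast
  have K': "exp (- jp t z) \<le> K * inverse (1 + z\<^sup>2)" for z
  proof -
    have "exp (- jp t z) * 1 \<le> exp (- jp t z) * (1 + \<bar>jp' t z\<bar>)" by (intro mult_left_mono) auto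
    then show ?thesis using K(2)[of z] by (simp only: mult_1_right)
  qed
  have "integrable lborel (\<lambda>x::real^'n. \<Prod>i\<in>UNIV. K * inverse (1 + (x $ i)\<^sup>2))"
    by (rule integrable_lborel_vec_prod) (use integrable_inverse_one_plus_sq K(1) in auto)
  then show ?thesis
  proof (rule Bochner_Integration.integrable_bound)
    have [measurable]: "jp' t \<in> borel_measurable borel"
      by (intro borel_measurable_continuous_onI continuous_jp)
    show "(\<lambda>x::real^'n. rho t x * (1 + \<bar>jp' t (x $ i)\<bar>)) \<in> borel_measurable lborel" by measurable
    show "AE x in lborel. norm (rho t x * (1 + \<bar>jp' t (x $ i)\<bar>)) \<le> norm (\<Prod>i\<in>UNIV. K * inverse (1 + (x $ i)\<^sup>2))"
    proof (rule AE_I2)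
      fix x :: "real ^ 'n"
      have "rho t x * (1 + \<bar>jp' t (x $ i)\<bar>) = (exp (- jp t (x $ i)) * (1 + \<bar>jp' t (x $ i)\<bar>)) * (\<Prod>j\<in>UNIV - {i}. exp (- jp t (x $ j)))"
        unfolding rho_def by (subst prod.remove[of _ i]) auto
      also have "\<dots> \<le> (K * inverse (1 + (x $ i)\<^sup>2)) * (\<Prod>j\<in>UNIV - {i}. K * inverse (1 + (x $ j)\<^sup>2))"
        by (intro mult_mono K(2) prod_mono prod_nonneg) (use K' K(1) in auto)
      also have "\<dots> = (\<Prod>i\<in>UNIV. K * inverse (1 + (x $ i)\<^sup>2))" by (subst prod.remove[of UNIV i]) auto
      finally show "norm (rho t x * (1 + \<bar>jp' t (x $ i)\<bar>)) \<le> norm (\<Prod>i\<in>UNIV. K * inverse (1 + (x $ i)\<^sup>2))"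
        using rho_pos[of t x] by simp
    qed
  qed
qed

section \<open>The weighted measure compared with Lebesgue measure\<close>

lemma space_rho_measure [simp]: "space (rho_measure t) = UNIV"
  and sets_rho_measure [simp, measurable_cong]: "sets (rho_measure t) = sets lebesgue"
  by (auto simp: rho_measure_def)

lemma measurable_rho_measure: "borel_measurable (rho_measure t) = borel_measurable lebesgue"
  by (rule measurable_cong_sets) auto

lemma AE_rho_measure: "(AE x in rho_measure t. P x) \<longleftrightarrow> (AE x in lebesgue. P x)"
  unfolding rho_measure_def by (subst AE_density) (auto simp: rho_pos)

lemma integrable_rho_measure:
  assumes "f \<in> borel_measurable lebesgue"
  shows "integrable (rho_measure t) f \<longleftrightarrow> integrable lebesgue (\<lambda>x. f x * rho t x)"
  unfolding rho_measure_def using assms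
  by (subst integrable_density) (auto simp: mult.commute)

lemma integral_rho_measure:
  assumes "f \<in> borel_measurable lebesgue"
  shows "(LINT x|rho_measure t. f x) = (LINT x|lebesgue. f x * rho t x)"
  unfolding rho_measure_def using assms
  by (subst integral_density) (auto simp: mult.commute)

lemma integrable_rho_measure_jp':
  fixes i :: "'n::finite"
  assumes t: "0 < t" "t \<le> 2"
  shows "integrable (rho_measure t) (\<lambda>x::real^'n. \<bar>jp' t (x $ i)\<bar>)"
    "integrable (rho_measure t :: (real ^ 'n) measure) (\<lambda>x. c::real)"
proof -
  have [measurable]: "jp' t \<in> borel_measurable borel"
    by (intro borel_measurable_continuous_onI continuous_jp)
  have "(\<lambda>x::real^'n. \<bar>jp' t (x $ i)\<bar>) \<in> borel_measurable borel" by measurable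
  then have [measurable]: "(\<lambda>x::real^'n. \<bar>jp' t (x $ i)\<bar>) \<in> borel_measurable lebesgue"
    by (intro measurable_completion) simp
  have int: "integrable lebesgue (\<lambda>x::real^'n. rho t x * (1 + \<bar>jp' t (x $ i)\<bar>))"
    using rho_integrable[OF t, of i] by (subst integrable_completion) auto
  show "integrable (rho_measure t) (\<lambda>x::real^'n. \<bar>jp' t (x $ i)\<bar>)"
    unfolding integrable_rho_measure[OF \<open>(\<lambda>x::real^'n. \<bar>jp' t (x $ i)\<bar>) \<in> borel_measurable lebesgue\<close>]
  proof (rule Bochner_Integration.integrable_bound[OF int])
    show "AE x in lebesgue. norm (\<bar>jp' t (x $ i)\<bar> * rho t x) \<le> norm (rho t x * (1 + \<bar>jp' t (x $ i)\<bar>))"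
      by (intro AE_I2) (auto simp: abs_mult distrib_left mult.commute)
  qed measurable
  have "integrable (rho_measure t :: (real ^ 'n) measure) (\<lambda>x. 1::real)"
    unfolding integrable_rho_measure[OF borel_measurable_const]
  proof (rule Bochner_Integration.integrable_bound[OF int])
    show "AE x::real^'n in lebesgue. norm (1 * rho t x) \<le> norm (rho t x * (1 + \<bar>jp' t (x $ i)\<bar>))"
      by (intro AE_I2) (auto simp: abs_mult distrib_left mult.commute)
  qed measurable
  from integrable_mult_right[OF this, of c]
  show "integrable (rho_measure t :: (real ^ 'n) measure) (\<lambda>x. c::real)" by simp
qed

lemma rho_locally_bounded_below:
  obtains c where "c > 0" "\<And>x::real^'n. norm x \<le> R \<Longrightarrow> c \<le> rho t x"
proof (cases "cball (0::real^'n) R = {}")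
  case True
  then have "\<not> norm x \<le> R" for x :: "real ^ 'n" by (metis norm_ge_zero order_trans cball_eq_empty not_less)
  then show ?thesis using that[of 1] by auto
next
  case False
  then obtain y where "y \<in> cball (0::real^'n) R" "\<forall>x\<in>cball (0::real^'n) R. rho t y \<le> rho t x"
    using continuous_attains_inf[OF compact_cball False rho_continuous] by blast
  then show ?thesis using that[of "rho t y"] rho_pos by auto
qed

text \<open>The weight is bounded below on balls. This bridges the two measures in play: norms use
  the weight, whereas weak derivatives are tested against Lebesgue measure.\<close>

lemma Lspace_rho_locally_integrable:
  fixes f :: "real ^ 'n \<Rightarrow> real"
  assumes "f \<in> Lspace (rho_measure t) p"
  shows "locally_integrable (\<lambda>x. \<bar>f x\<bar> powr p)"
proof (rule locally_integrableI)
  fix R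
  obtain c where c: "c > 0" "\<And>x::real^'n. norm x \<le> R \<Longrightarrow> c \<le> rho t x"
    using rho_locally_bounded_below by blast
  have m[measurable]: "f \<in> borel_measurable lebesgue" using LspaceD(1)[OF assms] by (simp add: measurable_rho_measure)
  have m': "(\<lambda>x. \<bar>f x\<bar> powr p) \<in> borel_measurable lebesgue" by measurable
  have "integrable lebesgue (\<lambda>x. (1 / c) * (\<bar>f x\<bar> powr p * rho t x))"
    using LspaceD(2)[OF assms] by (intro integrable_mult_right) (simp add: integrable_rho_measure[OF m'])
  then show "integrable lebesgue (\<lambda>x. indicator (cball 0 R) x * \<bar>f x\<bar> powr p)"
  proof (rule Bochner_Integration.integrable_bound)
    show "(\<lambda>x. indicator (cball 0 R) x * \<bar>f x\<bar> powr p) \<in> borel_measurable lebesgue"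
      by (intro borel_measurable_times borel_measurable_indicator m') auto
    have "\<bar>f x\<bar> powr p \<le> (1 / c) * (\<bar>f x\<bar> powr p * rho t x)" if "norm x \<le> R" for x
      using c(1) mult_left_mono[OF c(2)[OF that], of "\<bar>f x\<bar> powr p"] by (simp add: field_simps)
    then show "AE x in lebesgue. norm (indicator (cball 0 R) x * \<bar>f x\<bar> powr p) \<le> norm ((1 / c) * (\<bar>f x\<bar> powr p * rho t x))"
      using c(1) by (intro AE_I2) (auto simp: indicator_def abs_mult)
  qed
qed

section \<open>Density of test functions\<close>

lemma Lpconv_rho:
  assumes p: "0 \<le> p" and f: "Lpconv lebesgue p f g"
  shows "Lpconv (rho_measure t) p f g"
proof -
  have *: "integrable lebesgue (\<lambda>x. \<bar>h x\<bar> powr p * rho t x)"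
    "(LINT x|lebesgue. \<bar>h x\<bar> powr p * rho t x) \<le> (LINT x|lebesgue. \<bar>h x\<bar> powr p)"
    if h: "h \<in> borel_measurable lebesgue" "integrable lebesgue (\<lambda>x. \<bar>h x\<bar> powr p)" for h
  proof -
    have le: "\<bar>h x\<bar> powr p * rho t x \<le> \<bar>h x\<bar> powr p" for x
      using mult_left_mono[OF rho_le_1, of "\<bar>h x\<bar> powr p"] by simp
    show 1: "integrable lebesgue (\<lambda>x. \<bar>h x\<bar> powr p * rho t x)"
      by (rule Bochner_Integration.integrable_bound[OF h(2)]) (use h(1) le in \<open>auto simp: abs_mult\<close>)
    show "(LINT x|lebesgue. \<bar>h x\<bar> powr p * rho t x) \<le> (LINT x|lebesgue. \<bar>h x\<bar> powr p)"
      by (rule integral_mono[OF 1 h(2) le])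
  qed
  have L: "h \<in> Lspace (rho_measure t) p" if "h \<in> Lspace lebesgue p" for h
    using LspaceD[OF that] *(1) by (intro LspaceI) (auto simp: measurable_rho_measure integrable_rho_measure)
  have d: "(\<lambda>x. f n x - g x) \<in> Lspace lebesgue p" for n
    by (rule Lspace_diff[OF p LpconvD(1,2)[OF f]])
  have "(\<lambda>n. LINT x|rho_measure t. \<bar>f n x - g x\<bar> powr p) \<longlonglongrightarrow> 0"
  proof (rule tendsto_sandwich[OF _ _ tendsto_const LpconvD(3)[OF f]])
    have "(LINT x|rho_measure t. \<bar>f n x - g x\<bar> powr p) \<le> (LINT x|lebesgue. \<bar>f n x - g x\<bar> powr p)" for n
      using *(2)[OF LspaceD[OF d]] LspaceD(1)[OF d] by (subst integral_rho_measure) auto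
    then show "\<forall>\<^sub>F n in sequentially. (LINT x|rho_measure t. \<bar>f n x - g x\<bar> powr p) \<le> (LINT x|lebesgue. \<bar>f n x - g x\<bar> powr p)"
      by simp
  qed simp
  then show ?thesis using LpconvD(1,2)[OF f] L by (auto simp: Lpconv_def)
qed

lemma Lpconv_le:
  assumes p: "0 < p" and f: "Lpconv M p f g" and F: "\<And>n. F n \<in> borel_measurable M" "G \<in> Lspace M p"
    and K: "0 \<le> K" "\<And>n x. \<bar>F n x - G x\<bar> \<le> K * \<bar>f n x - g x\<bar>"
  shows "Lpconv M p F G"
proof -
  have p0: "0 \<le> p" using p by simp
  have le: "\<bar>F n x - G x\<bar> powr p \<le> K powr p * \<bar>f n x - g x\<bar> powr p" for n x
    using powr_mono2[OF p0 _ K(2), of n x] K(1) by (simp add: powr_mult)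
  have int: "integrable M (\<lambda>x. K powr p * \<bar>f n x - g x\<bar> powr p)" for n
    using LspaceD(2)[OF Lspace_diff[OF p0 LpconvD(1,2)[OF f]]] by simp
  have D: "(\<lambda>x. F n x - G x) \<in> Lspace M p" for n
    by (rule Lspace_bound[OF int]) (use F LspaceD(1)[OF F(2)] le in auto)
  have "F n \<in> Lspace M p" for n
    using Lspace_add[OF p0 D F(2)] by simp
  moreover have "(\<lambda>n. LINT x|M. \<bar>F n x - G x\<bar> powr p) \<longlonglongrightarrow> 0"
  proof (rule tendsto_sandwich[OF _ _ tendsto_const])
    show "(\<lambda>n. K powr p * (LINT x|M. \<bar>f n x - g x\<bar> powr p)) \<longlonglongrightarrow> 0"
      using tendsto_mult_right_zero[OF LpconvD(3)[OF f]] .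
    have "(LINT x|M. \<bar>F n x - G x\<bar> powr p) \<le> (LINT x|M. K powr p * \<bar>f n x - g x\<bar> powr p)" for n
      by (rule integral_mono[OF LspaceD(2)[OF D] int le])
    then show "\<forall>\<^sub>F n in sequentially. (LINT x|M. \<bar>F n x - G x\<bar> powr p) \<le> K powr p * (LINT x|M. \<bar>f n x - g x\<bar> powr p)"
      by simp
  qed simp
  ultimately show ?thesis using F by (simp add: Lpconv_def)
qed

lemma Lpconv_add:
  assumes p: "0 < p" and f: "Lpconv M p f1 g1" and g: "Lpconv M p f2 g2"
  shows "Lpconv M p (\<lambda>n x. f1 n x + f2 n x) (\<lambda>x. g1 x + g2 x)"
proof (rule Lpconv_triangle[OF p])
  have p0: "0 \<le> p" using p by simp
  show "Lpconv M p (\<lambda>n x. g1 x + f2 n x) (\<lambda>x. g1 x + g2 x)"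
    by (rule Lpconv_le[OF p g, of _ _ 1])
      (use LspaceD(1)[OF LpconvD(1)[OF g]] LspaceD(1)[OF LpconvD(2)[OF f]] Lspace_add[OF p0 LpconvD(2)[OF f] LpconvD(2)[OF g]] in auto)
  show "(\<lambda>x. f1 n x + f2 n x) \<in> Lspace M p" for n
    by (rule Lspace_add[OF p0 LpconvD(1)[OF f] LpconvD(1)[OF g]])
  show "(\<lambda>n. LINT x|M. \<bar>f1 n x + f2 n x - (g1 x + f2 n x)\<bar> powr p) \<longlonglongrightarrow> 0"
    using LpconvD(3)[OF f] by simp
qed

lemma Lpconv_const: "g \<in> Lspace M p \<Longrightarrow> Lpconv M p (\<lambda>_. g) g"
  by (simp add: Lpconv_def)

lemma Lpconv_sum:
  assumes "0 < p" "finite A" "\<And>i. i \<in> A \<Longrightarrow> Lpconv M p (f i) (g i)"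
  shows "Lpconv M p (\<lambda>j x. \<Sum>i\<in>A. f i j x) (\<lambda>x. \<Sum>i\<in>A. g i x)"
  using assms(2,3) by (induction A rule: finite_induct) (auto intro!: Lpconv_add assms(1) Lpconv_const Lspace_zero)

lemma mi_order_diff_le: "v \<le> u \<Longrightarrow> mi_order (u - v) \<le> mi_order u"
  by (auto simp: mi_order_def intro!: sum_mono)

text \<open>The approximation is a cutoff times a mollification of \<open>a\<close>. Cutting off
  after mollifying confines the Leibniz rule to smooth factors; \<open>b m u\<close> is only the
  formal Leibniz expression with weak derivatives, the limit in n for fixed m, and is never claimed
  to be a weak derivative.\<close>

lemma test_functions_dense:
  fixes a :: "('n::finite \<Rightarrow> nat) \<Rightarrow> real ^ 'n \<Rightarrow> real"
  assumes p: "1 \<le> p" and a: "\<And>u. mi_order u \<le> k \<Longrightarrow> a u \<in> Lspace (rho_measure t) p"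
    and w: "\<And>u. mi_order u \<le> k \<Longrightarrow> has_weak_deriv (a (\<lambda>_. 0)) u (a u)" and e: "0 < e"
  obtains c \<Gamma> R where "all_derivs c \<Gamma>" "supp_in R c"
    "\<And>u. mi_order u \<le> k \<Longrightarrow> \<Gamma> u \<in> Lspace (rho_measure t) p"
    "\<And>u. mi_order u \<le> k \<Longrightarrow> (LINT x|rho_measure t. \<bar>\<Gamma> u x - a u x\<bar> powr p) < e"
proof -
  let ?M = "rho_measure t :: (real ^ 'n) measure"
  let ?U = "{u :: 'n \<Rightarrow> nat. mi_order u \<le> k}"
  have p0: "0 < p" "0 \<le> p" using p by auto
  obtain \<eta> :: "nat \<Rightarrow> real ^ 'n \<Rightarrow> real" and H where \<eta>: "mollifier \<eta> H" using mollifier_exists by blast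
  have "\<exists>y. \<eta> 0 y \<noteq> 0"
  proof (rule ccontr)
    assume "\<not> (\<exists>y. \<eta> 0 y \<noteq> 0)"
    then show False using mollifierD(4)[OF \<eta>, of 0] by simp
  qed
  then obtain y0 where y0: "\<eta> 0 y0 \<noteq> 0" by blast
  have y0_pos: "\<eta> 0 y0 > 0" using y0 mollifierD(2)[OF \<eta>, of 0 y0] by simp
  define r where "r m = inverse (real (Suc m))" for m
  have r: "0 < r m" "r m \<le> 1" for m by (auto simp: r_def divide_simps)
  have r_lim: "r \<longlonglongrightarrow> 0" unfolding r_def by (rule LIMSEQ_inverse_real_of_nat)
  \<comment> \<open>No bump with a plateau is needed: stretching around a point where
    \<open>\<eta> 0\<close> is nonzero and normalising there gives cutoffs tending pointwise to 1,
    while each derivative gains a factor \<open>r m\<close> and tends to 0.\<close>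
  define X where "X m s x = (1 / \<eta> 0 y0) * (r m ^ mi_order s * H 0 s (y0 + r m *\<^sub>R x))" for m s x
  define chi where "chi m x = (1 / \<eta> 0 y0) * \<eta> 0 (y0 + r m *\<^sub>R x)" for m x
  have X: "all_derivs (chi m) (X m)" for m
    unfolding X_def[abs_def] chi_def[abs_def]
    by (intro all_derivs_cmult all_derivs_affine mollifierD(1)[OF \<eta>])
  have chi_supp: "supp_in ((1 + norm y0) / r m) (chi m)" for m
    unfolding supp_in_def
  proof (intro allI impI)
    fix x assume "chi m x \<noteq> 0"
    then have "\<eta> 0 (y0 + r m *\<^sub>R x) \<noteq> 0" by (auto simp: chi_def)
    then have "norm (y0 + r m *\<^sub>R x) \<le> 1" using supp_inD[OF mollifier_supp_in_1[OF \<eta>]] by force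
    then have "norm (r m *\<^sub>R x) \<le> 1 + norm y0"
      using norm_triangle_ineq2[of "r m *\<^sub>R x" "- y0"] by (simp add: add.commute)
    then show "norm x \<le> (1 + norm y0) / r m" using r(1)[of m] by (simp add: field_simps)
  qed
  have "\<exists>B>0. \<forall>x. \<bar>H 0 s x\<bar> \<le> B" for s
    using continuous_supp_in_bounded[OF all_derivs_continuous[OF mollifierD(1)[OF \<eta>]]
      all_derivs_supp_in[OF mollifierD(1)[OF \<eta>] mollifier_supp_in_1[OF \<eta>]], of 0 s] by metis
  then obtain B where B: "\<And>s. B s > 0" "\<And>s x. \<bar>H 0 s x\<bar> \<le> B s" by metis
  define K where "K s = (1 / \<eta> 0 y0) * B s" for s
  have K: "0 \<le> K s" "\<bar>X m s x\<bar> \<le> K s" for m s x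
  proof -
    show "0 \<le> K s" using y0_pos B(1)[of s] by (simp add: K_def)
    have "r m ^ mi_order s * \<bar>H 0 s (y0 + r m *\<^sub>R x)\<bar> \<le> 1 * B s"
      using r[of m] B by (intro mult_mono power_le_one) (auto simp: less_imp_le)
    then show "\<bar>X m s x\<bar> \<le> K s"
      unfolding X_def K_def abs_mult using y0_pos r(1)[of m] by (intro mult_mono) (auto simp: power_abs)
  qed
  have X_meas: "X m s \<in> borel_measurable lebesgue" for m s
    by (rule all_derivs_measurable[OF X])
  have X_lim: "(\<lambda>m. X m s x) \<longlonglongrightarrow> (if s = (\<lambda>_. 0) then 1 else 0)" for s x
  proof -
    have "isCont (H 0 s) y0"
      using all_derivs_continuous[OF mollifierD(1)[OF \<eta>], of UNIV 0 s] by (simp add: continuous_on_eq_continuous_at)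
    moreover have "(\<lambda>m. y0 + r m *\<^sub>R x) \<longlonglongrightarrow> y0" using r_lim by (auto intro!: tendsto_eq_intros)
    ultimately have H: "(\<lambda>m. H 0 s (y0 + r m *\<^sub>R x)) \<longlonglongrightarrow> H 0 s y0" by (rule isCont_tendsto_compose)
    have "(\<lambda>m. X m s x) \<longlonglongrightarrow> (1 / \<eta> 0 y0) * (0 ^ mi_order s * H 0 s y0)"
      unfolding X_def by (intro tendsto_intros H r_lim)
    moreover have "H 0 (\<lambda>_. 0) y0 = \<eta> 0 y0" by (simp add: all_derivsD(1)[OF mollifierD(1)[OF \<eta>]])
    ultimately show ?thesis using y0 by (auto simp: mi_order_eq_0 power_0_left split: if_splits)
  qed
  define b where "b m u = leibniz (X m) a u" for m u
  have am: "a u \<in> borel_measurable ?M" if "mi_order u \<le> k" for u using LspaceD(1)[OF a[OF that]] .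
  have b_term: "Lpconv ?M p (\<lambda>m x. mi_binom u v * (X m v x * a (u - v) x))
      (\<lambda>x. mi_binom u v * ((if v = (\<lambda>_. 0) then 1 else 0) * a (u - v) x))"
    if u: "mi_order u \<le> k" and v: "v \<le> u" for u v
  proof (rule Lpconv_dominated[OF p0(1)])
    have uv: "mi_order (u - v) \<le> k" using mi_order_diff_le[OF v] u by linarith
    note [measurable] = am[OF uv]
    have [measurable]: "X m v \<in> borel_measurable ?M" for m using X_meas by (simp add: measurable_rho_measure)
    show "L1conv ?M (\<lambda>_ x. (\<bar>mi_binom u v\<bar> * K v) powr p * \<bar>a (u - v) x\<bar> powr p)
        (\<lambda>x. (\<bar>mi_binom u v\<bar> * K v) powr p * \<bar>a (u - v) x\<bar> powr p)"
      using LspaceD(2)[OF a[OF uv]] by (intro L1conv_const) simp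
    show "(\<lambda>x. mi_binom u v * (X m v x * a (u - v) x)) \<in> borel_measurable ?M" for m by measurable
    show "(\<lambda>x. mi_binom u v * ((if v = (\<lambda>_. 0) then 1 else 0) * a (u - v) x)) \<in> borel_measurable ?M" by measurable
    show "AE x in ?M. (\<lambda>m. mi_binom u v * (X m v x * a (u - v) x))
        \<longlonglongrightarrow> mi_binom u v * ((if v = (\<lambda>_. 0) then 1 else 0) * a (u - v) x)"
      by (intro AE_I2 tendsto_mult X_lim tendsto_const)
    show "AE x in ?M. \<bar>mi_binom u v * (X m v x * a (u - v) x)\<bar> powr p
        \<le> (\<bar>mi_binom u v\<bar> * K v) powr p * \<bar>a (u - v) x\<bar> powr p" for m
    proof (rule AE_I2)
      fix x
      have "\<bar>mi_binom u v * (X m v x * a (u - v) x)\<bar> \<le> \<bar>mi_binom u v\<bar> * K v * \<bar>a (u - v) x\<bar>"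
        unfolding abs_mult mult.assoc[symmetric] using K by (intro mult_mono) auto
      then show "\<bar>mi_binom u v * (X m v x * a (u - v) x)\<bar> powr p \<le> (\<bar>mi_binom u v\<bar> * K v) powr p * \<bar>a (u - v) x\<bar> powr p"
        using powr_mono2[OF p0(2)] K(1)[of v] by (subst powr_mult[symmetric]) auto
    qed
  qed
  have b_conv: "Lpconv ?M p (\<lambda>m. b m u) (a u)" if u: "mi_order u \<le> k" for u
  proof -
    have "(\<Sum>v | v \<le> u. mi_binom u v * ((if v = (\<lambda>_. 0) then 1 else 0) * a (u - v) x)) = a u x" for x
    proof -
      have "(\<Sum>v | v \<le> u. mi_binom u v * ((if v = (\<lambda>_. 0) then 1 else 0) * a (u - v) x))
          = (\<Sum>v | v \<le> u. if v = (\<lambda>_. 0) then a u x else 0)"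
        by (intro sum.cong) (auto simp: fun_diff_def)
      also have "\<dots> = a u x"
        by (subst sum.delta[OF finite_mi_le]) (simp add: le_fun_def)
      finally show ?thesis .
    qed
    moreover have "Lpconv ?M p (\<lambda>m x. \<Sum>v | v \<le> u. mi_binom u v * (X m v x * a (u - v) x))
      (\<lambda>x. \<Sum>v | v \<le> u. mi_binom u v * ((if v = (\<lambda>_. 0) then 1 else 0) * a (u - v) x))"
      by (intro Lpconv_sum p0 finite_mi_le b_term u) auto
    ultimately show ?thesis unfolding b_def leibniz_def by simp
  qed
  \<comment> \<open>Half the tolerance for each of the two approximations, divided by the
    quasi-triangle constant.\<close>
  define e' where "e' = e / (2 * 2 powr p)"
  have e': "e' > 0" using e by (simp add: e'_def)
  have "\<forall>\<^sub>F m in sequentially. \<forall>u\<in>?U. (LINT x|?M. \<bar>b m u x - a u x\<bar> powr p) < e'"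
    by (intro eventually_ball_finite finite_mi_order_le)
      (use order_tendstoD(2)[OF LpconvD(3)[OF b_conv] e'] in auto)
  then obtain m where m: "\<And>u. mi_order u \<le> k \<Longrightarrow> (LINT x|?M. \<bar>b m u x - a u x\<bar> powr p) < e'"
    using eventually_happens' sequentially_bot by force
  define R where "R = (1 + norm y0) / r m"
  obtain q where q: "strict_mono q"
    "\<And>u. u \<in> ?U \<Longrightarrow> Lpconv lebesgue p (\<lambda>n x. indicator (cball 0 R) x * conv (a u) (\<eta> (q n)) x)
      (\<lambda>x. indicator (cball 0 R) x * a u x)"
    by (rule mollification_Lp_local[OF finite_mi_order_le p \<eta>, of k a R])
      (use am Lspace_rho_locally_integrable[OF a] in \<open>auto simp: measurable_rho_measure\<close>)
  have li: "locally_integrable (a (\<lambda>_. 0))"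
    using w[of "\<lambda>_. 0"] by (simp add: has_weak_deriv_def)
  define \<Gamma> where "\<Gamma> n = leibniz (X m) (\<lambda>s. conv (a (\<lambda>_. 0)) (H (q n) s))" for n
  have \<Gamma>: "all_derivs (\<lambda>x. chi m x * conv (a (\<lambda>_. 0)) (\<eta> (q n)) x) (\<Gamma> n)" for n
    unfolding \<Gamma>_def by (intro all_derivs_mult X all_derivs_conv[OF li mollifierD(1)[OF \<eta>] mollifierD(3)[OF \<eta>]])
  have \<Gamma>_conv: "Lpconv ?M p (\<lambda>n. \<Gamma> n u) (b m u)" if u: "mi_order u \<le> k" for u
  proof -
    have summand: "Lpconv ?M p (\<lambda>n x. mi_binom u v * (X m v x * conv (a (\<lambda>_. 0)) (H (q n) (u - v)) x))
        (\<lambda>x. mi_binom u v * (X m v x * a (u - v) x))" if v: "v \<le> u" for v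
    proof (rule Lpconv_le[OF p0(1)])
      have uv: "mi_order (u - v) \<le> k" using mi_order_diff_le[OF v] u by linarith
      show "Lpconv ?M p (\<lambda>n x. indicator (cball 0 R) x * conv (a (u - v)) (\<eta> (q n)) x)
          (\<lambda>x. indicator (cball 0 R) x * a (u - v) x)"
        by (rule Lpconv_rho[OF p0(2) q(2)]) (use uv in simp)
      have eq: "conv (a (\<lambda>_. 0)) (H (q n) (u - v)) = conv (a (u - v)) (\<eta> (q n))" for n
        by (rule ext) (rule conv_weak_deriv[OF w[OF uv] mollifierD(1)[OF \<eta>] mollifierD(3)[OF \<eta>]])
      have "conv (a (\<lambda>_. 0)) (H (q n) (u - v)) \<in> borel_measurable lebesgue" for n
        by (rule all_derivs_measurable(2)[OF all_derivs_conv[OF li mollifierD(1)[OF \<eta>] mollifierD(3)[OF \<eta>]]])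
      then show "(\<lambda>x. mi_binom u v * (X m v x * conv (a (\<lambda>_. 0)) (H (q n) (u - v)) x)) \<in> borel_measurable ?M" for n
        using X_meas by (simp add: measurable_rho_measure)
      show "(\<lambda>x. mi_binom u v * (X m v x * a (u - v) x)) \<in> Lspace ?M p"
        by (rule LpconvD(1)[OF b_term[OF u v]])
      show "0 \<le> \<bar>mi_binom u v\<bar> * K v" using K(1) by simp
      fix n x
      show "\<bar>mi_binom u v * (X m v x * conv (a (\<lambda>_. 0)) (H (q n) (u - v)) x) - mi_binom u v * (X m v x * a (u - v) x)\<bar>
          \<le> \<bar>mi_binom u v\<bar> * K v * \<bar>indicator (cball 0 R) x * conv (a (u - v)) (\<eta> (q n)) x - indicator (cball 0 R) x * a (u - v) x\<bar>"
      proof (cases "norm x \<le> R")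
        case True
        have "\<bar>mi_binom u v * (X m v x * conv (a (\<lambda>_. 0)) (H (q n) (u - v)) x) - mi_binom u v * (X m v x * a (u - v) x)\<bar>
            = \<bar>mi_binom u v\<bar> * \<bar>X m v x\<bar> * \<bar>conv (a (u - v)) (\<eta> (q n)) x - a (u - v) x\<bar>"
          unfolding eq abs_mult[symmetric] by (simp add: algebra_simps)
        also have "\<dots> \<le> \<bar>mi_binom u v\<bar> * K v * \<bar>conv (a (u - v)) (\<eta> (q n)) x - a (u - v) x\<bar>"
          using K by (intro mult_right_mono mult_left_mono) auto
        finally show ?thesis using True by simp
      next
        case False
        then have "X m v x = 0"
          using supp_inD[OF all_derivs_supp_in[OF X chi_supp]] by (simp add: R_def)
        then show ?thesis using K(1) by simp
      qed
    qed
    show ?thesis unfolding \<Gamma>_def b_def leibniz_def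
      by (intro Lpconv_sum p0 finite_mi_le summand) auto
  qed
  have "\<forall>\<^sub>F n in sequentially. \<forall>u\<in>?U. (LINT x|?M. \<bar>\<Gamma> n u x - b m u x\<bar> powr p) < e'"
    by (intro eventually_ball_finite finite_mi_order_le)
      (use order_tendstoD(2)[OF LpconvD(3)[OF \<Gamma>_conv] e'] in auto)
  then obtain n where n: "\<And>u. mi_order u \<le> k \<Longrightarrow> (LINT x|?M. \<bar>\<Gamma> n u x - b m u x\<bar> powr p) < e'"
    using eventually_happens' sequentially_bot by force
  have "(LINT x|?M. \<bar>\<Gamma> n u x - a u x\<bar> powr p) < e" if u: "mi_order u \<le> k" for u
  proof -
    note \<Gamma>L = LpconvD(1)[OF \<Gamma>_conv[OF u], of n] and bL = LpconvD(1)[OF b_conv[OF u], of m]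
    note int = LspaceD(2)[OF Lspace_diff[OF p0(2) \<Gamma>L bL]] LspaceD(2)[OF Lspace_diff[OF p0(2) bL a[OF u]]]
      LspaceD(2)[OF Lspace_diff[OF p0(2) \<Gamma>L a[OF u]]]
    have "(LINT x|?M. \<bar>\<Gamma> n u x - a u x\<bar> powr p)
        \<le> (LINT x|?M. 2 powr p * (\<bar>\<Gamma> n u x - b m u x\<bar> powr p + \<bar>b m u x - a u x\<bar> powr p))"
    proof (rule integral_mono)
      show "\<bar>\<Gamma> n u x - a u x\<bar> powr p \<le> 2 powr p * (\<bar>\<Gamma> n u x - b m u x\<bar> powr p + \<bar>b m u x - a u x\<bar> powr p)" for x
        using abs_add_powr_le[OF p0(2), of "\<Gamma> n u x - b m u x" "b m u x - a u x"] by simp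
    qed (use int in auto)
    also have "\<dots> = 2 powr p * ((LINT x|?M. \<bar>\<Gamma> n u x - b m u x\<bar> powr p) + (LINT x|?M. \<bar>b m u x - a u x\<bar> powr p))"
      using int by simp
    also have "\<dots> < 2 powr p * (e' + e')"
      using n[OF u] m[OF u] by (intro mult_strict_left_mono add_strict_mono) auto
    also have "\<dots> = e" by (simp add: e'_def)
    finally show ?thesis .
  qed
  moreover have "supp_in R (\<lambda>x. chi m x * conv (a (\<lambda>_. 0)) (\<eta> (q n)) x)"
    unfolding R_def by (rule supp_in_mult(1)[OF chi_supp])
  ultimately show ?thesis using that[OF \<Gamma>[of n]] LpconvD(1)[OF \<Gamma>_conv] by blast
qed

section \<open>Weighted integration by parts with truncation\<close>

lemma integrable_rho_continuous_supp_in: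
  assumes f: "continuous_on UNIV f" "supp_in R f"
  shows "integrable (rho_measure t) f" "(LINT x|rho_measure t. f x) = (LINT x|lborel. f x * rho t x)"
proof -
  have b: "f \<in> borel_measurable borel" by (intro borel_measurable_continuous_onI f)
  then have m: "f \<in> borel_measurable lebesgue" by (intro measurable_completion) simp
  have m': "(\<lambda>x. f x * rho t x) \<in> borel_measurable borel" using b by measurable
  have "integrable lborel (\<lambda>x. f x * rho t x)"
    by (rule integrable_lborel_continuous_supp_in[of _ R])
      (intro continuous_intros f rho_continuous, rule supp_in_mult(1)[OF f(2)])
  then show "integrable (rho_measure t) f"
    unfolding integrable_rho_measure[OF m] using m' by (subst integrable_completion) auto
  show "(LINT x|rho_measure t. f x) = (LINT x|lborel. f x * rho t x)"
    unfolding integral_rho_measure[OF m] by (rule lborel_integral_lebesgue[OF m'])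
qed

lemma continuous_of_real_derivative:
  assumes "\<And>y. (f has_real_derivative f' y) (at y)"
  shows "continuous_on A f"
  using assms by (meson DERIV_isCont continuous_at_imp_continuous_on)

text \<open>The integral of a total derivative, with \<open>jp'\<close> being minus the logarithmic
  derivative of the weight. \<open>N 0 = 0\<close> makes the product compactly supported even if
  \<open>F 0\<close> is nonzero. The three slots allow both intended choices: F = 1 with \<beta> =
  \<open>drift t\<close>, and F = \<psi>' with \<beta> = 1.\<close>

lemma rho_integral_by_parts:
  fixes c :: "real ^ 'n \<Rightarrow> real" and i :: 'n
  assumes c: "all_derivs c \<Gamma>" "supp_in R c"
    and F: "\<And>y. (F has_real_derivative F' y) (at y)" "continuous_on UNIV F'"
    and N: "\<And>y. (N has_real_derivative N' y) (at y)" "continuous_on UNIV N'" "N 0 = 0"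
    and \<beta>: "\<And>y. (\<beta> has_real_derivative \<beta>' y) (at y)" "continuous_on UNIV \<beta>'"
  defines "e \<equiv> mi_inc i (\<lambda>_. 0)"
  shows "(LINT x|rho_measure t. F' (c x) * \<Gamma> e x * N (\<Gamma> e x) * \<beta> (x $ i)
       + F (c x) * (N' (\<Gamma> e x) * \<Gamma> (mi_inc i e) x) * \<beta> (x $ i)
       + F (c x) * N (\<Gamma> e x) * \<beta>' (x $ i)
       - F (c x) * N (\<Gamma> e x) * \<beta> (x $ i) * jp' t (x $ i)) = 0"
proof -
  note cont = continuous_on_compose2[OF _ _ subset_UNIV]
  have cc: "continuous_on UNIV c"
    using all_derivs_continuous[OF c(1), of UNIV "\<lambda>_. 0"] all_derivsD(1)[OF c(1)] by simp
  note cG = all_derivs_continuous[OF c(1), of UNIV]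
  note cF = cont[OF continuous_of_real_derivative[OF F(1)] cc] cont[OF F(2) cc]
  note cN = cont[OF continuous_of_real_derivative[OF N(1)] cG] cont[OF N(2) cG]
  have cx: "continuous_on UNIV (\<lambda>x::real^'n. x $ i)" by (intro continuous_intros)
  note c\<beta> = cont[OF continuous_of_real_derivative[OF \<beta>(1)] cx] cont[OF \<beta>(2) cx] cont[OF continuous_jp(2) cx]
  note supp = all_derivs_supp_in[OF c]
  have suppN: "supp_in R (\<lambda>x. N (\<Gamma> e x))"
    using supp[of e] N(3) unfolding supp_in_def by metis
  have pc: "has_partial i c (\<Gamma> e)"
    using all_derivs_partial[OF c(1), of i "\<lambda>_. 0"] all_derivsD(1)[OF c(1)] by (simp add: e_def)
  define G where "G x = F (c x) * N (\<Gamma> e x) * \<beta> (x $ i)" for x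
  define G' where "G' x = F' (c x) * \<Gamma> e x * N (\<Gamma> e x) * \<beta> (x $ i)
       + F (c x) * (N' (\<Gamma> e x) * \<Gamma> (mi_inc i e) x) * \<beta> (x $ i)
       + F (c x) * N (\<Gamma> e x) * \<beta>' (x $ i)" for x
  have "has_partial i G (\<lambda>x. (F' (c x) * \<Gamma> e x * N (\<Gamma> e x) + F (c x) * (N' (\<Gamma> e x) * \<Gamma> (mi_inc i e) x)) * \<beta> (x $ i)
       + F (c x) * N (\<Gamma> e x) * \<beta>' (x $ i))"
    unfolding G_def[abs_def]
    by (intro has_partial_mult has_partial_compose[OF pc F(1)] has_partial_compose[OF all_derivs_partial[OF c(1)] N(1)]
        has_partial_coord \<beta>)
  then have G: "has_partial i G G'" by (simp add: G'_def[abs_def] algebra_simps)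
  have suppG: "supp_in R G"
    unfolding G_def[abs_def] by (intro supp_in_mult(1) supp_in_mult(2)[OF suppN])
  have suppG': "supp_in R G'" by (rule has_partial_supp_in[OF G suppG])
  have cont_G: "continuous_on UNIV G" unfolding G_def by (intro continuous_intros cF cN c\<beta>)
  have cont_G': "continuous_on UNIV G'" unfolding G'_def by (intro continuous_intros cF cN c\<beta> cG)
  have "(LINT x|lborel. G' x * rho t x + G x * (- jp' t (x $ i) * rho t x)) = 0"
    by (rule integral_partial_eq_0[OF has_partial_mult[OF G has_partial_rho] _ _ supp_in_mult(1)[OF suppG]])
      (intro continuous_intros cont_G cont_G' rho_continuous c\<beta>)+
  also have "(LINT x|lborel. G' x * rho t x + G x * (- jp' t (x $ i) * rho t x))
      = (LINT x|rho_measure t. G' x - G x * jp' t (x $ i))"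
  proof (subst integrable_rho_continuous_supp_in(2))
    show "continuous_on UNIV (\<lambda>x. G' x - G x * jp' t (x $ i))"
      by (intro continuous_intros cont_G cont_G' c\<beta>)
    show "supp_in R (\<lambda>x. G' x - G x * jp' t (x $ i))"
      using suppG suppG' unfolding supp_in_def by (metis mult_zero_left diff_zero)
  qed (simp add: algebra_simps)
  finally show ?thesis by (simp add: G_def G'_def)
qed

text \<open>A rescaled arctangent is bounded, odd and smooth, lies between 0 and u, has slope in (0,
  1], and tends to the identity. Unlike a hard clamp it is differentiable and may enter an
  integration by parts.\<close>

definition trunc :: "nat \<Rightarrow> real \<Rightarrow> real" where
  "trunc m u = real (Suc m) * arctan (u / real (Suc m))"

definition trunc' :: "nat \<Rightarrow> real \<Rightarrow> real" where
  "trunc' m u = 1 / (1 + (u / real (Suc m))\<^sup>2)"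

lemma trunc_has_real_derivative: "(trunc m has_real_derivative trunc' m u) (at u)"
  unfolding trunc_def[abs_def] trunc'_def
  using one_plus_sq_pos[of "u / real (Suc m)"]
  by (auto intro!: derivative_eq_intros simp: divide_simps simp del: of_nat_Suc)

lemma trunc'_bounds: "0 \<le> trunc' m u" "trunc' m u \<le> 1"
  using one_plus_sq_pos[of "u / real (Suc m)"] by (auto simp: trunc'_def divide_simps)

lemma continuous_trunc': "continuous_on A (trunc' m)"
  unfolding trunc'_def by (intro continuous_intros) (use one_plus_sq_pos in auto)

lemma continuous_trunc: "continuous_on A (trunc m)"
  by (rule continuous_of_real_derivative[OF trunc_has_real_derivative])

lemma trunc_0 [simp]: "trunc m 0 = 0"
  by (simp add: trunc_def)

lemma trunc_bounded: "\<bar>trunc m u\<bar> \<le> real (Suc m) * 2"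
proof -
  have "\<bar>arctan (u / real (Suc m))\<bar> \<le> 2"
    using arctan_bounded[of "u / real (Suc m)"] pi_less_4 by linarith
  then show ?thesis unfolding trunc_def abs_mult by (simp add: mult_left_mono del: of_nat_Suc)
qed

lemma trunc_nonneg: "0 \<le> u \<Longrightarrow> 0 \<le> trunc m u"
  by (simp add: trunc_def)

lemma trunc_le: "0 \<le> u \<Longrightarrow> trunc m u \<le> u"
proof -
  assume u: "0 \<le> u"
  have "arctan (u / real (Suc m)) \<le> u / real (Suc m)"
    using u by (intro arctan_le_self) simp
  then show ?thesis by (simp add: trunc_def field_simps del: of_nat_Suc)
qed

lemma trunc_minus: "trunc m (- u) = - trunc m u"
  by (simp add: trunc_def arctan_minus)

lemma abs_trunc_le: "\<bar>trunc m u\<bar> \<le> \<bar>u\<bar>"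
  using trunc_le[of u m] trunc_nonneg[of u m] trunc_le[of "- u" m] trunc_nonneg[of "- u" m]
  by (cases "0 \<le> u") (auto simp: trunc_minus)

lemma mult_trunc:
  assumes "0 \<le> p * u"
  shows "0 \<le> p * trunc m u" "p * trunc m u \<le> p * u"
proof -
  consider "p = 0" | "p > 0" "u \<ge> 0" | "p < 0" "u \<le> 0" using assms by (cases "p = 0") (auto simp: zero_le_mult_iff less_le)
  then show "0 \<le> p * trunc m u" "p * trunc m u \<le> p * u"
    using trunc_le[of u m] trunc_nonneg[of u m] trunc_le[of "- u" m] trunc_nonneg[of "- u" m]
    by (cases; auto simp: trunc_minus zero_le_mult_iff mult_le_cancel_left)+
qed

lemma scaled_arg_tendsto_0: "(\<lambda>m. u / real (Suc m)) \<longlonglongrightarrow> 0"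
  using LIMSEQ_ignore_initial_segment[OF tendsto_divide_0[OF tendsto_const filterlim_real_sequentially[THEN filterlim_at_top_imp_at_infinity]], of u 1]
  by simp

lemma trunc_tendsto: "(\<lambda>m. trunc m u) \<longlonglongrightarrow> u"
proof (cases "u = 0")
  case False
  have "((\<lambda>h. arctan h / h) \<longlongrightarrow> 1) (at 0)"
    using DERIV_arctan[of 0] by (simp add: has_field_derivative_iff)
  moreover have "filterlim (\<lambda>m. u / real (Suc m)) (at 0) sequentially"
    unfolding filterlim_at using scaled_arg_tendsto_0[of u] False by auto
  ultimately have "(\<lambda>m. arctan (u / real (Suc m)) / (u / real (Suc m))) \<longlonglongrightarrow> 1"
    by (rule filterlim_compose)
  from tendsto_mult_left[OF this, of u] show ?thesis
    using False by (simp add: trunc_def field_simps del: of_nat_Suc)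
qed simp

lemma trunc'_tendsto: "(\<lambda>m. trunc' m u) \<longlonglongrightarrow> 1"
proof -
  have "(\<lambda>m. 1 / (1 + (u / real (Suc m))\<^sup>2)) \<longlonglongrightarrow> 1 / (1 + 0\<^sup>2)"
    by (intro tendsto_intros scaled_arg_tendsto_0) auto
  then show ?thesis by (simp add: trunc'_def)
qed

text \<open>If integration by parts holds for all truncations of \<open>N\<close>, it survives the limit \<open>j \<rightarrow> \<infinity>\<close> for each
  truncation level and then holds without truncation, both along the sequence and for the limit.
  Hence the integrals of the nonnegative functions \<open>P \<cdot> N\<close> converge, and Scheffe's lemma applies.\<close>

lemma L1conv_by_truncation:
  fixes P :: "real \<Rightarrow> real \<Rightarrow> 'a \<Rightarrow> real" and Q0 Q1 :: "real \<Rightarrow> 'a \<Rightarrow> real"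
  assumes meas: "\<And>j. (\<lambda>x. P (c j x) (y j x) x) \<in> borel_measurable M" "(\<lambda>x. P (cl x) (yl x) x) \<in> borel_measurable M"
    "\<And>j. (\<lambda>x. Q0 (c j x) x) \<in> borel_measurable M" "(\<lambda>x. Q0 (cl x) x) \<in> borel_measurable M"
    "\<And>j. (\<lambda>x. Q1 (c j x) x) \<in> borel_measurable M" "(\<lambda>x. Q1 (cl x) x) \<in> borel_measurable M"
    "\<And>j. y j \<in> borel_measurable M" "yl \<in> borel_measurable M"
    "\<And>j. z j \<in> borel_measurable M" "zl \<in> borel_measurable M"
    and N: "continuous_on UNIV N" "continuous_on UNIV N'"
    and lim: "AE x in M. (\<lambda>j. c j x) \<longlonglongrightarrow> cl x" "AE x in M. (\<lambda>j. y j x) \<longlonglongrightarrow> yl x" "AE x in M. (\<lambda>j. z j x) \<longlonglongrightarrow> zl x"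
    and cP: "\<And>x f g a b. f \<longlonglongrightarrow> a \<Longrightarrow> g \<longlonglongrightarrow> b \<Longrightarrow> (\<lambda>j. P (f j) (g j) x) \<longlonglongrightarrow> P a b x"
    and cQ: "\<And>x f a. f \<longlonglongrightarrow> a \<Longrightarrow> (\<lambda>j. Q0 (f j) x) \<longlonglongrightarrow> Q0 a x" "\<And>x f a. f \<longlonglongrightarrow> a \<Longrightarrow> (\<lambda>j. Q1 (f j) x) \<longlonglongrightarrow> Q1 a x"
    and pos: "\<And>a b x. 0 \<le> P a b x * N b"
    and W: "L1conv M W Wl"
    "\<And>j x. \<bar>Q0 (c j x) x\<bar> * \<bar>N' (y j x) * z j x\<bar> + \<bar>Q1 (c j x) x\<bar> * \<bar>N (y j x)\<bar> \<le> W j x"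
    "\<And>x. \<bar>Q0 (cl x) x\<bar> * \<bar>N' (yl x) * zl x\<bar> + \<bar>Q1 (cl x) x\<bar> * \<bar>N (yl x)\<bar> \<le> Wl x"
    and S: "L1conv M S Sl" "\<And>j x. \<bar>P (c j x) (y j x) x\<bar> \<le> S j x"
    and ident: "\<And>m j. (LINT x|M. P (c j x) (y j x) x * trunc m (N (y j x)))
      = (LINT x|M. Q0 (c j x) x * (trunc' m (N (y j x)) * (N' (y j x) * z j x)) + Q1 (c j x) x * trunc m (N (y j x)))"
  shows "L1conv M (\<lambda>j x. P (c j x) (y j x) x * N (y j x)) (\<lambda>x. P (cl x) (yl x) x * N (yl x))"
proof -
  note [measurable] = meas
  have [measurable]: "N \<in> borel_measurable borel" "N' \<in> borel_measurable borel"
    "trunc m \<in> borel_measurable borel" "trunc' m \<in> borel_measurable borel" for m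
    by (intro borel_measurable_continuous_onI N continuous_trunc continuous_trunc')+
  have isC: "isCont N v" "isCont N' v" "isCont (trunc m) v" "isCont (trunc' m) v" for v m
    using N continuous_trunc[of UNIV m] continuous_trunc'[of UNIV m] by (auto simp: continuous_on_eq_continuous_at)
  note tend = isCont_tendsto_compose[OF isC(1)] isCont_tendsto_compose[OF isC(2)]
    isCont_tendsto_compose[OF isC(3)] isCont_tendsto_compose[OF isC(4)]
  define U where "U m a b x = P a b x * trunc m (N b)" for m a b x
  define V where "V m a b d x = Q0 a x * (trunc' m (N b) * (N' b * d)) + Q1 a x * trunc m (N b)" for m a b d x
  define v where "v a b d x = Q0 a x * (1 * (N' b * d)) + Q1 a x * N b" for a b d x
  have U_lim: "(\<lambda>m. U m a b x) \<longlonglongrightarrow> P a b x * N b" for a b x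
    unfolding U_def by (intro tendsto_intros trunc_tendsto)
  have V_lim: "(\<lambda>m. V m a b d x) \<longlonglongrightarrow> v a b d x" for a b d x
    unfolding V_def v_def by (intro tendsto_intros trunc_tendsto trunc'_tendsto)
  \<comment> \<open>The bound is free of m, since \<open>trunc'\<close> is at most 1 and |trunc m u|
    \<le> |u|; hence \<open>W\<close> serves for every truncation level and also without
    truncation.\<close>
  have V_le: "\<bar>V m a b d x\<bar> \<le> \<bar>Q0 a x\<bar> * \<bar>N' b * d\<bar> + \<bar>Q1 a x\<bar> * \<bar>N b\<bar>" for m a b d x
  proof -
    have "\<bar>trunc' m (N b) * (N' b * d)\<bar> \<le> 1 * \<bar>N' b * d\<bar>"
      unfolding abs_mult[of "trunc' m (N b)"] using trunc'_bounds[of m "N b"] by (intro mult_right_mono) auto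
    then have "\<bar>Q0 a x * (trunc' m (N b) * (N' b * d))\<bar> \<le> \<bar>Q0 a x\<bar> * \<bar>N' b * d\<bar>"
      unfolding abs_mult[of "Q0 a x"] by (intro mult_left_mono) auto
    moreover have "\<bar>Q1 a x * trunc m (N b)\<bar> \<le> \<bar>Q1 a x\<bar> * \<bar>N b\<bar>"
      unfolding abs_mult[of "Q1 a x"] by (intro mult_left_mono abs_trunc_le) auto
    ultimately show ?thesis unfolding V_def using abs_triangle_ineq[of "Q0 a x * (trunc' m (N b) * (N' b * d))"] by (meson add_mono order_trans)
  qed
  have v_le: "\<bar>v a b d x\<bar> \<le> \<bar>Q0 a x\<bar> * \<bar>N' b * d\<bar> + \<bar>Q1 a x\<bar> * \<bar>N b\<bar>" for a b d x
    unfolding v_def by (rule order_trans[OF abs_triangle_ineq]) (simp add: abs_mult)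
  \<comment> \<open>At a fixed level the truncated factor is bounded, so a majorant of
    \<open>P\<close> alone suffices.\<close>
  have L1U: "L1conv M (\<lambda>j x. U m (c j x) (y j x) x) (\<lambda>x. U m (cl x) (yl x) x)" for m
  proof (rule L1conv_dominated)
    show "L1conv M (\<lambda>j x. (real (Suc m) * 2) * S j x) (\<lambda>x. (real (Suc m) * 2) * Sl x)"
      by (rule L1conv_cmult[OF S(1)])
    show "AE x in M. (\<lambda>j. U m (c j x) (y j x) x) \<longlonglongrightarrow> U m (cl x) (yl x) x"
      using lim(1,2) by eventually_elim (auto simp: U_def intro!: tendsto_mult cP tend)
    show "AE x in M. \<bar>U m (c j x) (y j x) x\<bar> \<le> (real (Suc m) * 2) * S j x" for j
    proof (rule AE_I2)
      fix x
      have "\<bar>U m (c j x) (y j x) x\<bar> \<le> S j x * (real (Suc m) * 2)"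
        unfolding U_def abs_mult using S(2)[of j x] by (intro mult_mono trunc_bounded) (auto intro: order_trans[OF abs_ge_zero])
      then show "\<bar>U m (c j x) (y j x) x\<bar> \<le> (real (Suc m) * 2) * S j x" by (simp only: mult.commute)
    qed
    show "(\<lambda>x. U m (c j x) (y j x) x) \<in> borel_measurable M" "(\<lambda>x. U m (cl x) (yl x) x) \<in> borel_measurable M" for j
      unfolding U_def by measurable
  qed
  have L1V: "L1conv M (\<lambda>j x. V m (c j x) (y j x) (z j x) x) (\<lambda>x. V m (cl x) (yl x) (zl x) x)" for m
  proof (rule L1conv_dominated[OF W(1)])
    show "AE x in M. (\<lambda>j. V m (c j x) (y j x) (z j x) x) \<longlonglongrightarrow> V m (cl x) (yl x) (zl x) x"
      using lim by eventually_elim (auto simp: V_def intro!: tendsto_intros cQ tend)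
    show "AE x in M. \<bar>V m (c j x) (y j x) (z j x) x\<bar> \<le> W j x" for j
      using V_le W(2) by (intro AE_I2) (rule order_trans)
    show "(\<lambda>x. V m (c j x) (y j x) (z j x) x) \<in> borel_measurable M" "(\<lambda>x. V m (cl x) (yl x) (zl x) x) \<in> borel_measurable M" for j
      unfolding V_def by measurable
  qed
  have L1v: "L1conv M (\<lambda>j x. v (c j x) (y j x) (z j x) x) (\<lambda>x. v (cl x) (yl x) (zl x) x)"
  proof (rule L1conv_dominated[OF W(1)])
    show "AE x in M. (\<lambda>j. v (c j x) (y j x) (z j x) x) \<longlonglongrightarrow> v (cl x) (yl x) (zl x) x"
      using lim by eventually_elim (auto simp: v_def intro!: tendsto_intros cQ tend)
    show "AE x in M. \<bar>v (c j x) (y j x) (z j x) x\<bar> \<le> W j x" for j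
      using v_le W(2) by (intro AE_I2) (rule order_trans)
    show "(\<lambda>x. v (c j x) (y j x) (z j x) x) \<in> borel_measurable M" "(\<lambda>x. v (cl x) (yl x) (zl x) x) \<in> borel_measurable M" for j
      unfolding v_def by measurable
  qed
  have eqj: "(LINT x|M. U m (c j x) (y j x) x) = (LINT x|M. V m (c j x) (y j x) (z j x) x)" for m j
    unfolding U_def V_def by (rule ident)
  have eql: "(LINT x|M. U m (cl x) (yl x) x) = (LINT x|M. V m (cl x) (yl x) (zl x) x)" for m
    using LIMSEQ_unique[OF L1conv_integral[OF L1U, of m] L1conv_integral[OF L1V, of m, folded eqj]] .
  have R: "integrable M (\<lambda>x. P (a x) (b x) x * N (b x))"
    "(LINT x|M. P (a x) (b x) x * N (b x)) = (LINT x|M. v (a x) (b x) (d x) x)"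
    if "\<And>m. integrable M (\<lambda>x. U m (a x) (b x) x)" "(\<lambda>x. P (a x) (b x) x) \<in> borel_measurable M" "b \<in> borel_measurable M"
      "\<And>m. (\<lambda>x. V m (a x) (b x) (d x) x) \<in> borel_measurable M" "(\<lambda>x. v (a x) (b x) (d x) x) \<in> borel_measurable M"
      "\<And>x. \<bar>Q0 (a x) x\<bar> * \<bar>N' (b x) * d x\<bar> + \<bar>Q1 (a x) x\<bar> * \<bar>N (b x)\<bar> \<le> w x" "integrable M w"
      "\<And>m. (LINT x|M. U m (a x) (b x) x) = (LINT x|M. V m (a x) (b x) (d x) x)" for a b d w
  proof -
    have m: "(\<lambda>x. P (a x) (b x) x * N (b x)) \<in> borel_measurable M" using that(2,3) by measurable
    note T = integral_truncation_limit[where W=w, OF that(1) m U_lim _ _ that(4,5) V_lim order_trans[OF V_le that(6)] that(7,8)]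
    show "integrable M (\<lambda>x. P (a x) (b x) x * N (b x))"
      "(LINT x|M. P (a x) (b x) x * N (b x)) = (LINT x|M. v (a x) (b x) (d x) x)"
      by (rule T; use mult_trunc[OF pos] in \<open>simp add: U_def\<close>)+
  qed
  note Rj = R[OF L1convD(1)[OF L1U] meas(1) meas(7) borel_measurable_integrable[OF L1convD(1)[OF L1V]]
      borel_measurable_integrable[OF L1convD(1)[OF L1v]] W(2) L1convD(1)[OF W(1)] eqj]
  note Rl = R[OF L1convD(2)[OF L1U] meas(2) meas(8) borel_measurable_integrable[OF L1convD(2)[OF L1V]]
      borel_measurable_integrable[OF L1convD(2)[OF L1v]] W(3) L1convD(2)[OF W(1)] eql]
  show ?thesis
  proof (rule L1conv_scheffe[OF Rj(1) Rl(1)])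
    show "AE x in M. (\<lambda>j. P (c j x) (y j x) x * N (y j x)) \<longlonglongrightarrow> P (cl x) (yl x) x * N (yl x)"
      using lim(1,2) by eventually_elim (auto intro!: tendsto_mult cP tend)
    show "(\<lambda>j. LINT x|M. P (c j x) (y j x) x * N (y j x)) \<longlonglongrightarrow> (LINT x|M. P (cl x) (yl x) x * N (yl x))"
      unfolding Rj(2) Rl(2) by (rule L1conv_integral[OF L1v])
  qed (rule pos)+
qed

section \<open>Inequalities for powers of the Japanese bracket\<close>

lemmas one_plus_sq_neq_0 [simp] = one_plus_sq_pos(2)

lemma jp_pos: "0 < jp p y"
  using one_plus_sq_pos[of y] by (simp add: jp_def)

lemma jp_ge_1: "0 \<le> p \<Longrightarrow> 1 \<le> jp p y"
  using one_plus_sq_pos[of y] by (simp add: jp_def ge_one_powr_ge_zero)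

lemma jp_le_1: "p \<le> 0 \<Longrightarrow> jp p y \<le> 1"
  using one_plus_sq_pos[of y] powr_mono[of "p / 2" 0 "1 + y\<^sup>2"] by (simp add: jp_def)

lemma jp_add: "jp p y * jp q y = jp (p + q) y"
  by (simp add: jp_def powr_add[symmetric] add_divide_distrib)

lemma abs_le_jp: "\<bar>y\<bar> \<le> jp 1 y"
  using abs_le_one_plus_sq_powr by (simp add: jp_def)

lemma abs_mult_jp_le: "\<bar>y\<bar> * jp (p - 1) y \<le> jp p y"
  using mult_right_mono[OF abs_le_jp less_imp_le[OF jp_pos], of y "p - 1" y] by (simp add: jp_add)

lemma jp'_eq: "jp' p y = p * y * jp (p - 2) y"
  by (simp add: jp'_def jp_def diff_divide_distrib)

lemma jp_powr: "jp 1 y powr p = jp p y"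
  by (simp add: jp_def powr_powr)

lemma jp_1_le: "jp 1 y \<le> 1 + \<bar>y\<bar>"
proof -
  have "1 + y\<^sup>2 \<le> (1 + \<bar>y\<bar>)\<^sup>2" by (simp add: power2_sum)
  then have "sqrt (1 + y\<^sup>2) \<le> 1 + \<bar>y\<bar>" by (intro real_le_lsqrt) auto
  then show ?thesis using one_plus_sq_pos(1)[of y] by (simp add: jp_def powr_half_sqrt)
qed

lemma jp_le_powr:
  assumes "0 \<le> p"
  shows "jp p y \<le> 2 powr p * (1 + \<bar>y\<bar> powr p)"
proof -
  have "jp p y \<le> (1 + \<bar>y\<bar>) powr p"
    unfolding jp_powr[of y p, symmetric] using assms jp_1_le jp_pos by (intro powr_mono2) (auto simp: less_imp_le)
  also have "\<dots> \<le> 2 powr p * (1 powr p + \<bar>y\<bar> powr p)" using assms by (intro powr_add_le) auto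
  finally show ?thesis by simp
qed

text \<open>A cheap substitute for Young's inequality: whichever of |z| and \<open>jp 1 y\<close> is
  larger takes over the whole product.\<close>

lemma jp_mult_le:
  assumes "1 \<le> p"
  shows "jp (p - 1) y * \<bar>z\<bar> \<le> jp p y + \<bar>z\<bar> powr p"
proof (cases "\<bar>z\<bar> \<le> jp 1 y")
  case True
  have "jp (p - 1) y * \<bar>z\<bar> \<le> jp (p - 1) y * jp 1 y" using True jp_pos by (intro mult_left_mono) (auto simp: less_imp_le)
  also have "\<dots> = jp p y" by (simp add: jp_add)
  finally show ?thesis by (simp add: add_increasing2)
next
  case False
  have "jp (p - 1) y = jp 1 y powr (p - 1)" by (simp add: jp_powr)
  also have "\<dots> \<le> \<bar>z\<bar> powr (p - 1)" using False assms jp_pos[of 1 y] by (intro powr_mono2) auto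
  finally have "jp (p - 1) y * \<bar>z\<bar> \<le> \<bar>z\<bar> powr (p - 1) * \<bar>z\<bar> powr 1" using mult_right_mono[of _ _ "\<bar>z\<bar>"] by simp
  also have "\<dots> = \<bar>z\<bar> powr p" by (subst powr_add[symmetric]) simp
  finally show ?thesis using jp_pos[of p y] by (simp add: add_increasing)
qed

lemma jp'_bound: "0 \<le> p \<Longrightarrow> \<bar>jp' p y\<bar> \<le> p * jp (p - 1) y"
  using abs_mult_jp_le[of y "p - 1"] jp_pos[of "p - 2" y]
  by (simp add: jp'_eq abs_mult mult.assoc mult_left_mono)

lemma mult_jp_has_real_derivative:
  "((\<lambda>y. y * jp q y) has_real_derivative jp q y + y * jp' q y) (at y)"
  by (rule DERIV_cong[OF DERIV_mult[OF DERIV_ident jp_has_real_derivative]]) simp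

lemma mult_jp'_bound:
  assumes "1 \<le> p"
  shows "\<bar>jp (p - 1) y + y * jp' (p - 1) y\<bar> \<le> p * jp (p - 1) y"
proof -
  have "\<bar>y\<bar> * \<bar>jp' (p - 1) y\<bar> \<le> \<bar>y\<bar> * ((p - 1) * jp (p - 1 - 1) y)"
    using assms by (intro mult_left_mono jp'_bound) auto
  also have "\<dots> = (p - 1) * (\<bar>y\<bar> * jp (p - 1 - 1) y)" by simp
  also have "\<dots> \<le> (p - 1) * jp (p - 1) y" using assms by (intro mult_left_mono abs_mult_jp_le) auto
  finally have "\<bar>y * jp' (p - 1) y\<bar> \<le> (p - 1) * jp (p - 1) y" by (simp add: abs_mult)
  moreover have "(p - 1) * jp (p - 1) y = p * jp (p - 1) y - jp (p - 1) y" by (simp add: algebra_simps)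
  ultimately show ?thesis using jp_pos[of "p - 1" y] by linarith
qed

text \<open>In the integration by parts the smooth function y \<mapsto>
  \<open>y * jp (p - 1) y\<close> replaces y |y|^(p - 1); for domination the inequality is
  enough.\<close>

lemma powr_Suc_le_mult_jp:
  assumes "1 \<le> p"
  shows "\<bar>y\<bar> powr (p + 1) \<le> y * (y * jp (p - 1) y)"
proof -
  have "\<bar>y\<bar> powr (p + 1) = \<bar>y\<bar> powr 2 * \<bar>y\<bar> powr (p - 1)" by (subst powr_add[symmetric]) (simp add: add.commute)
  also have "\<bar>y\<bar> powr 2 = y\<^sup>2" by (cases "y = 0") (simp_all add: powr_numeral)
  also have "y\<^sup>2 * \<bar>y\<bar> powr (p - 1) \<le> y\<^sup>2 * jp 1 y powr (p - 1)" using assms abs_le_jp by (intro mult_left_mono powr_mono2) auto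
  finally show ?thesis by (simp add: jp_powr power2_eq_square mult.assoc)
qed

text \<open>The bounded vector field \<open>jp' / sqrt (1 + jp'\<^sup>2)\<close> controls the drift \<open>jp'\<close>, which is unbounded for
  \<open>t > 1\<close>.\<close>

definition drift :: "real \<Rightarrow> real \<Rightarrow> real" where
  "drift t z = jp' t z * jp (-1) (jp' t z)"

definition drift' :: "real \<Rightarrow> real \<Rightarrow> real" where
  "drift' t z = (jp (-1) (jp' t z) + jp' t z * jp' (-1) (jp' t z)) * jp'' t z"

lemma drift_has_real_derivative: "(drift t has_real_derivative drift' t z) (at z)"
  unfolding drift_def[abs_def] drift'_def
  by (rule DERIV_chain2[OF mult_jp_has_real_derivative jp'_has_real_derivative])

lemma continuous_drift: "continuous_on A (drift t)" "continuous_on A (drift' t)"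
  unfolding drift_def drift'_def
  by (intro continuous_intros continuous_on_compose2[OF continuous_jp(1)[of UNIV]]
      continuous_on_compose2[OF continuous_jp(2)[of UNIV]] continuous_jp subset_UNIV)+

lemma drift_bound: "\<bar>drift t z\<bar> \<le> 1"
  using abs_mult_jp_le[of "jp' t z" 0] jp_pos[of "-1" "jp' t z"] by (simp add: drift_def abs_mult jp_def)

lemma abs_jp_minus_1_deriv_le: "\<bar>jp (-1) w + w * jp' (-1) w\<bar> \<le> 2"
proof -
  have "\<bar>w * jp' (-1) w\<bar> = \<bar>w\<bar> * (\<bar>w\<bar> * jp (-2 - 1) w)"
    using jp_pos[of "-3" w] by (simp add: jp'_eq abs_mult)
  also have "\<dots> \<le> \<bar>w\<bar> * jp (-1 - 1) w" using abs_mult_jp_le[of w "-2"] by (intro mult_left_mono) auto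
  also have "\<dots> \<le> 1" using order_trans[OF abs_mult_jp_le[of w "-1"] jp_le_1] by simp
  finally show ?thesis
    using jp_le_1[of "-1" w] jp_pos[of "-1" w] by linarith
qed

lemma drift'_bound:
  assumes "0 < t" "t \<le> 2"
  shows "\<bar>drift' t z\<bar> \<le> 12"
proof -
  have "\<bar>drift' t z\<bar> \<le> 2 * 6"
    unfolding drift'_def abs_mult[of "_ + _"]
    by (intro mult_mono jp''_bound abs_jp_minus_1_deriv_le assms) auto
  then show ?thesis by simp
qed

lemma drift_mult_nonneg: "0 \<le> drift t z * jp' t z"
  using jp_pos[of "-1" "jp' t z"] by (simp add: drift_def mult.assoc mult.left_commute[of "jp' t z"] flip: power2_eq_square)

text \<open>The absorption property of the field. For w = |jp'| \<ge> 1 it reduces to (w - 1)(w + 1)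
  \<le> w^2; the summand 1 covers small w and is harmless since the weight has finite mass.\<close>

lemma abs_jp'_le_drift: "\<bar>jp' t z\<bar> \<le> drift t z * jp' t z + 1"
proof -
  let ?w = "\<bar>jp' t z\<bar>"
  have eq: "drift t z * jp' t z = ?w\<^sup>2 * jp (-1) (jp' t z)"
    by (simp add: drift_def power2_eq_square)
  have "?w - 1 \<le> ?w\<^sup>2 * jp (-1) (jp' t z)"
  proof (cases "?w \<le> 1")
    case True
    have "0 \<le> ?w\<^sup>2 * jp (-1) (jp' t z)" using jp_pos by (simp add: less_imp_le)
    with True show ?thesis by linarith
  next
    case False
    have "(?w - 1) * jp 1 (jp' t z) \<le> (?w - 1) * (1 + ?w)"
      using False jp_1_le by (intro mult_left_mono) auto
    also have "\<dots> \<le> ?w\<^sup>2" by (simp add: algebra_simps power2_eq_square)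
    finally have "(?w - 1) * jp 1 (jp' t z) * jp (-1) (jp' t z) \<le> ?w\<^sup>2 * jp (-1) (jp' t z)"
      using jp_pos by (intro mult_right_mono) (auto simp: less_imp_le)
    moreover have "jp 1 (jp' t z) * jp (-1) (jp' t z) = 1" using one_plus_sq_pos[of "jp' t z"] unfolding jp_add by (simp add: jp_def)
    ultimately show ?thesis by (simp add: mult.assoc)
  qed
  then show ?thesis using eq by simp
qed

lemma continuous_coord: "continuous_on UNIV f \<Longrightarrow> continuous_on A (\<lambda>x :: real ^ 'n. f (x $ i))"
  by (rule continuous_on_compose2[of UNIV f]) (auto intro!: continuous_intros)

lemma coord_measurable:
  fixes i :: "'n::finite"
  assumes "continuous_on UNIV f"
  shows "(\<lambda>x :: real ^ 'n. f (x $ i)) \<in> borel_measurable (rho_measure t)"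
proof -
  have "(\<lambda>x :: real ^ 'n. f (x $ i)) \<in> borel_measurable borel"
    by (intro borel_measurable_continuous_onI continuous_coord assms)
  then show ?thesis unfolding measurable_rho_measure by (intro measurable_completion) simp
qed

section \<open>The top-order term: two integrations by parts along one coordinate\<close>

context
  fixes t p :: real and i :: "'n::finite" and c :: "nat \<Rightarrow> real ^ 'n \<Rightarrow> real" and \<Gamma> cl yl zl and e :: "'n \<Rightarrow> nat"
    and M :: "(real ^ 'n) measure"
  defines "e \<equiv> mi_inc i (\<lambda>_. 0)" and "M \<equiv> rho_measure t"
  assumes t: "0 < t" "t \<le> 2" and p: "1 \<le> p"
    and c: "\<And>j. all_derivs (c j) (\<Gamma> j)" "\<And>j. \<exists>R. supp_in R (c j)"
    and y: "Lpconv M p (\<lambda>j. \<Gamma> j e) yl" and z: "Lpconv M p (\<lambda>j. \<Gamma> j (mi_inc i e)) zl"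
    and cl: "cl \<in> borel_measurable M"
    and lim: "AE x in M. (\<lambda>j. c j x) \<longlonglongrightarrow> cl x" "AE x in M. (\<lambda>j. \<Gamma> j e x) \<longlonglongrightarrow> yl x"
      "AE x in M. (\<lambda>j. \<Gamma> j (mi_inc i e) x) \<longlonglongrightarrow> zl x"
begin

lemma pos_p: "0 < p" using p by simp

lemma integrable_const: "integrable M (\<lambda>x. k :: real)"
  unfolding M_def by (rule integrable_rho_measure_jp'(2)[OF t])

lemma integrable_jp': "integrable M (\<lambda>x. \<bar>jp' t (x $ i)\<bar>)"
  unfolding M_def by (rule integrable_rho_measure_jp'(1)[OF t])

lemma coord_meas: "continuous_on UNIV f \<Longrightarrow> (\<lambda>x. f (x $ i)) \<in> borel_measurable M"
  unfolding M_def by (rule coord_measurable)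

lemma c_eq: "\<Gamma> j (\<lambda>_. 0) = c j" by (rule all_derivsD(1)[OF c(1)])

lemma continuous_\<Gamma>: "continuous_on UNIV (\<Gamma> j s)" by (rule all_derivs_continuous[OF c(1)])

lemma continuous_c: "continuous_on UNIV (c j)" using continuous_\<Gamma>[of j "\<lambda>_. 0"] by (simp add: c_eq)

lemma continuous_comp: "continuous_on UNIV g \<Longrightarrow> continuous_on UNIV f \<Longrightarrow> continuous_on UNIV (\<lambda>x. g (f x))"
  by (rule continuous_on_compose2[of UNIV g]) auto

lemma meas:
  "\<Gamma> j s \<in> borel_measurable M" "c j \<in> borel_measurable M" "yl \<in> borel_measurable M" "zl \<in> borel_measurable M"
  using all_derivs_measurable(2)[OF c(1), of j s] all_derivs_measurable(2)[OF c(1), of j "\<lambda>_. 0"]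
    LspaceD(1)[OF LpconvD(2)[OF y]] LspaceD(1)[OF LpconvD(2)[OF z]]
  by (auto simp: M_def measurable_rho_measure c_eq)

lemma L1conv_jp: "L1conv M (\<lambda>j x. jp p (\<Gamma> j e x)) (\<lambda>x. jp p (yl x))"
proof (rule L1conv_dominated)
  have [measurable]: "jp p \<in> borel_measurable borel" by (intro borel_measurable_continuous_onI continuous_jp)
  note [measurable] = meas
  show "L1conv M (\<lambda>j x. 2 powr p * (1 + \<bar>\<Gamma> j e x\<bar> powr p)) (\<lambda>x. 2 powr p * (1 + \<bar>yl x\<bar> powr p))"
    by (intro L1conv_cmult L1conv_add L1conv_const integrable_const Lpconv_imp_L1conv_powr[OF pos_p y lim(2)])
  show "(\<lambda>x. jp p (\<Gamma> j e x)) \<in> borel_measurable M" "(\<lambda>x. jp p (yl x)) \<in> borel_measurable M" for j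
    by measurable
  have "isCont (jp p) v" for v using continuous_jp(1)[of UNIV p] by (simp add: continuous_on_eq_continuous_at)
  then show "AE x in M. (\<lambda>j. jp p (\<Gamma> j e x)) \<longlonglongrightarrow> jp p (yl x)"
    using lim(2) by (auto elim!: eventually_mono intro: isCont_tendsto_compose)
  show "AE x in M. \<bar>jp p (\<Gamma> j e x)\<bar> \<le> 2 powr p * (1 + \<bar>\<Gamma> j e x\<bar> powr p)" for j
    using jp_le_powr[of p] p jp_pos[of p] by (simp add: less_imp_le)
qed

lemma L1conv_powr_z: "L1conv M (\<lambda>j x. \<bar>\<Gamma> j (mi_inc i e) x\<bar> powr p) (\<lambda>x. \<bar>zl x\<bar> powr p)"
  by (rule Lpconv_imp_L1conv_powr[OF pos_p z lim(3)])

text \<open>Compact support makes the two groups of terms integrable separately, so the vanishing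
  total splits into an identity. The drift term stands on the left because one application estimates
  it and the other transports it.\<close>

lemma parts_identity:
  assumes F: "\<And>y. (F has_real_derivative F' y) (at y)" "continuous_on UNIV F'"
    and N: "\<And>y. (N has_real_derivative N' y) (at y)" "continuous_on UNIV N'" "N 0 = 0"
    and b: "\<And>y. (b has_real_derivative b' y) (at y)" "continuous_on UNIV b'"
  shows "(LINT x|M. F' (c j x) * \<Gamma> j e x * N (\<Gamma> j e x) * b (x $ i) - F (c j x) * N (\<Gamma> j e x) * b (x $ i) * jp' t (x $ i))
     = - (LINT x|M. F (c j x) * (N' (\<Gamma> j e x) * \<Gamma> j (mi_inc i e) x) * b (x $ i) + F (c j x) * N (\<Gamma> j e x) * b' (x $ i))"
    (is "(LINT x|M. ?U x) = - (LINT x|M. ?V x)")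
proof -
  obtain R where R: "supp_in R (c j)" using c(2) by blast
  note supp = all_derivs_supp_in[OF c(1) R]
  have suppN: "\<Gamma> j e x \<noteq> 0 \<Longrightarrow> norm x \<le> R" "\<Gamma> j (mi_inc i e) x \<noteq> 0 \<Longrightarrow> norm x \<le> R" for x
    using supp[of e] supp[of "mi_inc i e"] unfolding supp_in_def by auto
  note cont = continuous_comp[OF continuous_of_real_derivative[OF F(1)] continuous_c] continuous_comp[OF F(2) continuous_c]
    continuous_comp[OF continuous_of_real_derivative[OF N(1)] continuous_\<Gamma>] continuous_comp[OF N(2) continuous_\<Gamma>]
    continuous_coord[OF continuous_of_real_derivative[OF b(1)]] continuous_coord[OF b(2)] continuous_coord[OF continuous_jp(2)]
  have "integrable M ?U"
    unfolding M_def
  proof (rule integrable_rho_continuous_supp_in(1))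
    show "continuous_on UNIV ?U" by (intro continuous_intros continuous_\<Gamma> cont)
    show "supp_in R ?U" unfolding supp_in_def using suppN N(3) by force
  qed
  moreover have "integrable M ?V"
    unfolding M_def
  proof (rule integrable_rho_continuous_supp_in(1))
    show "continuous_on UNIV ?V" by (intro continuous_intros continuous_\<Gamma> cont)
    show "supp_in R ?V" unfolding supp_in_def using suppN N(3) by force
  qed
  moreover have "(LINT x|M. ?U x + ?V x) = 0"
    using rho_integral_by_parts[OF c(1) R F N b, of t i] unfolding M_def e_def by (simp add: algebra_simps)
  ultimately show ?thesis by simp
qed

text \<open>The choice F = 1, N = \<open>jp p\<close> - 1 and b = \<open>drift t\<close>.
  Subtracting 1 makes N vanish at 0 and keeps it nonnegative. This comes before the estimate with
  \<psi>'' because its conclusion is part of the majorant there.\<close>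

lemma L1conv_drift:
  "L1conv M (\<lambda>j x. drift t (x $ i) * jp' t (x $ i) * (jp p (\<Gamma> j e x) - 1))
     (\<lambda>x. drift t (x $ i) * jp' t (x $ i) * (jp p (yl x) - 1))"
proof (rule L1conv_by_truncation[where P="\<lambda>_ _ x. drift t (x $ i) * jp' t (x $ i)" and N="\<lambda>y. jp p y - 1" and N'="jp' p"
      and ?Q0.0="\<lambda>_ x. drift t (x $ i)" and ?Q1.0="\<lambda>_ x. drift' t (x $ i)" and c=c and cl=cl and y="\<lambda>j. \<Gamma> j e"
      and z="\<lambda>j. \<Gamma> j (mi_inc i e)" and zl=zl and S="\<lambda>_ x. \<bar>jp' t (x $ i)\<bar>" and Sl="\<lambda>x. \<bar>jp' t (x $ i)\<bar>"
      and W="\<lambda>j x. p * (jp p (\<Gamma> j e x) + \<bar>\<Gamma> j (mi_inc i e) x\<bar> powr p) + 12 * jp p (\<Gamma> j e x)"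
      and Wl="\<lambda>x. p * (jp p (yl x) + \<bar>zl x\<bar> powr p) + 12 * jp p (yl x)"])
  show "continuous_on UNIV (\<lambda>y. jp p y - 1)" "continuous_on UNIV (jp' p)" by (intro continuous_intros continuous_jp)+
  show "L1conv M (\<lambda>j x. p * (jp p (\<Gamma> j e x) + \<bar>\<Gamma> j (mi_inc i e) x\<bar> powr p) + 12 * jp p (\<Gamma> j e x))
      (\<lambda>x. p * (jp p (yl x) + \<bar>zl x\<bar> powr p) + 12 * jp p (yl x))"
    by (intro L1conv_add L1conv_cmult L1conv_jp L1conv_powr_z)
  show "L1conv M (\<lambda>_ x. \<bar>jp' t (x $ i)\<bar>) (\<lambda>x. \<bar>jp' t (x $ i)\<bar>)"
    by (intro L1conv_const integrable_jp')
  have bound: "\<bar>drift t (x $ i)\<bar> * \<bar>jp' p y * z\<bar> + \<bar>drift' t (x $ i)\<bar> * \<bar>jp p y - 1\<bar>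
      \<le> p * (jp p y + \<bar>z\<bar> powr p) + 12 * jp p y" for y z and x :: "real ^ 'n"
  proof (rule add_mono)
    have "\<bar>drift t (x $ i)\<bar> * \<bar>jp' p y * z\<bar> \<le> 1 * (p * jp (p - 1) y * \<bar>z\<bar>)"
      unfolding abs_mult using p jp'_bound[of p y] by (intro mult_mono drift_bound) auto
    also have "\<dots> \<le> p * (jp p y + \<bar>z\<bar> powr p)"
      unfolding mult_1 mult.assoc using p by (intro mult_left_mono jp_mult_le) auto
    finally show "\<bar>drift t (x $ i)\<bar> * \<bar>jp' p y * z\<bar> \<le> p * (jp p y + \<bar>z\<bar> powr p)" .
    show "\<bar>drift' t (x $ i)\<bar> * \<bar>jp p y - 1\<bar> \<le> 12 * jp p y"
      using jp_ge_1[of p y] p by (intro mult_mono drift'_bound t) auto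
  qed
  show "\<bar>drift t (x $ i)\<bar> * \<bar>jp' p (\<Gamma> j e x) * \<Gamma> j (mi_inc i e) x\<bar> + \<bar>drift' t (x $ i)\<bar> * \<bar>jp p (\<Gamma> j e x) - 1\<bar>
      \<le> p * (jp p (\<Gamma> j e x) + \<bar>\<Gamma> j (mi_inc i e) x\<bar> powr p) + 12 * jp p (\<Gamma> j e x)" for j x
    by (rule bound)
  show "\<bar>drift t (x $ i)\<bar> * \<bar>jp' p (yl x) * zl x\<bar> + \<bar>drift' t (x $ i)\<bar> * \<bar>jp p (yl x) - 1\<bar>
      \<le> p * (jp p (yl x) + \<bar>zl x\<bar> powr p) + 12 * jp p (yl x)" for x
    by (rule bound)
  show "0 \<le> drift t (x $ i) * jp' t (x $ i) * (jp p b - 1)" for b and x :: "real ^ 'n"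
    using jp_ge_1[of p b] p by (intro mult_nonneg_nonneg[OF drift_mult_nonneg]) auto
  show "\<bar>drift t (x $ i) * jp' t (x $ i)\<bar> \<le> \<bar>jp' t (x $ i)\<bar>" for x :: "real ^ 'n"
    using mult_right_mono[OF drift_bound, of "\<bar>jp' t (x $ i)\<bar>" t "x $ i"] by (simp add: abs_mult)
  show "(LINT x|M. drift t (x $ i) * jp' t (x $ i) * trunc m (jp p (\<Gamma> j e x) - 1))
      = (LINT x|M. drift t (x $ i) * (trunc' m (jp p (\<Gamma> j e x) - 1) * (jp' p (\<Gamma> j e x) * \<Gamma> j (mi_inc i e) x))
        + drift' t (x $ i) * trunc m (jp p (\<Gamma> j e x) - 1))" for m j
  proof -
    have N: "((\<lambda>y. trunc m (jp p y - 1)) has_real_derivative trunc' m (jp p y - 1) * jp' p y) (at y)" for y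
      using DERIV_chain2[OF trunc_has_real_derivative DERIV_diff[OF jp_has_real_derivative DERIV_const]] by simp
    have N': "continuous_on UNIV (\<lambda>y. trunc' m (jp p y - 1) * jp' p y)"
      by (intro continuous_intros continuous_jp continuous_on_compose2[OF continuous_trunc'[of UNIV]]) auto
    have F: "((\<lambda>_::real. 1::real) has_real_derivative (\<lambda>_. 0) y) (at y)" for y by simp
    show ?thesis
      using parts_identity[OF F _ N N' _ drift_has_real_derivative continuous_drift(2), of j]
      by (simp add: jp_def mult_ac)
  qed
qed (use meas cl lim in \<open>auto intro!: tendsto_intros coord_meas continuous_on_mult continuous_drift continuous_jp\<close>)

text \<open>The choice F = \<psi>', N = \<open>y * jp (p - 1) y\<close> and b = 1. All terms on the
  other side contain only the bounded \<psi>'; the term with N' z is handled by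
  \<open>jp_mult_le\<close>, the one with \<open>jp'\<close> by \<open>L1conv_drift\<close>.\<close>

lemma L1conv_psi_deriv_2:
  "L1conv M (\<lambda>j x. psi_deriv 2 (c j x) * \<Gamma> j e x * (\<Gamma> j e x * jp (p - 1) (\<Gamma> j e x)))
     (\<lambda>x. psi_deriv 2 (cl x) * yl x * (yl x * jp (p - 1) (yl x)))"
proof (rule L1conv_by_truncation[where P="\<lambda>a y x. psi_deriv 2 a * y" and N="\<lambda>y. y * jp (p - 1) y"
      and N'="\<lambda>y. jp (p - 1) y + y * jp' (p - 1) y"
      and ?Q0.0="\<lambda>a x. - psi_deriv 1 a" and ?Q1.0="\<lambda>a x. psi_deriv 1 a * jp' t (x $ i)" and c=c and cl=cl and y="\<lambda>j. \<Gamma> j e"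
      and z="\<lambda>j. \<Gamma> j (mi_inc i e)" and zl=zl and S="\<lambda>j x. 1 + \<bar>\<Gamma> j e x\<bar> powr p" and Sl="\<lambda>x. 1 + \<bar>yl x\<bar> powr p"
      and W="\<lambda>j x. p * (jp p (\<Gamma> j e x) + \<bar>\<Gamma> j (mi_inc i e) x\<bar> powr p) + (drift t (x $ i) * jp' t (x $ i) * (jp p (\<Gamma> j e x) - 1)
          + (jp p (\<Gamma> j e x) + \<bar>jp' t (x $ i)\<bar>))"
      and Wl="\<lambda>x. p * (jp p (yl x) + \<bar>zl x\<bar> powr p) + (drift t (x $ i) * jp' t (x $ i) * (jp p (yl x) - 1)
          + (jp p (yl x) + \<bar>jp' t (x $ i)\<bar>))"])
  have isC: "isCont (psi_deriv n) v" for n v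
    using continuous_psi_deriv[of UNIV n] by (simp add: continuous_on_eq_continuous_at)
  have D1: "(psi_deriv 1 has_real_derivative psi_deriv 2 y) (at y)" for y
    using psi_deriv_has_real_derivative[of 1 y] by (simp add: numeral_2_eq_2)
  show "continuous_on UNIV (\<lambda>y. y * jp (p - 1) y)" "continuous_on UNIV (\<lambda>y. jp (p - 1) y + y * jp' (p - 1) y)"
    by (intro continuous_intros continuous_jp)+
  show "L1conv M (\<lambda>j x. p * (jp p (\<Gamma> j e x) + \<bar>\<Gamma> j (mi_inc i e) x\<bar> powr p) + (drift t (x $ i) * jp' t (x $ i) * (jp p (\<Gamma> j e x) - 1)
          + (jp p (\<Gamma> j e x) + \<bar>jp' t (x $ i)\<bar>)))
     (\<lambda>x. p * (jp p (yl x) + \<bar>zl x\<bar> powr p) + (drift t (x $ i) * jp' t (x $ i) * (jp p (yl x) - 1)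
          + (jp p (yl x) + \<bar>jp' t (x $ i)\<bar>)))"
    by (intro L1conv_add L1conv_cmult L1conv_jp L1conv_powr_z L1conv_drift L1conv_const integrable_jp')
  show "L1conv M (\<lambda>j x. 1 + \<bar>\<Gamma> j e x\<bar> powr p) (\<lambda>x. 1 + \<bar>yl x\<bar> powr p)"
    by (intro L1conv_add L1conv_const integrable_const Lpconv_imp_L1conv_powr[OF pos_p y lim(2)])
  have bound: "\<bar>- psi_deriv 1 a\<bar> * \<bar>(jp (p - 1) y + y * jp' (p - 1) y) * z\<bar> + \<bar>psi_deriv 1 a * jp' t (x $ i)\<bar> * \<bar>y * jp (p - 1) y\<bar>
      \<le> p * (jp p y + \<bar>z\<bar> powr p) + (drift t (x $ i) * jp' t (x $ i) * (jp p y - 1) + (jp p y + \<bar>jp' t (x $ i)\<bar>))"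
    for a y z and x :: "real ^ 'n"
  proof (rule add_mono)
    have \<psi>: "\<bar>psi_deriv 1 a\<bar> \<le> 1" using psi_deriv_1_bounds[of a] by linarith
    have "\<bar>- psi_deriv 1 a\<bar> * \<bar>(jp (p - 1) y + y * jp' (p - 1) y) * z\<bar> \<le> 1 * (p * jp (p - 1) y * \<bar>z\<bar>)"
      unfolding abs_mult[of _ z] abs_minus_cancel using p mult_jp'_bound[OF p, of y] \<psi> jp_pos[of "p - 1" y]
      by (intro mult_mono) auto
    also have "\<dots> \<le> p * (jp p y + \<bar>z\<bar> powr p)"
      unfolding mult_1 mult.assoc using p by (intro mult_left_mono jp_mult_le) auto
    finally show "\<bar>- psi_deriv 1 a\<bar> * \<bar>(jp (p - 1) y + y * jp' (p - 1) y) * z\<bar> \<le> p * (jp p y + \<bar>z\<bar> powr p)" .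
    have "\<bar>y * jp (p - 1) y\<bar> \<le> jp p y" using abs_mult_jp_le[of y p] jp_pos[of "p - 1" y] by (simp add: abs_mult)
    then have "\<bar>psi_deriv 1 a * jp' t (x $ i)\<bar> * \<bar>y * jp (p - 1) y\<bar> \<le> (1 * \<bar>jp' t (x $ i)\<bar>) * jp p y"
      unfolding abs_mult[of "psi_deriv 1 a"] using \<psi> by (intro mult_mono) auto
    \<comment> \<open>Splitting off 1 matches the form of \<open>L1conv_drift\<close>; the leftover
      |jp'| is integrable for the weight.\<close>
    also have "\<dots> = \<bar>jp' t (x $ i)\<bar> * (jp p y - 1) + \<bar>jp' t (x $ i)\<bar>" by (simp add: algebra_simps)
    also have "\<bar>jp' t (x $ i)\<bar> * (jp p y - 1) \<le> (drift t (x $ i) * jp' t (x $ i) + 1) * (jp p y - 1)"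
      using jp_ge_1[of p y] p by (intro mult_right_mono abs_jp'_le_drift) auto
    also have "\<dots> \<le> drift t (x $ i) * jp' t (x $ i) * (jp p y - 1) + jp p y" by (simp add: algebra_simps)
    finally show "\<bar>psi_deriv 1 a * jp' t (x $ i)\<bar> * \<bar>y * jp (p - 1) y\<bar>
        \<le> drift t (x $ i) * jp' t (x $ i) * (jp p y - 1) + (jp p y + \<bar>jp' t (x $ i)\<bar>)" by simp
  qed
  show "\<bar>- psi_deriv 1 (c j x)\<bar> * \<bar>(jp (p - 1) (\<Gamma> j e x) + \<Gamma> j e x * jp' (p - 1) (\<Gamma> j e x)) * \<Gamma> j (mi_inc i e) x\<bar>
      + \<bar>psi_deriv 1 (c j x) * jp' t (x $ i)\<bar> * \<bar>\<Gamma> j e x * jp (p - 1) (\<Gamma> j e x)\<bar>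
      \<le> p * (jp p (\<Gamma> j e x) + \<bar>\<Gamma> j (mi_inc i e) x\<bar> powr p) + (drift t (x $ i) * jp' t (x $ i) * (jp p (\<Gamma> j e x) - 1)
          + (jp p (\<Gamma> j e x) + \<bar>jp' t (x $ i)\<bar>))" for j x
    by (rule bound)
  show "\<bar>- psi_deriv 1 (cl x)\<bar> * \<bar>(jp (p - 1) (yl x) + yl x * jp' (p - 1) (yl x)) * zl x\<bar>
      + \<bar>psi_deriv 1 (cl x) * jp' t (x $ i)\<bar> * \<bar>yl x * jp (p - 1) (yl x)\<bar>
      \<le> p * (jp p (yl x) + \<bar>zl x\<bar> powr p) + (drift t (x $ i) * jp' t (x $ i) * (jp p (yl x) - 1)
          + (jp p (yl x) + \<bar>jp' t (x $ i)\<bar>))" for x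
    by (rule bound)
  show "0 \<le> psi_deriv 2 a * b * (b * jp (p - 1) b)" for a b
  proof -
    have eq: "psi_deriv 2 a * b * (b * jp (p - 1) b) = psi_deriv 2 a * b\<^sup>2 * jp (p - 1) b" by (simp add: power2_eq_square)
    show ?thesis unfolding eq using psi_deriv_2_bounds(1)[of a] jp_pos[of "p - 1" b]
      by (intro mult_nonneg_nonneg) auto
  qed
  show "\<bar>psi_deriv 2 (c j x) * \<Gamma> j e x\<bar> \<le> 1 + \<bar>\<Gamma> j e x\<bar> powr p" for j x
  proof -
    have "\<bar>psi_deriv 2 (c j x) * \<Gamma> j e x\<bar> \<le> 1 * \<bar>\<Gamma> j e x\<bar>"
      unfolding abs_mult using psi_deriv_2_bounds[of "c j x"] by (intro mult_right_mono) auto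
    then show ?thesis using abs_le_one_plus_powr[OF p, of "\<Gamma> j e x"] by simp
  qed
  show "(LINT x|M. psi_deriv 2 (c j x) * \<Gamma> j e x * trunc m (\<Gamma> j e x * jp (p - 1) (\<Gamma> j e x)))
      = (LINT x|M. - psi_deriv 1 (c j x) * (trunc' m (\<Gamma> j e x * jp (p - 1) (\<Gamma> j e x)) *
          ((jp (p - 1) (\<Gamma> j e x) + \<Gamma> j e x * jp' (p - 1) (\<Gamma> j e x)) * \<Gamma> j (mi_inc i e) x))
        + psi_deriv 1 (c j x) * jp' t (x $ i) * trunc m (\<Gamma> j e x * jp (p - 1) (\<Gamma> j e x)))" for m j
  proof -
    have N: "((\<lambda>y. trunc m (y * jp (p - 1) y)) has_real_derivative
        trunc' m (y * jp (p - 1) y) * (jp (p - 1) y + y * jp' (p - 1) y)) (at y)" for y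
      by (rule DERIV_chain2[OF trunc_has_real_derivative mult_jp_has_real_derivative])
    have N': "continuous_on UNIV (\<lambda>y. trunc' m (y * jp (p - 1) y) * (jp (p - 1) y + y * jp' (p - 1) y))"
      by (intro continuous_intros continuous_jp continuous_on_compose2[OF continuous_trunc'[of UNIV]]) auto
    have b: "((\<lambda>_::real. 1::real) has_real_derivative (\<lambda>_. 0) y) (at y)" for y by simp
    obtain R where R: "supp_in R (c j)" using c(2) by blast
    let ?T = "\<lambda>x. trunc m (\<Gamma> j e x * jp (p - 1) (\<Gamma> j e x))"
    have suppT: "supp_in R ?T" using all_derivs_supp_in[OF c(1) R, of e] unfolding supp_in_def by force
    have contT: "continuous_on UNIV ?T"
      by (intro continuous_intros continuous_comp[OF continuous_trunc] continuous_comp[OF continuous_jp(1)] continuous_\<Gamma>)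
    note cont\<psi> = continuous_comp[OF continuous_psi_deriv continuous_c]
    have 1: "integrable M (\<lambda>x. psi_deriv 2 (c j x) * \<Gamma> j e x * ?T x)"
      unfolding M_def by (rule integrable_rho_continuous_supp_in(1)[OF _ supp_in_mult(2)[OF suppT]])
        (intro continuous_intros cont\<psi> contT continuous_\<Gamma>)
    have 2: "integrable M (\<lambda>x. psi_deriv 1 (c j x) * jp' t (x $ i) * ?T x)"
      unfolding M_def by (rule integrable_rho_continuous_supp_in(1)[OF _ supp_in_mult(2)[OF suppT]])
        (intro continuous_intros cont\<psi> contT continuous_coord continuous_jp)
    have 3: "integrable M (\<lambda>x. psi_deriv 1 (c j x) * (trunc' m (\<Gamma> j e x * jp (p - 1) (\<Gamma> j e x)) *
          ((jp (p - 1) (\<Gamma> j e x) + \<Gamma> j e x * jp' (p - 1) (\<Gamma> j e x)) * \<Gamma> j (mi_inc i e) x)))"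
      unfolding M_def mult.assoc[symmetric]
      by (rule integrable_rho_continuous_supp_in(1)[OF _ supp_in_mult(2)[OF all_derivs_supp_in[OF c(1) R]]])
        (intro continuous_intros cont\<psi> continuous_comp[OF continuous_trunc'] continuous_comp[OF continuous_jp(1)]
          continuous_comp[OF continuous_jp(2)] continuous_\<Gamma>)
    have "(LINT x|M. psi_deriv 2 (c j x) * \<Gamma> j e x * ?T x - psi_deriv 1 (c j x) * jp' t (x $ i) * ?T x)
        = - (LINT x|M. psi_deriv 1 (c j x) * (trunc' m (\<Gamma> j e x * jp (p - 1) (\<Gamma> j e x)) *
          ((jp (p - 1) (\<Gamma> j e x) + \<Gamma> j e x * jp' (p - 1) (\<Gamma> j e x)) * \<Gamma> j (mi_inc i e) x)))"
      using parts_identity[OF D1 continuous_psi_deriv N N' _ b, of j] by (simp add: mult_ac)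
    then show ?thesis using 1 2 3 by (simp del: psi_deriv.simps)
  qed
  have [measurable]: "(\<lambda>x. jp' t (x $ i)) \<in> borel_measurable M" by (intro coord_meas continuous_jp)
  note [measurable] = meas cl
  show "(\<lambda>x. psi_deriv 2 (c j x) * \<Gamma> j e x) \<in> borel_measurable M" "(\<lambda>x. psi_deriv 2 (cl x) * yl x) \<in> borel_measurable M"
    "(\<lambda>x. - psi_deriv 1 (c j x)) \<in> borel_measurable M" "(\<lambda>x. - psi_deriv 1 (cl x)) \<in> borel_measurable M"
    "(\<lambda>x. psi_deriv 1 (c j x) * jp' t (x $ i)) \<in> borel_measurable M"
    "(\<lambda>x. psi_deriv 1 (cl x) * jp' t (x $ i)) \<in> borel_measurable M" for j
    by measurable
  show "(\<lambda>j. psi_deriv 2 (f j) * g j) \<longlonglongrightarrow> psi_deriv 2 a * b" "(\<lambda>j. - psi_deriv 1 (f j)) \<longlonglongrightarrow> - psi_deriv 1 a"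
    "(\<lambda>j. psi_deriv 1 (f j) * jp' t (x $ i)) \<longlonglongrightarrow> psi_deriv 1 a * jp' t (x $ i)"
    if "f \<longlonglongrightarrow> a" "g \<longlonglongrightarrow> b" for f g a b and x :: "real ^ 'n"
    by (intro tendsto_intros isCont_tendsto_compose[OF isC] that)+
qed (use meas cl lim in auto)

end

section \<open>The chain rule\<close>

text \<open>A list \<open>[u1, ..., um]\<close> of multi-indices encodes the term \<open>\<psi>\<^sup>(\<^sup>m\<^sup>)(a) D\<^sup>u\<^sup>1 a \<cdots> D\<^sup>u\<^sup>m a\<close> of the Faa di Bruno
  formula; \<open>fdb is\<close> collects the terms after differentiating along the directions \<open>is\<close>.\<close>

definition fdb_term :: "('n::finite \<Rightarrow> nat) list \<Rightarrow> (('n \<Rightarrow> nat) \<Rightarrow> 'a \<Rightarrow> real) \<Rightarrow> 'a \<Rightarrow> real" where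
  "fdb_term us A x = psi_deriv (length us) (A (\<lambda>_. 0) x) * (\<Prod>u\<leftarrow>us. A u x)"

text \<open>The product rule on lists, one result for each factor that takes the derivative. Equal
  terms are simply repeated, which avoids the combinatorial coefficients of the formula.\<close>

fun mi_incs :: "'n \<Rightarrow> ('n \<Rightarrow> nat) list \<Rightarrow> ('n \<Rightarrow> nat) list list" where
  "mi_incs i [] = []"
| "mi_incs i (u # us) = (mi_inc i u # us) # map ((#) u) (mi_incs i us)"

fun fdb :: "'n list \<Rightarrow> ('n \<Rightarrow> nat) list list" where
  "fdb [] = [[]]"
| "fdb (i # is) = concat (map (\<lambda>us. (mi_inc i (\<lambda>_. 0) # us) # mi_incs i us) (fdb is))"

definition fdb_sum :: "'n::finite list \<Rightarrow> (('n \<Rightarrow> nat) \<Rightarrow> 'a \<Rightarrow> real) \<Rightarrow> 'a \<Rightarrow> real" where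
  "fdb_sum is A x = (\<Sum>us\<leftarrow>fdb is. fdb_term us A x)"

fun mi_of :: "'n list \<Rightarrow> 'n \<Rightarrow> nat" where
  "mi_of [] = (\<lambda>_. 0)"
| "mi_of (i # is) = mi_inc i (mi_of is)"

lemma mi_order_mi_of [simp]: "mi_order (mi_of is :: 'n::finite \<Rightarrow> nat) = length is"
  by (induction "is") auto

lemma mi_of_exists: "\<exists>is. mi_of is = (s :: 'n::finite \<Rightarrow> nat)"
proof (induction s rule: mi_induct)
  case zero
  show ?case by (rule exI[of _ "[]"]) simp
next
  case (inc i s)
  then obtain "is" where "mi_of is = s" by blast
  then show ?case by (intro exI[of _ "i # is"]) simp
qed

lemma mi_incs_props:
  fixes us :: "('n::finite \<Rightarrow> nat) list"
  assumes "vs \<in> set (mi_incs i us)"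
  shows "length vs = length us" "sum_list (map mi_order vs) = Suc (sum_list (map mi_order us))"
    "(\<forall>u\<in>set us. 1 \<le> mi_order u) \<Longrightarrow> (\<forall>u\<in>set vs. 1 \<le> mi_order u)"
proof -
  have "length vs = length us \<and> sum_list (map mi_order vs) = Suc (sum_list (map mi_order us)) \<and>
      ((\<forall>u\<in>set us. 1 \<le> mi_order u) \<longrightarrow> (\<forall>u\<in>set vs. 1 \<le> mi_order u))"
    using assms by (induction us arbitrary: vs) auto
  then show "length vs = length us" "sum_list (map mi_order vs) = Suc (sum_list (map mi_order us))"
    "(\<forall>u\<in>set us. 1 \<le> mi_order u) \<Longrightarrow> (\<forall>u\<in>set vs. 1 \<le> mi_order u)" by blast+
qed

lemma fdb_props:
  fixes us :: "('n::finite \<Rightarrow> nat) list"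
  assumes "us \<in> set (fdb is)"
  shows "sum_list (map mi_order us) = length is" "\<forall>u\<in>set us. 1 \<le> mi_order u"
proof -
  have "sum_list (map mi_order us) = length is \<and> (\<forall>u\<in>set us. 1 \<le> mi_order u)"
    using assms
  proof (induction "is" arbitrary: us)
    case (Cons i "is")
    then obtain ws where ws: "ws \<in> set (fdb is)" "us = mi_inc i (\<lambda>_. 0) # ws \<or> us \<in> set (mi_incs i ws)" by auto
    from Cons.IH[OF ws(1)] ws(2) show ?case using mi_incs_props[of us i ws] by auto
  qed simp
  then show "sum_list (map mi_order us) = length is" "\<forall>u\<in>set us. 1 \<le> mi_order u" by blast+
qed

lemma length_le_sum_list:
  fixes xs :: "nat list"
  assumes "\<forall>x\<in>set xs. 1 \<le> x"
  shows "length xs \<le> sum_list xs" "length xs = sum_list xs \<Longrightarrow> \<forall>x\<in>set xs. x = 1"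
proof -
  have "length xs \<le> sum_list xs \<and> (length xs = sum_list xs \<longrightarrow> (\<forall>x\<in>set xs. x = 1))"
    using assms by (induction xs) auto
  then show "length xs \<le> sum_list xs" "length xs = sum_list xs \<Longrightarrow> \<forall>x\<in>set xs. x = 1" by blast+
qed

text \<open>Every entry has order at least 1 and the orders add up to the length of
  \<open>is\<close>; hence equal lengths leave only first derivatives.\<close>

lemma fdb_length:
  fixes us :: "('n::finite \<Rightarrow> nat) list"
  assumes "us \<in> set (fdb is)"
  shows "length us \<le> length is" "u \<in> set us \<Longrightarrow> mi_order u \<le> length is"
    "length us = length is \<Longrightarrow> u \<in> set us \<Longrightarrow> \<exists>i. u = mi_inc i (\<lambda>_. 0)"
proof -
  note props = fdb_props[OF assms] and L = length_le_sum_list[of "map mi_order us"]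
  show "length us \<le> length is" using L(1) props by simp
  show "mi_order u \<le> length is" if "u \<in> set us"
    using member_le_sum_list[of "mi_order u" "map mi_order us"] that props(1) by simp
  show "\<exists>i. u = mi_inc i (\<lambda>_. 0)" if "length us = length is" "u \<in> set us"
  proof -
    have "mi_order u = 1" using L(2) props that by simp
    then show ?thesis
      by (cases u rule: mi_cases) (auto simp: mi_order_eq_0)
  qed
qed

lemma prod_list_has_partial:
  assumes c: "all_derivs c \<Gamma>"
  shows "has_partial i (\<lambda>x. \<Prod>u\<leftarrow>us. \<Gamma> u x) (\<lambda>x. \<Sum>vs\<leftarrow>mi_incs i us. \<Prod>u\<leftarrow>vs. \<Gamma> u x)"
proof (induction us)
  case Nil
  show ?case by (simp add: has_partial_def)
next
  case (Cons u us)
  have "(\<Sum>vs\<leftarrow>mi_incs i (u # us). \<Prod>u\<leftarrow>vs. \<Gamma> u x)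
      = \<Gamma> (mi_inc i u) x * (\<Prod>u\<leftarrow>us. \<Gamma> u x) + \<Gamma> u x * (\<Sum>vs\<leftarrow>mi_incs i us. \<Prod>u\<leftarrow>vs. \<Gamma> u x)" for x
    by (simp add: o_def sum_list_const_mult)
  then show ?case
    using has_partial_mult[OF all_derivs_partial[OF c, of i u] Cons.IH] by simp
qed

lemma fdb_term_has_partial:
  assumes c: "all_derivs c \<Gamma>"
  shows "has_partial i (fdb_term us \<Gamma>)
    (\<lambda>x. \<Sum>vs\<leftarrow>(mi_inc i (\<lambda>_. 0) # us) # mi_incs i us. fdb_term vs \<Gamma> x)"
proof -
  have eq: "(\<Sum>vs\<leftarrow>(mi_inc i (\<lambda>_. 0) # us) # mi_incs i us. fdb_term vs \<Gamma> x)
      = (psi_deriv (Suc (length us)) (\<Gamma> (\<lambda>_. 0) x) * \<Gamma> (mi_inc i (\<lambda>_. 0)) x) * (\<Prod>u\<leftarrow>us. \<Gamma> u x)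
        + psi_deriv (length us) (\<Gamma> (\<lambda>_. 0) x) * (\<Sum>vs\<leftarrow>mi_incs i us. \<Prod>u\<leftarrow>vs. \<Gamma> u x)" for x
  proof -
    have "map (\<lambda>vs. fdb_term vs \<Gamma> x) (mi_incs i us)
        = map (\<lambda>vs. psi_deriv (length us) (\<Gamma> (\<lambda>_. 0) x) * (\<Prod>u\<leftarrow>vs. \<Gamma> u x)) (mi_incs i us)"
      by (intro map_cong refl) (simp add: fdb_term_def mi_incs_props(1))
    then have "(\<Sum>vs\<leftarrow>mi_incs i us. fdb_term vs \<Gamma> x)
        = psi_deriv (length us) (\<Gamma> (\<lambda>_. 0) x) * (\<Sum>vs\<leftarrow>mi_incs i us. \<Prod>u\<leftarrow>vs. \<Gamma> u x)"
      by (simp only: sum_list_const_mult)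
    then show ?thesis by (simp add: fdb_term_def del: psi_deriv.simps)
  qed
  show ?thesis
    unfolding eq unfolding fdb_term_def[abs_def]
    by (intro has_partial_mult has_partial_compose[OF all_derivs_partial[OF c] psi_deriv_has_real_derivative]
        prod_list_has_partial[OF c])
qed

lemma has_partial_sum_list:
  assumes "\<And>a. a \<in> set as \<Longrightarrow> has_partial i (f a) (g a)"
  shows "has_partial i (\<lambda>x. \<Sum>a\<leftarrow>as. f a x) (\<lambda>x. \<Sum>a\<leftarrow>as. g a x)"
  using assms
proof (induction as)
  case (Cons a as)
  then show ?case by (auto simp: has_partial_def intro!: DERIV_add)
qed (simp add: has_partial_def)

lemma fdb_sum_has_partial:
  assumes c: "all_derivs c \<Gamma>"
  shows "has_partial i (fdb_sum is \<Gamma>) (fdb_sum (i # is) \<Gamma>)"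
proof -
  have eq: "fdb_sum (i # is) \<Gamma> = (\<lambda>x. \<Sum>us\<leftarrow>fdb is. \<Sum>vs\<leftarrow>(mi_inc i (\<lambda>_. 0) # us) # mi_incs i us. fdb_term vs \<Gamma> x)"
  proof -
    have "(\<Sum>vs\<leftarrow>concat (map g uss). fdb_term vs \<Gamma> x) = (\<Sum>us\<leftarrow>uss. \<Sum>vs\<leftarrow>g us. fdb_term vs \<Gamma> x)"
      for g and uss :: "('a \<Rightarrow> nat) list list" and x
      by (induction uss) auto
    then show ?thesis unfolding fdb_sum_def[abs_def] fdb.simps by (intro ext)
  qed
  show ?thesis
    unfolding eq fdb_sum_def[of "is", abs_def] by (intro has_partial_sum_list fdb_term_has_partial[OF c])
qed

lemma continuous_prod_list:
  fixes f :: "'b \<Rightarrow> 'a::topological_space \<Rightarrow> real"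
  assumes "\<And>u. continuous_on A (f u)"
  shows "continuous_on A (\<lambda>x. \<Prod>u\<leftarrow>us. f u x)"
  by (induction us) (auto intro!: continuous_intros assms)

lemma continuous_sum_list:
  fixes f :: "'b \<Rightarrow> 'a::topological_space \<Rightarrow> real"
  assumes "\<And>u. continuous_on A (f u)"
  shows "continuous_on A (\<lambda>x. \<Sum>u\<leftarrow>us. f u x)"
  by (induction us) (auto intro!: continuous_intros assms)

lemma continuous_fdb_sum:
  assumes c: "all_derivs c \<Gamma>"
  shows "continuous_on UNIV (fdb_sum is \<Gamma>)"
  unfolding fdb_sum_def fdb_term_def
  by (intro continuous_sum_list continuous_intros continuous_prod_list all_derivs_continuous[OF c]
      continuous_on_compose2[OF continuous_psi_deriv[of UNIV]] subset_UNIV)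

text \<open>One integration by parts per direction: the induction hypothesis is applied to the test
  function already differentiated in direction i, whose derivatives are the shifted family.\<close>

lemma fdb_sum_integral:
  assumes c: "all_derivs c \<Gamma>"
  shows "all_derivs \<phi> \<Phi> \<Longrightarrow> supp_in R \<phi> \<Longrightarrow>
    (LINT x|lborel. psi (c x) * \<Phi> (mi_of is) x) = (- 1) ^ length is * (LINT x|lborel. fdb_sum is \<Gamma> x * \<phi> x)"
proof (induction "is" arbitrary: \<phi> \<Phi>)
  case Nil
  then show ?case by (simp add: fdb_sum_def fdb_term_def all_derivsD(1)[OF c] all_derivsD(1)[OF Nil(1)])
next
  case (Cons i "is")
  let ?e = "mi_inc i (\<lambda>_. 0)"
  have "all_derivs (\<Phi> ?e) (\<lambda>s. \<Phi> (\<lambda>j. s j + ?e j))" by (rule all_derivs_shift[OF Cons.prems(1)])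
  from Cons.IH[OF this all_derivs_supp_in[OF Cons.prems]]
  have "(LINT x|lborel. psi (c x) * \<Phi> (\<lambda>j. mi_of is j + ?e j) x)
      = (- 1) ^ length is * (LINT x|lborel. fdb_sum is \<Gamma> x * \<Phi> ?e x)" .
  moreover have "(\<lambda>j. mi_of is j + ?e j) = mi_of (i # is)" by (auto simp: mi_inc_apply)
  moreover have "(LINT x|lborel. fdb_sum is \<Gamma> x * \<Phi> ?e x) = - (LINT x|lborel. fdb_sum (i # is) \<Gamma> x * \<phi> x)"
  proof (rule integral_by_parts_partial[OF fdb_sum_has_partial[OF c] continuous_fdb_sum[OF c] continuous_fdb_sum[OF c] _ _ _ Cons.prems(2)])
    show "has_partial i \<phi> (\<Phi> ?e)"
      using all_derivs_partial[OF Cons.prems(1), of i "\<lambda>_. 0"] by (simp add: all_derivsD(1)[OF Cons.prems(1)])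
    show "continuous_on UNIV \<phi>"
      using all_derivs_continuous[OF Cons.prems(1), of UNIV "\<lambda>_. 0"] by (simp add: all_derivsD(1)[OF Cons.prems(1)])
    show "continuous_on UNIV (\<Phi> ?e)" by (rule all_derivs_continuous[OF Cons.prems(1)])
  qed
  ultimately show ?case by simp
qed

section \<open>Convergence of the terms of the chain rule\<close>

text \<open>The product is at most the largest factor to the power of the length, and that one
  summand already gives the bound. This does the work of the generalised Hoelder inequality.\<close>

lemma prod_list_powr_le:
  fixes f :: "'b \<Rightarrow> real"
  assumes "us \<noteq> []" "0 \<le> q"
  shows "\<bar>\<Prod>u\<leftarrow>us. f u\<bar> powr q \<le> (\<Sum>u\<leftarrow>us. \<bar>f u\<bar> powr (real (length us) * q))"
proof -
  define m where "m = Max ((\<lambda>u. \<bar>f u\<bar>) ` set us)"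
  have "m \<in> (\<lambda>u. \<bar>f u\<bar>) ` set us" unfolding m_def using assms(1) by (intro Max_in) auto
  then obtain v where v: "v \<in> set us" "m = \<bar>f v\<bar>" by blast
  have le: "\<bar>f u\<bar> \<le> m" if "u \<in> set us" for u unfolding m_def using that by (intro Max_ge) auto
  have prod: "\<bar>\<Prod>u\<leftarrow>ws. f u\<bar> \<le> m ^ length ws" if "set ws \<subseteq> set us" for ws
    using that by (induction ws) (use le v in \<open>auto simp: abs_mult intro!: mult_mono\<close>)
  have "\<bar>\<Prod>u\<leftarrow>us. f u\<bar> powr q \<le> (m ^ length us) powr q"
    using prod[of us] assms by (intro powr_mono2) auto
  also have "\<dots> = \<bar>f v\<bar> powr (real (length us) * q)"
  proof (cases "m = 0")
    case False
    then have "m > 0" using v by simp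
    then show ?thesis using v by (simp add: powr_realpow[symmetric] powr_powr)
  qed (use v assms in simp)
  also have "\<dots> \<le> (\<Sum>u\<leftarrow>us. \<bar>f u\<bar> powr (real (length us) * q))"
    using v(1) by (intro member_le_sum_list) auto
  finally show ?thesis .
qed

lemma powr_le_one_plus_powr:
  fixes x :: real
  assumes "0 \<le> q" "q \<le> p"
  shows "\<bar>x\<bar> powr q \<le> 1 + \<bar>x\<bar> powr p"
proof (cases "\<bar>x\<bar> \<le> 1")
  case True
  then have "\<bar>x\<bar> powr q \<le> 1" using powr_mono2[OF assms(1), of "\<bar>x\<bar>" 1] by simp
  then show ?thesis by (simp add: add_increasing2)
next
  case False
  then have "\<bar>x\<bar> powr q \<le> \<bar>x\<bar> powr p" by (intro powr_mono assms) auto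
  then show ?thesis by linarith
qed

lemma L1conv_sum_list:
  assumes "\<And>u. u \<in> set us \<Longrightarrow> L1conv M (f u) (g u)"
  shows "L1conv M (\<lambda>j x. \<Sum>u\<leftarrow>us. f u j x) (\<lambda>x. \<Sum>u\<leftarrow>us. g u x)"
  using assms by (induction us) (auto intro!: L1conv_add L1conv_const)

lemma Lpconv_sum_list:
  assumes "0 < p" "\<And>u. u \<in> set us \<Longrightarrow> Lpconv M p (f u) (g u)"
  shows "Lpconv M p (\<lambda>j x. \<Sum>u\<leftarrow>us. f u j x) (\<lambda>x. \<Sum>u\<leftarrow>us. g u x)"
  using assms(2) by (induction us) (auto intro!: Lpconv_add assms(1) Lpconv_const Lspace_zero)

lemma tendsto_prod_list:
  fixes f :: "'b \<Rightarrow> 'c \<Rightarrow> real"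
  assumes "\<And>u. u \<in> set us \<Longrightarrow> (f u \<longlongrightarrow> l u) F"
  shows "((\<lambda>j. \<Prod>u\<leftarrow>us. f u j) \<longlongrightarrow> (\<Prod>u\<leftarrow>us. l u)) F"
  using assms by (induction us) (auto intro!: tendsto_mult)

lemma borel_measurable_prod_list:
  fixes f :: "'b \<Rightarrow> 'c \<Rightarrow> real"
  assumes "\<And>u. u \<in> set us \<Longrightarrow> f u \<in> borel_measurable M"
  shows "(\<lambda>x. \<Prod>u\<leftarrow>us. f u x) \<in> borel_measurable M"
  using assms by (induction us) (auto intro!: borel_measurable_times)

lemma fdb_term_Lpconv:
  fixes c :: "nat \<Rightarrow> real ^ 'n \<Rightarrow> real" and a :: "('n \<Rightarrow> nat) \<Rightarrow> real ^ 'n \<Rightarrow> real"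
  assumes t: "0 < t" "t \<le> 2" and k: "2 \<le> k" "real k - 1 \<le> p" and q: "q = (p + 1) / real k"
    and c: "\<And>j. all_derivs (c j) (\<Gamma> j)" "\<And>j. \<exists>R. supp_in R (c j)"
    and conv: "\<And>u. mi_order u \<le> k \<Longrightarrow> Lpconv (rho_measure t) p (\<lambda>j. \<Gamma> j u) (a u)"
    and lim: "\<And>u. mi_order u \<le> k \<Longrightarrow> AE x in rho_measure t. (\<lambda>j. \<Gamma> j u x) \<longlonglongrightarrow> a u x"
    and us: "us \<in> set (fdb is)" and len: "length is \<le> k"
  shows "Lpconv (rho_measure t) q (\<lambda>j. fdb_term us (\<Gamma> j)) (fdb_term us a)"
proof -
  let ?M = "rho_measure t :: (real ^ 'n) measure"
  have p: "1 \<le> p" using k by linarith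
  have kq: "real k * q = p + 1" using k(1) q by simp
  have q_pos: "0 < q" using q p k(1) by simp
  have q1: "q \<ge> 1" using k by (simp add: q le_divide_eq)
  \<comment> \<open>For m \<le> k - 1 the exponent m q is at most (k - 1) q = p + 1 - q, and q \<ge>
    1 turns this into p.\<close>
  have mq: "real m * q \<le> p" if "m < k" for m :: nat
  proof -
    have "real m * q \<le> (real k - 1) * q" using that q_pos by (intro mult_right_mono) auto
    also have "\<dots> = p + 1 - q" using kq by (simp add: algebra_simps)
    finally show ?thesis using q1 by simp
  qed
  have qp: "q \<le> p" using mq[of 1] k by simp
  have const: "L1conv ?M (\<lambda>_ _. b) (\<lambda>_. b)" for b :: real
    using integrable_rho_measure_jp'(2)[OF t] by (rule L1conv_const)
  have powr_conv: "L1conv ?M (\<lambda>j x. \<bar>\<Gamma> j u x\<bar> powr p) (\<lambda>x. \<bar>a u x\<bar> powr p)" if "mi_order u \<le> k" for u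
    using p by (intro Lpconv_imp_L1conv_powr conv lim that) auto
  have ord: "mi_order u \<le> k" if "u \<in> set us" for u
    using fdb_length(2)[OF us that] len by simp
  have meas: "\<Gamma> j u \<in> borel_measurable ?M" "mi_order u \<le> k \<Longrightarrow> a u \<in> borel_measurable ?M" for j u
    using all_derivs_measurable(2)[OF c(1)] LspaceD(1)[OF LpconvD(2)[OF conv]] by (auto simp: measurable_rho_measure)
  have AE_us: "AE x in ?M. \<forall>u\<in>insert (\<lambda>_. 0) (set us). (\<lambda>j. \<Gamma> j u x) \<longlonglongrightarrow> a u x"
    by (rule AE_finite_allI) (use lim ord in auto)
  have isC: "isCont (psi_deriv n) v" for n v
    using continuous_psi_deriv[of UNIV n] by (simp add: continuous_on_eq_continuous_at)
  have "\<exists>G g. L1conv ?M G g \<and> (\<forall>j x. \<bar>fdb_term us (\<Gamma> j) x\<bar> powr q \<le> G j x)"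
  proof -
    \<comment> \<open>The empty list stands for \<psi>(a) itself, which is unbounded but of linear
      growth. Below length k boundedness of the derivative of \<psi> suffices; at length k \<ge> 2
      the factor \<psi>'' is needed.\<close>
    consider "us = []" | "us \<noteq> []" "length us < k" | "us \<noteq> []" "length us = k"
      using fdb_length(1)[OF us] len by linarith
    then show ?thesis
    proof cases
      case 1
      have "L1conv ?M (\<lambda>j x. 2 powr q * (psi 0 powr q + (1 + \<bar>\<Gamma> j (\<lambda>_. 0) x\<bar> powr p)))
          (\<lambda>x. 2 powr q * (psi 0 powr q + (1 + \<bar>a (\<lambda>_. 0) x\<bar> powr p)))"
        by (intro L1conv_cmult L1conv_add const powr_conv) simp
      moreover have "\<bar>psi v\<bar> powr q \<le> 2 powr q * (psi 0 powr q + (1 + \<bar>v\<bar> powr p))" for v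
      proof -
        have "\<bar>psi v\<bar> powr q \<le> (psi 0 + \<bar>v\<bar>) powr q" using q_pos psi_abs_le by (intro powr_mono2) auto
        also have "\<dots> \<le> 2 powr q * (psi 0 powr q + \<bar>v\<bar> powr q)"
          using q_pos psi_pos[of 0] by (intro powr_add_le) auto
        also have "\<dots> \<le> 2 powr q * (psi 0 powr q + (1 + \<bar>v\<bar> powr p))"
          using q_pos qp by (intro mult_left_mono add_left_mono powr_le_one_plus_powr) auto
        finally show ?thesis .
      qed
      ultimately show ?thesis using 1 by (auto simp: fdb_term_def)
    next
      case 2
      then obtain m where m: "length us = Suc m" by (cases us) auto
      obtain K where K: "K > 0" "\<And>v. \<bar>psi_deriv (length us) v\<bar> \<le> K"
        unfolding m using psi_deriv_Suc_bounded by blast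
      have "L1conv ?M (\<lambda>j x. K powr q * (\<Sum>u\<leftarrow>us. 1 + \<bar>\<Gamma> j u x\<bar> powr p)) (\<lambda>x. K powr q * (\<Sum>u\<leftarrow>us. 1 + \<bar>a u x\<bar> powr p))"
        by (intro L1conv_cmult L1conv_sum_list L1conv_add const powr_conv ord)
      moreover have "\<bar>fdb_term us (\<Gamma> j) x\<bar> powr q \<le> K powr q * (\<Sum>u\<leftarrow>us. 1 + \<bar>\<Gamma> j u x\<bar> powr p)" for j x
      proof -
        have "\<bar>fdb_term us (\<Gamma> j) x\<bar> powr q
            = \<bar>psi_deriv (length us) (\<Gamma> j (\<lambda>_. 0) x)\<bar> powr q * \<bar>\<Prod>u\<leftarrow>us. \<Gamma> j u x\<bar> powr q"
          by (simp only: fdb_term_def abs_mult powr_mult abs_ge_zero)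
        also have "\<dots> \<le> K powr q * (\<Sum>u\<leftarrow>us. \<bar>\<Gamma> j u x\<bar> powr (real (length us) * q))"
          using q_pos K 2(1) by (intro mult_mono powr_mono2 prod_list_powr_le) auto
        also have "\<dots> \<le> K powr q * (\<Sum>u\<leftarrow>us. 1 + \<bar>\<Gamma> j u x\<bar> powr p)"
          using q_pos mq[OF 2(2)] by (intro mult_left_mono sum_list_mono powr_le_one_plus_powr) auto
        finally show ?thesis .
      qed
      ultimately show ?thesis by blast
    next
      case 3
      then have lenk: "length us = length is" using fdb_length(1)[OF us] len by simp
      obtain K where K: "K > 0" "\<And>v. \<bar>psi_deriv (length us) v\<bar> \<le> K * psi_deriv 2 v"
        using psi_deriv_le_psi_deriv_2[of "length us"] 3 k(1) by metis
      let ?T = "\<lambda>A u x. psi_deriv 2 (A (\<lambda>_. 0) x) * A u x * (A u x * jp (p - 1) (A u x))"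
      have "L1conv ?M (\<lambda>j x. ?T (\<Gamma> j) u x) (?T a u)" if u: "u \<in> set us" for u
      proof -
        obtain i where i: "u = mi_inc i (\<lambda>_. 0)" using fdb_length(3)[OF us lenk u] by blast
        \<comment> \<open>The second derivative in direction i has order 2 \<le> k, so its
          convergence is among the hypotheses.\<close>
        have o: "mi_order u \<le> k" "mi_order (mi_inc i u) \<le> k" using i k(1) by auto
        have "L1conv ?M (\<lambda>j x. psi_deriv 2 (c j x) * \<Gamma> j u x * (\<Gamma> j u x * jp (p - 1) (\<Gamma> j u x))) (?T a u)"
          using L1conv_psi_deriv_2[where i=i and yl="a u" and zl="a (mi_inc i u)" and cl="a (\<lambda>_. 0)", OF t p c] conv[OF o(1)] conv[OF o(2)]
            lim[OF o(1)] lim[OF o(2)] lim[of "\<lambda>_. 0"] meas(2)[of "\<lambda>_. 0"] all_derivsD(1)[OF c(1)] i by simp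
        then show ?thesis by (simp add: all_derivsD(1)[OF c(1)])
      qed
      then have "L1conv ?M (\<lambda>j x. K powr q * (\<Sum>u\<leftarrow>us. ?T (\<Gamma> j) u x)) (\<lambda>x. K powr q * (\<Sum>u\<leftarrow>us. ?T a u x))"
        by (intro L1conv_cmult L1conv_sum_list)
      moreover have "\<bar>fdb_term us (\<Gamma> j) x\<bar> powr q \<le> K powr q * (\<Sum>u\<leftarrow>us. ?T (\<Gamma> j) u x)" for j x
      proof -
        let ?d = "psi_deriv 2 (\<Gamma> j (\<lambda>_. 0) x)"
        have d: "0 \<le> ?d" "?d \<le> 1" by (rule psi_deriv_2_bounds)+
        \<comment> \<open>As 0 \<le> \<psi>'' \<le> 1 and q \<ge> 1, raising to the power q leaves a
          single factor \<psi>'', just what \<open>L1conv_psi_deriv_2\<close> controls.\<close>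
        have "?d powr q \<le> ?d" using powr_mono'[OF q1 d] d by simp
        have "\<bar>psi_deriv (length us) (\<Gamma> j (\<lambda>_. 0) x)\<bar> powr q \<le> (K * ?d) powr q"
          using q_pos K by (intro powr_mono2) auto
        also have "\<dots> = K powr q * ?d powr q" using K d by (simp add: powr_mult)
        also have "\<dots> \<le> K powr q * ?d" using \<open>?d powr q \<le> ?d\<close> by (intro mult_left_mono) auto
        finally have le: "\<bar>psi_deriv (length us) (\<Gamma> j (\<lambda>_. 0) x)\<bar> powr q \<le> K powr q * ?d" .
        have "\<bar>fdb_term us (\<Gamma> j) x\<bar> powr q
            = \<bar>psi_deriv (length us) (\<Gamma> j (\<lambda>_. 0) x)\<bar> powr q * \<bar>\<Prod>u\<leftarrow>us. \<Gamma> j u x\<bar> powr q"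
          by (simp only: fdb_term_def abs_mult powr_mult abs_ge_zero)
        also have "\<dots> \<le> (K powr q * ?d) * (\<Sum>u\<leftarrow>us. \<bar>\<Gamma> j u x\<bar> powr (real (length us) * q))"
          using q_pos 3(1) d by (intro mult_mono le prod_list_powr_le mult_nonneg_nonneg) auto
        also have "\<dots> \<le> (K powr q * ?d) * (\<Sum>u\<leftarrow>us. \<Gamma> j u x * (\<Gamma> j u x * jp (p - 1) (\<Gamma> j u x)))"
          using powr_Suc_le_mult_jp[OF p] d unfolding 3(2) kq
          by (intro mult_left_mono sum_list_mono mult_nonneg_nonneg) auto
        also have "\<dots> = K powr q * (\<Sum>u\<leftarrow>us. ?T (\<Gamma> j) u x)"
          by (simp only: mult.assoc sum_list_const_mult)
        finally show ?thesis .
      qed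
      ultimately show ?thesis by blast
    qed
  qed
  then obtain G g where G: "L1conv ?M G g" "\<And>j x. \<bar>fdb_term us (\<Gamma> j) x\<bar> powr q \<le> G j x" by blast
  show ?thesis
  proof (rule Lpconv_dominated[OF q_pos G(1)])
    show "AE x in ?M. \<bar>fdb_term us (\<Gamma> j) x\<bar> powr q \<le> G j x" for j using G(2) by simp
    show "AE x in ?M. (\<lambda>j. fdb_term us (\<Gamma> j) x) \<longlonglongrightarrow> fdb_term us a x"
      using AE_us
    proof eventually_elim
      case (elim x)
      then show ?case unfolding fdb_term_def
        by (intro tendsto_mult isCont_tendsto_compose[OF isC] tendsto_prod_list) auto
    qed
    show "fdb_term us (\<Gamma> j) \<in> borel_measurable ?M" for j
      unfolding fdb_term_def[abs_def]
      by (intro borel_measurable_times measurable_compose[OF _ psi_deriv_measurable] borel_measurable_prod_list meas)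
    show "fdb_term us a \<in> borel_measurable ?M"
      unfolding fdb_term_def[abs_def]
      by (intro borel_measurable_times measurable_compose[OF _ psi_deriv_measurable] borel_measurable_prod_list meas(2)) (use ord in auto)
  qed
qed

lemma fdb_sum_Lpconv:
  fixes c :: "nat \<Rightarrow> real ^ 'n \<Rightarrow> real" and a :: "('n \<Rightarrow> nat) \<Rightarrow> real ^ 'n \<Rightarrow> real"
  assumes "0 < t" "t \<le> 2" "2 \<le> k" "real k - 1 \<le> p" "q = (p + 1) / real k"
    and "\<And>j. all_derivs (c j) (\<Gamma> j)" "\<And>j. \<exists>R. supp_in R (c j)"
    and "\<And>u. mi_order u \<le> k \<Longrightarrow> Lpconv (rho_measure t) p (\<lambda>j. \<Gamma> j u) (a u)"
    and "\<And>u. mi_order u \<le> k \<Longrightarrow> AE x in rho_measure t. (\<lambda>j. \<Gamma> j u x) \<longlonglongrightarrow> a u x"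
    and "length is \<le> k"
  shows "Lpconv (rho_measure t) q (\<lambda>j. fdb_sum is (\<Gamma> j)) (fdb_sum is a)"
  unfolding fdb_sum_def[abs_def]
  by (intro Lpconv_sum_list fdb_term_Lpconv[OF assms(1-9) _ assms(10)])
    (use assms(3-5) in auto)

section \<open>Superposition on the weighted Sobolev space\<close>

text \<open>Weak derivatives exist only up to null sets, so a version of each is fixed once. At
  order 0 it is \<open>a\<close> itself, everywhere, so that the chain rule terms evaluate \<psi>
  and its derivatives at \<open>a\<close>.\<close>

definition sobolev_family ::
  "(real ^ 'n) measure \<Rightarrow> nat \<Rightarrow> real \<Rightarrow> (real ^ 'n \<Rightarrow> real) \<Rightarrow> (('n \<Rightarrow> nat) \<Rightarrow> real ^ 'n \<Rightarrow> real) \<Rightarrow> bool" where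
  "sobolev_family M k p a A \<longleftrightarrow> A (\<lambda>_. 0) = a \<and>
     (\<forall>u. mi_order u \<le> k \<longrightarrow> A u \<in> Lspace M p \<and> has_weak_deriv a u (A u))"

lemma sobolev_familyD:
  assumes "sobolev_family M k p a A"
  shows "A (\<lambda>_. 0) = a" "mi_order u \<le> k \<Longrightarrow> A u \<in> Lspace M p" "mi_order u \<le> k \<Longrightarrow> has_weak_deriv a u (A u)"
  using assms by (auto simp: sobolev_family_def)

lemma Lspace_rho_locally_integrable_1:
  fixes f :: "real ^ 'n \<Rightarrow> real"
  assumes "1 \<le> p" "f \<in> Lspace (rho_measure t) p"
  shows "locally_integrable f"
  by (rule locally_integrable_powr_imp[OF assms(1) _ Lspace_rho_locally_integrable[OF assms(2)]])
    (use LspaceD(1)[OF assms(2)] in \<open>simp add: measurable_rho_measure\<close>)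

lemma has_weak_deriv_zero:
  "locally_integrable a \<Longrightarrow> has_weak_deriv a (\<lambda>_. 0) a"
  by (auto simp: has_weak_deriv_iff all_derivsD(1))

lemma sobolev_family_exists:
  fixes a :: "real ^ 'n \<Rightarrow> real"
  assumes p: "1 \<le> p" and a: "a \<in> sobolev (rho_measure t) k p"
  obtains A where "sobolev_family (rho_measure t) k p a A"
proof -
  let ?M = "rho_measure t :: (real ^ 'n) measure"
  have aL: "a \<in> Lspace ?M p" using a by (simp add: sobolev_def)
  have "\<exists>v. (s = (\<lambda>_. 0) \<longrightarrow> v = a) \<and> (mi_order s \<le> k \<longrightarrow> v \<in> Lspace ?M p \<and> has_weak_deriv a s v)" for s :: "'n \<Rightarrow> nat"
  proof (cases "s = (\<lambda>_. 0)")
    case True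
    then show ?thesis using aL has_weak_deriv_zero[OF Lspace_rho_locally_integrable_1[OF p aL]] by auto
  next
    case False
    then have "1 \<le> mi_order s" using mi_order_eq_0[of s] by simp
    then show ?thesis using a False by (auto simp: sobolev_def)
  qed
  then obtain A where "\<And>s. (s = (\<lambda>_. 0) \<longrightarrow> A s = a) \<and> (mi_order s \<le> k \<longrightarrow> A s \<in> Lspace ?M p \<and> has_weak_deriv a s (A s))"
    by metis
  then show ?thesis by (intro that[of A]) (auto simp: sobolev_family_def)
qed

lemma inverse_Suc_tendsto_0: "(\<lambda>j. 1 / real (Suc j)) \<longlonglongrightarrow> 0"
  using LIMSEQ_inverse_real_of_nat by (simp add: inverse_eq_divide)

lemma sobolev_family_approx:
  fixes a :: "real ^ 'n \<Rightarrow> real"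
  assumes p: "1 \<le> p" and A: "sobolev_family (rho_measure t) k p a A"
  obtains c \<Gamma> where "\<And>j. all_derivs (c j) (\<Gamma> j)" "\<And>j. \<exists>R. supp_in R (c j)"
    "\<And>u. mi_order u \<le> k \<Longrightarrow> Lpconv (rho_measure t) p (\<lambda>j. \<Gamma> j u) (A u)"
    "\<And>u. mi_order u \<le> k \<Longrightarrow> AE x in rho_measure t. (\<lambda>j. \<Gamma> j u x) \<longlonglongrightarrow> A u x"
proof -
  let ?M = "rho_measure t :: (real ^ 'n) measure"
  note A0 = sobolev_familyD(1)[OF A]
  define close where "close j c \<Gamma> \<longleftrightarrow> all_derivs c \<Gamma> \<and> (\<exists>R. supp_in R c) \<and> (\<forall>u. mi_order u \<le> k \<longrightarrow> \<Gamma> u \<in> Lspace ?M p \<and>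
      (LINT x|?M. \<bar>\<Gamma> u x - A u x\<bar> powr p) < 1 / real (Suc j))" for j c \<Gamma>
  have "\<exists>c \<Gamma>. close j c \<Gamma>" for j
  proof -
    obtain c \<Gamma> R where "all_derivs c \<Gamma>" "supp_in R c" "\<And>u. mi_order u \<le> k \<Longrightarrow> \<Gamma> u \<in> Lspace ?M p"
      "\<And>u. mi_order u \<le> k \<Longrightarrow> (LINT x|?M. \<bar>\<Gamma> u x - A u x\<bar> powr p) < 1 / real (Suc j)"
      by (rule test_functions_dense[of p k A t "1 / real (Suc j)"])
        (use p sobolev_familyD[OF A] A0 in auto)
    then show ?thesis unfolding close_def by blast
  qed
  then obtain c \<Gamma> where "\<And>j. close j (c j) (\<Gamma> j)" by metis
  then have c: "\<And>j. all_derivs (c j) (\<Gamma> j)" "\<And>j. \<exists>R. supp_in R (c j)"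
    "\<And>j u. mi_order u \<le> k \<Longrightarrow> \<Gamma> j u \<in> Lspace ?M p"
    "\<And>j u. mi_order u \<le> k \<Longrightarrow> (LINT x|?M. \<bar>\<Gamma> j u x - A u x\<bar> powr p) < 1 / real (Suc j)"
    unfolding close_def by blast+
  have conv: "Lpconv ?M p (\<lambda>j. \<Gamma> j u) (A u)" if u: "mi_order u \<le> k" for u
    unfolding Lpconv_def
  proof (intro conjI allI)
    show "(\<lambda>j. LINT x|?M. \<bar>\<Gamma> j u x - A u x\<bar> powr p) \<longlonglongrightarrow> 0"
      by (rule tendsto_sandwich[OF _ _ tendsto_const inverse_Suc_tendsto_0])
        (use c(4)[OF u] in \<open>auto simp: less_imp_le\<close>)
  qed (use c(3) sobolev_familyD(2)[OF A] u in auto)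
  have p0: "0 < p" using p by simp
  have conv': "Lpconv ?M p (\<lambda>j. \<Gamma> j u) (A u)" if "u \<in> {u. mi_order u \<le> k}" for u
    using conv that by simp
  obtain r where r: "strict_mono r"
    "\<And>u. u \<in> {u. mi_order u \<le> k} \<Longrightarrow> AE x in ?M. (\<lambda>j. \<Gamma> (r j) u x) \<longlonglongrightarrow> A u x"
    by (rule Lpconv_AE_subseq_finite) (rule finite_mi_order_le, rule p0, erule conv', rule that)
  show ?thesis
  proof (rule that[of "\<lambda>j. c (r j)" "\<lambda>j. \<Gamma> (r j)"])
    show "Lpconv ?M p (\<lambda>j. \<Gamma> (r j) u) (A u)" if "mi_order u \<le> k" for u
      by (rule Lpconv_subseq[OF conv[OF that] r(1)])
  qed (use c r in auto)
qed

text \<open>Pairing with \<phi> for Lebesgue measure is pairing with \<phi>/\<rho> for the weighted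
  measure, and \<phi>/\<rho> is still bounded since \<rho> is continuous and positive.\<close>

lemma Lpconv_tested:
  fixes F :: "real ^ 'n \<Rightarrow> real"
  assumes t: "0 < t" "t \<le> 2" and q: "1 \<le> q" and f: "Lpconv (rho_measure t) q f F"
    and lim: "AE x in rho_measure t. (\<lambda>j. f j x) \<longlonglongrightarrow> F x"
    and \<phi>: "continuous_on UNIV \<phi>" "supp_in R \<phi>"
  shows "(\<lambda>j. LINT x|lebesgue. f j x * \<phi> x) \<longlonglongrightarrow> (LINT x|lebesgue. F x * \<phi> x)"
proof -
  let ?M = "rho_measure t :: (real ^ 'n) measure"
  have q0: "0 < q" using q by simp
  have cont: "continuous_on UNIV (\<lambda>x. \<phi> x / rho t x)"
    by (intro continuous_intros \<phi> rho_continuous ballI less_imp_neq[OF rho_pos, symmetric])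
  have supp: "supp_in R (\<lambda>x. \<phi> x / rho t x)" using \<phi>(2) by (auto simp: supp_in_def)
  obtain B where B: "B > 0" "\<And>x. \<bar>\<phi> x / rho t x\<bar> \<le> B" using continuous_supp_in_bounded[OF cont supp] by blast
  have m\<phi>: "(\<lambda>x. \<phi> x / rho t x) \<in> borel_measurable ?M"
    unfolding measurable_rho_measure using borel_measurable_continuous_onI[OF cont]
    by (intro measurable_completion) simp
  have m: "f j \<in> borel_measurable ?M" "F \<in> borel_measurable ?M" for j
    using LspaceD(1)[OF LpconvD(1)[OF f]] LspaceD(1)[OF LpconvD(2)[OF f]] by auto
  have eq: "(LINT x|?M. h x * (\<phi> x / rho t x)) = (LINT x|lebesgue. h x * \<phi> x)" if "h \<in> borel_measurable ?M" for h
  proof -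
    have "(\<lambda>x. h x * (\<phi> x / rho t x)) \<in> borel_measurable lebesgue"
      using borel_measurable_times[OF that m\<phi>] by (simp add: measurable_rho_measure)
    moreover have "rho t x \<noteq> 0" for x :: "real ^ 'n" by (rule less_imp_neq[OF rho_pos, symmetric])
    ultimately show ?thesis by (simp add: integral_rho_measure)
  qed
  have "L1conv ?M (\<lambda>j x. f j x * (\<phi> x / rho t x)) (\<lambda>x. F x * (\<phi> x / rho t x))"
  proof (rule L1conv_dominated)
    show "L1conv ?M (\<lambda>j x. B * (1 + \<bar>f j x\<bar> powr q)) (\<lambda>x. B * (1 + \<bar>F x\<bar> powr q))"
      by (intro L1conv_cmult L1conv_add L1conv_const integrable_rho_measure_jp'(2)[OF t]
          Lpconv_imp_L1conv_powr[OF q0 f lim])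
    show "(\<lambda>x. f j x * (\<phi> x / rho t x)) \<in> borel_measurable ?M" "(\<lambda>x. F x * (\<phi> x / rho t x)) \<in> borel_measurable ?M" for j
      by (intro borel_measurable_times m m\<phi>)+
    show "AE x in ?M. (\<lambda>j. f j x * (\<phi> x / rho t x)) \<longlonglongrightarrow> F x * (\<phi> x / rho t x)"
      using lim by eventually_elim (intro tendsto_mult tendsto_const)
    show "AE x in ?M. \<bar>f j x * (\<phi> x / rho t x)\<bar> \<le> B * (1 + \<bar>f j x\<bar> powr q)" for j
    proof (rule AE_I2)
      fix x
      have "\<bar>f j x * (\<phi> x / rho t x)\<bar> \<le> (1 + \<bar>f j x\<bar> powr q) * B"
        unfolding abs_mult[of "f j x"] by (intro mult_mono abs_le_one_plus_powr q B) auto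
      then show "\<bar>f j x * (\<phi> x / rho t x)\<bar> \<le> B * (1 + \<bar>f j x\<bar> powr q)" by (simp only: mult.commute)
    qed
  qed
  from L1conv_integral[OF this] show ?thesis by (simp only: eq m)
qed

context
  fixes t p q :: real and k :: nat
  assumes t: "0 < t" "t \<le> 2" and k: "2 \<le> k" "real k - 1 \<le> p" and q: "q = (p + 1) / real k"
begin

lemma p_ge_1: "1 \<le> p" using k by linarith

lemma q_ge_1: "1 \<le> q" using k by (simp add: q le_divide_eq)

lemma psi_chain_rule:
  fixes a :: "real ^ 'n \<Rightarrow> real" and "is" :: "'n list"
  assumes A: "sobolev_family (rho_measure t) k p a A" and len: "length is \<le> k"
  shows "fdb_sum is A \<in> Lspace (rho_measure t) q" "has_weak_deriv (\<lambda>x. psi (a x)) (mi_of is) (fdb_sum is A)"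
proof -
  let ?M = "rho_measure t :: (real ^ 'n) measure"
  have q0: "0 < q" using q_ge_1 by simp
  obtain c \<Gamma> where c: "\<And>j. all_derivs (c j) (\<Gamma> j)" "\<And>j. \<exists>R. supp_in R (c j)"
    "\<And>u. mi_order u \<le> k \<Longrightarrow> Lpconv ?M p (\<lambda>j. \<Gamma> j u) (A u)"
    "\<And>u. mi_order u \<le> k \<Longrightarrow> AE x in ?M. (\<lambda>j. \<Gamma> j u x) \<longlonglongrightarrow> A u x"
    by (rule sobolev_family_approx[OF p_ge_1 A]) (rule that)
  have conv: "Lpconv ?M q (\<lambda>j. fdb_sum js (\<Gamma> j)) (fdb_sum js A)" if "length js \<le> k" for js
    by (rule fdb_sum_Lpconv[OF t k q c that])
  \<comment> \<open>The weak formulation has \<psi>(c) on one side, coded by the empty list, and the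
    chain rule sum on the other; both must converge a.e. along one subsequence.\<close>
  have fin: "finite {[], is}" by simp
  have conv': "Lpconv ?M q (\<lambda>j. fdb_sum js (\<Gamma> j)) (fdb_sum js A)" if "js \<in> {[], is}" for js
    using that len by (intro conv) auto
  obtain r where r: "strict_mono r"
    "\<And>js. js \<in> {[], is} \<Longrightarrow> AE x in ?M. (\<lambda>j. fdb_sum js (\<Gamma> (r j)) x) \<longlonglongrightarrow> fdb_sum js A x"
    by (rule Lpconv_AE_subseq_finite) (rule fin, rule q0, erule conv', rule that)
  have psi_a: "fdb_sum [] A = (\<lambda>x. psi (a x))"
    by (simp add: fdb_sum_def[abs_def] fdb_term_def sobolev_familyD(1)[OF A])
  have psi_c: "fdb_sum [] (\<Gamma> j) = (\<lambda>x. psi (c j x))" for j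
    by (simp add: fdb_sum_def[abs_def] fdb_term_def all_derivsD(1)[OF c(1)])
  show L: "fdb_sum is A \<in> Lspace ?M q" using LpconvD(2)[OF conv[OF len]] .
  have L0: "(\<lambda>x. psi (a x)) \<in> Lspace ?M q" using LpconvD(2)[OF conv[of "[]"]] by (simp add: psi_a)
  show "has_weak_deriv (\<lambda>x. psi (a x)) (mi_of is) (fdb_sum is A)"
    unfolding has_weak_deriv_iff
  proof (intro conjI allI impI)
    show "locally_integrable (\<lambda>x. psi (a x))" "locally_integrable (fdb_sum is A)"
      by (rule Lspace_rho_locally_integrable_1[OF q_ge_1 L0], rule Lspace_rho_locally_integrable_1[OF q_ge_1 L])
    fix \<phi> :: "real ^ 'n \<Rightarrow> real" and \<Phi> R assume \<phi>: "all_derivs \<phi> \<Phi>" and R: "supp_in R \<phi>"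
    have cont\<phi>: "continuous_on UNIV \<phi>"
      using all_derivs_continuous[OF \<phi>, of UNIV "\<lambda>_. 0"] by (simp add: all_derivsD(1)[OF \<phi>])
    have sub: "Lpconv ?M q (\<lambda>j. fdb_sum js (\<Gamma> (r j))) (fdb_sum js A)" if "length js \<le> k" for js
      by (rule Lpconv_subseq[OF conv[OF that] r(1)])
    have eqn: "(LINT x|lebesgue. fdb_sum [] (\<Gamma> (r j)) x * \<Phi> (mi_of is) x)
        = (- 1) ^ length is * (LINT x|lebesgue. fdb_sum is (\<Gamma> (r j)) x * \<phi> x)" for j
    proof -
      have [measurable]: "fdb_sum js (\<Gamma> (r j)) \<in> borel_measurable borel" for js
        by (intro borel_measurable_continuous_onI continuous_fdb_sum[OF c(1)])
      have pc: "psi (c (r j) x) = fdb_sum [] (\<Gamma> (r j)) x" for x by (simp add: psi_c)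
      have [measurable]: "\<Phi> s \<in> borel_measurable borel" "\<phi> \<in> borel_measurable borel" for s
        by (rule all_derivs_measurable[OF \<phi>], rule borel_measurable_continuous_onI[OF cont\<phi>])
      show ?thesis
        using fdb_sum_integral[OF c(1)[of "r j"] \<phi> R, of "is"] unfolding pc
        by (subst (1 2) lborel_integral_lebesgue) simp_all
    qed
    have l1: "(\<lambda>j. LINT x|lebesgue. fdb_sum [] (\<Gamma> (r j)) x * \<Phi> (mi_of is) x)
        \<longlonglongrightarrow> (LINT x|lebesgue. fdb_sum [] A x * \<Phi> (mi_of is) x)"
      by (rule Lpconv_tested[OF t q_ge_1 sub r(2) all_derivs_continuous[OF \<phi>] all_derivs_supp_in[OF \<phi> R]]) auto
    have l2: "(\<lambda>j. (- 1) ^ length is * (LINT x|lebesgue. fdb_sum is (\<Gamma> (r j)) x * \<phi> x))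
        \<longlonglongrightarrow> (- 1) ^ length is * (LINT x|lebesgue. fdb_sum is A x * \<phi> x)"
      by (intro tendsto_mult tendsto_const Lpconv_tested[OF t q_ge_1 sub[OF len] r(2) cont\<phi> R]) auto
    show "(LINT x|lebesgue. psi (a x) * \<Phi> (mi_of is) x)
        = (- 1) ^ mi_order (mi_of is) * (LINT x|lebesgue. fdb_sum is A x * \<phi> x)"
      using LIMSEQ_unique[OF l1[unfolded eqn] l2] by (simp only: psi_a mi_order_mi_of)
  qed
qed

lemma psi_in_sobolev:
  fixes a :: "real ^ 'n \<Rightarrow> real"
  assumes a: "a \<in> sobolev (rho_measure t) k p"
  shows "(\<lambda>x. psi (a x)) \<in> sobolev (rho_measure t) k q"
proof -
  obtain A where A: "sobolev_family (rho_measure t) k p a A"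
    using sobolev_family_exists[OF p_ge_1 a] by blast
  have "(\<lambda>x. psi (a x)) \<in> Lspace (rho_measure t) q"
    using psi_chain_rule(1)[OF A, of "[]"]
    by (simp add: fdb_sum_def[abs_def] fdb_term_def sobolev_familyD(1)[OF A])
  moreover have "\<exists>v \<in> Lspace (rho_measure t) q. has_weak_deriv (\<lambda>x. psi (a x)) s v" if s: "mi_order s \<le> k" for s
  proof -
    obtain "is" where "is": "mi_of is = s" using mi_of_exists by blast
    then have "length is \<le> k" using s mi_order_mi_of[of "is"] by simp
    with psi_chain_rule[OF A this] "is" show ?thesis by blast
  qed
  ultimately show ?thesis by (simp add: sobolev_def)
qed

end

section \<open>Continuity of the superposition operator\<close>

lemma has_weak_deriv_diff:
  fixes a b :: "real ^ 'n \<Rightarrow> real"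
  assumes a: "has_weak_deriv a s v" and b: "has_weak_deriv b s w"
  shows "has_weak_deriv (\<lambda>x. a x - b x) s (\<lambda>x. v x - w x)"
proof -
  have li: "locally_integrable (\<lambda>x. f x - g x)" if "locally_integrable f" "locally_integrable g" for f g :: "real ^ 'n \<Rightarrow> real"
  proof (rule locally_integrableI)
    fix R
    have "(\<lambda>x. indicator (cball 0 R) x * (f x - g x)) = (\<lambda>x. indicator (cball 0 R) x * f x - indicator (cball 0 R) x * g x)"
      by (simp add: algebra_simps)
    then show "integrable lebesgue (\<lambda>x. indicator (cball 0 R) x * (f x - g x))"
      using locally_integrableD[OF that(1)] locally_integrableD[OF that(2)] by simp
  qed
  have L: "locally_integrable a" "locally_integrable b" "locally_integrable v" "locally_integrable w"
    using a b by (auto simp: has_weak_deriv_def)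
  show ?thesis
    unfolding has_weak_deriv_iff
  proof (intro conjI allI impI li L)
    fix \<phi> :: "real ^ 'n \<Rightarrow> real" and \<Phi> R assume \<phi>: "all_derivs \<phi> \<Phi>" and R: "supp_in R \<phi>"
    have cont: "continuous_on UNIV (\<Phi> s)" for s by (rule all_derivs_continuous[OF \<phi>])
    have cont\<phi>: "continuous_on UNIV \<phi>" using cont[of "\<lambda>_. 0"] by (simp add: all_derivsD(1)[OF \<phi>])
    note int = locally_integrable_mult_continuous[OF _ cont all_derivs_supp_in[OF \<phi> R]]
      locally_integrable_mult_continuous[OF _ cont\<phi> R]
    have "(LINT x|lebesgue. (a x - b x) * \<Phi> s x) = (LINT x|lebesgue. a x * \<Phi> s x) - (LINT x|lebesgue. b x * \<Phi> s x)"
      using int(1)[OF L(1)] int(1)[OF L(2)] by (simp add: left_diff_distrib)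
    also have "\<dots> = (- 1) ^ mi_order s * (LINT x|lebesgue. v x * \<phi> x) - (- 1) ^ mi_order s * (LINT x|lebesgue. w x * \<phi> x)"
      using a[unfolded has_weak_deriv_iff, THEN conjunct2, THEN conjunct2, rule_format, OF \<phi> R]
        b[unfolded has_weak_deriv_iff, THEN conjunct2, THEN conjunct2, rule_format, OF \<phi> R] by simp
    also have "\<dots> = (- 1) ^ mi_order s * (LINT x|lebesgue. (v x - w x) * \<phi> x)"
      using int(2)[OF L(3)] int(2)[OF L(4)] by (simp add: left_diff_distrib right_diff_distrib)
    finally show "(LINT x|lebesgue. (a x - b x) * \<Phi> s x) = (- 1) ^ mi_order s * (LINT x|lebesgue. (v x - w x) * \<phi> x)" .
  qed
qed

text \<open>The norm is defined with arbitrarily chosen weak derivatives; a.e. uniqueness allows it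
  to be computed from any explicit ones. Only Lebesgue null sets matter, so the lemma covers both
  measures.\<close>

lemma sobolev_norm_eq:
  fixes a :: "real ^ 'n \<Rightarrow> real"
  assumes M: "sets M = sets lebesgue" "\<And>P. (AE x in lebesgue. P x) \<Longrightarrow> AE x in M. P x"
    and A: "\<And>u. mi_order u \<le> k \<Longrightarrow> has_weak_deriv a u (A u)"
  shows "sobolev_norm M k p a = (\<Sum>u | mi_order u \<le> k. LINT x|M. \<bar>A u x\<bar> powr p) powr (1 / p)"
proof -
  have "(LINT x|M. \<bar>weak_deriv u a x\<bar> powr p) = (LINT x|M. \<bar>A u x\<bar> powr p)" if u: "mi_order u \<le> k" for u
  proof (rule integral_cong_AE)
    have w: "has_weak_deriv a u (weak_deriv u a)" unfolding weak_deriv_def by (rule someI[where P="has_weak_deriv a u" and x="A u"]) (rule A[OF u])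
    have m: "weak_deriv u a \<in> borel_measurable M" "A u \<in> borel_measurable M"
      using w A[OF u] locally_integrable_measurable measurable_cong_sets[OF M(1) refl, of borel]
      by (auto simp: has_weak_deriv_def)
    then show "(\<lambda>x. \<bar>weak_deriv u a x\<bar> powr p) \<in> borel_measurable M" "(\<lambda>x. \<bar>A u x\<bar> powr p) \<in> borel_measurable M"
      by measurable
    show "AE x in M. \<bar>weak_deriv u a x\<bar> powr p = \<bar>A u x\<bar> powr p"
      using M(2)[OF has_weak_deriv_unique[OF w A[OF u]]] by eventually_elim simp
  qed
  then show ?thesis unfolding sobolev_norm_def by (intro arg_cong[where f="\<lambda>z. z powr (1 / p)"] sum.cong) auto
qed

lemma AE_rho_measureI: "(AE x in lebesgue. P x) \<Longrightarrow> AE x in rho_measure t. P x"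
  by (simp add: AE_rho_measure)

context
  fixes t p q :: real and k :: nat
  assumes t: "0 < t" "t \<le> 2" and k: "2 \<le> k" "real k - 1 \<le> p" and q: "q = (p + 1) / real k"
begin

text \<open>There are finitely many multi-indices and finitely many direction lists of length at
  most k, so one test function can be close to \<open>b\<close> both in its own derivatives and in
  those of its image under \<psi>.\<close>

lemma sobolev_family_close_test_function:
  fixes b :: "real ^ 'n \<Rightarrow> real"
  assumes B: "sobolev_family (rho_measure t) k p b B" and e: "0 < e"
  obtains c \<Gamma> where "all_derivs c \<Gamma>" "\<exists>R. supp_in R c"
    "\<And>u. mi_order u \<le> k \<Longrightarrow> \<Gamma> u \<in> Lspace (rho_measure t) p"
    "\<And>u. mi_order u \<le> k \<Longrightarrow> (LINT x|rho_measure t. \<bar>\<Gamma> u x - B u x\<bar> powr p) < e"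
    "\<And>is. length is \<le> k \<Longrightarrow> (LINT x|rho_measure t. \<bar>fdb_sum is B x - fdb_sum is \<Gamma> x\<bar> powr q) < e"
proof -
  let ?M = "rho_measure t :: (real ^ 'n) measure"
  obtain c \<Gamma> where c: "\<And>j. all_derivs (c j) (\<Gamma> j)" "\<And>j. \<exists>R. supp_in R (c j)"
    "\<And>u. mi_order u \<le> k \<Longrightarrow> Lpconv ?M p (\<lambda>j. \<Gamma> j u) (B u)"
    "\<And>u. mi_order u \<le> k \<Longrightarrow> AE x in ?M. (\<lambda>j. \<Gamma> j u x) \<longlonglongrightarrow> B u x"
    by (rule sobolev_family_approx[OF p_ge_1[OF t k q] B]) (rule that)
  note conv = fdb_sum_Lpconv[OF t k q c]
  have 1: "\<forall>\<^sub>F j in sequentially. \<forall>u\<in>{u. mi_order u \<le> k}. (LINT x|?M. \<bar>\<Gamma> j u x - B u x\<bar> powr p) < e"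
    by (intro eventually_ball_finite finite_mi_order_le) (use order_tendstoD(2)[OF LpconvD(3)[OF c(3)] e] in auto)
  have fin: "finite {is :: 'n list. length is \<le> k}"
    using finite_lists_length_le[of "UNIV :: 'n set" k] by simp
  have 2: "\<forall>\<^sub>F j in sequentially. \<forall>is\<in>{is. length is \<le> k}. (LINT x|?M. \<bar>fdb_sum is (\<Gamma> j) x - fdb_sum is B x\<bar> powr q) < e"
    by (intro eventually_ball_finite fin) (use order_tendstoD(2)[OF LpconvD(3)[OF conv] e] in auto)
  obtain j where j: "\<And>u. mi_order u \<le> k \<Longrightarrow> (LINT x|?M. \<bar>\<Gamma> j u x - B u x\<bar> powr p) < e"
    "\<And>is. length is \<le> k \<Longrightarrow> (LINT x|?M. \<bar>fdb_sum is (\<Gamma> j) x - fdb_sum is B x\<bar> powr q) < e"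
    using eventually_happens'[OF sequentially_bot eventually_conj[OF 1 2]] by auto
  show ?thesis
    by (rule that[OF c(1) c(2), of j]) (use j LpconvD(1)[OF c(3)] in \<open>auto simp: abs_minus_commute\<close>)
qed

text \<open>If continuity failed, some b j would tend to \<open>a\<close> with images at distance at
  least \<epsilon>. Replacing b j by test functions close before and after applying \<psi> gives
  test functions tending to \<open>a\<close>, to which the convergence of the chain rule terms
  applies; a subsequence suffices for the contradiction.\<close>

lemma psi_continuous_on_sobolev:
  fixes a :: "real ^ 'n \<Rightarrow> real"
  assumes a: "a \<in> sobolev (rho_measure t) k p" and \<epsilon>: "0 < \<epsilon>"
  shows "\<exists>\<delta>>0. \<forall>b \<in> sobolev (rho_measure t) k p.
    sobolev_norm (rho_measure t) k p (\<lambda>x. b x - a x) < \<delta> \<longrightarrow>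
    sobolev_norm (rho_measure t) k q (\<lambda>x. psi (b x) - psi (a x)) < \<epsilon>"
proof (rule ccontr)
  let ?M = "rho_measure t :: (real ^ 'n) measure"
  let ?U = "{u :: 'n \<Rightarrow> nat. mi_order u \<le> k}"
  have p: "0 < p" "1 \<le> p" and q0: "0 < q" using p_ge_1[OF t k q] q_ge_1[OF t k q] by auto
  assume "\<not> ?thesis"
  then have neg: "\<exists>b \<in> sobolev ?M k p. sobolev_norm ?M k p (\<lambda>x. b x - a x) < \<delta> \<and>
      \<not> sobolev_norm ?M k q (\<lambda>x. psi (b x) - psi (a x)) < \<epsilon>" if "0 < \<delta>" for \<delta>
    using that by blast
  have "\<exists>b \<in> sobolev ?M k p. sobolev_norm ?M k p (\<lambda>x. b x - a x) < 1 / real (Suc j) \<and>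
      \<not> sobolev_norm ?M k q (\<lambda>x. psi (b x) - psi (a x)) < \<epsilon>" for j
    by (rule neg) simp
  then obtain b where b: "\<And>j. b j \<in> sobolev ?M k p"
    "\<And>j. sobolev_norm ?M k p (\<lambda>x. b j x - a x) < 1 / real (Suc j)"
    "\<And>j. \<not> sobolev_norm ?M k q (\<lambda>x. psi (b j x) - psi (a x)) < \<epsilon>" by metis
  obtain A where A: "sobolev_family ?M k p a A" using sobolev_family_exists[OF p(2) a] by blast
  have "\<exists>B. sobolev_family ?M k p (b j) B" for j using sobolev_family_exists[OF p(2) b(1)] by metis
  then obtain B where B: "\<And>j. sobolev_family ?M k p (b j) (B j)" by metis
  have norm_p: "sobolev_norm ?M k p (\<lambda>x. b j x - a x) = (\<Sum>u\<in>?U. LINT x|?M. \<bar>B j u x - A u x\<bar> powr p) powr (1 / p)" for j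
    by (rule sobolev_norm_eq[OF sets_rho_measure AE_rho_measureI])
      (auto intro!: has_weak_deriv_diff sobolev_familyD(3)[OF A] sobolev_familyD(3)[OF B])
  have B_conv: "Lpconv ?M p (\<lambda>j. B j u) (A u)" if u: "mi_order u \<le> k" for u
    unfolding Lpconv_def
  proof (intro conjI allI sobolev_familyD(2)[OF A u] sobolev_familyD(2)[OF B u])
    have le: "(LINT x|?M. \<bar>B j u x - A u x\<bar> powr p) \<le> (1 / real (Suc j)) powr p" for j
    proof -
      let ?S = "\<Sum>u\<in>?U. LINT x|?M. \<bar>B j u x - A u x\<bar> powr p"
      have S: "0 \<le> ?S" by (intro sum_nonneg Bochner_Integration.integral_nonneg) auto
      have "(LINT x|?M. \<bar>B j u x - A u x\<bar> powr p) \<le> ?S"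
        using u by (intro member_le_sum finite_mi_order_le Bochner_Integration.integral_nonneg) auto
      also have "?S = (?S powr (1 / p)) powr p" using p S by (simp add: powr_powr)
      also have "\<dots> \<le> (1 / real (Suc j)) powr p"
        using b(2)[of j] p unfolding norm_p by (intro powr_mono2) auto
      finally show ?thesis .
    qed
    have lim: "(\<lambda>j. (1 / real (Suc j)) powr p) \<longlonglongrightarrow> 0"
      using tendsto_abs_powr_zero[OF p(1) inverse_Suc_tendsto_0] by simp
    show "(\<lambda>j. LINT x|?M. \<bar>B j u x - A u x\<bar> powr p) \<longlonglongrightarrow> 0"
      by (rule tendsto_sandwich[OF _ _ tendsto_const lim]) (use le in auto)
  qed
  define close where "close j c \<Gamma> \<longleftrightarrow> all_derivs c \<Gamma> \<and> (\<exists>R. supp_in R c) \<and> (\<forall>u. mi_order u \<le> k \<longrightarrow> \<Gamma> u \<in> Lspace ?M p \<and>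
      (LINT x|?M. \<bar>\<Gamma> u x - B j u x\<bar> powr p) < 1 / real (Suc j)) \<and>
      (\<forall>is. length is \<le> k \<longrightarrow> (LINT x|?M. \<bar>fdb_sum is (B j) x - fdb_sum is \<Gamma> x\<bar> powr q) < 1 / real (Suc j))" for j c \<Gamma>
  have "\<exists>c \<Gamma>. close j c \<Gamma>" for j
  proof -
    have "0 < 1 / real (Suc j)" by simp
    then show ?thesis
      by (rule sobolev_family_close_test_function[OF B[of j]]) (unfold close_def, blast)
  qed
  then obtain c \<Gamma> where "\<And>j. close j (c j) (\<Gamma> j)" by metis
  then have c: "\<And>j. all_derivs (c j) (\<Gamma> j)" "\<And>j. \<exists>R. supp_in R (c j)"
    "\<And>j u. mi_order u \<le> k \<Longrightarrow> \<Gamma> j u \<in> Lspace ?M p"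
    "\<And>j u. mi_order u \<le> k \<Longrightarrow> (LINT x|?M. \<bar>\<Gamma> j u x - B j u x\<bar> powr p) < 1 / real (Suc j)"
    "\<And>j is. length is \<le> k \<Longrightarrow> (LINT x|?M. \<bar>fdb_sum is (B j) x - fdb_sum is (\<Gamma> j) x\<bar> powr q) < 1 / real (Suc j)"
    unfolding close_def by blast+
  have small: "f \<longlonglongrightarrow> 0" if "\<And>j. 0 \<le> f j" "\<And>j. f j < 1 / real (Suc j)" for f :: "nat \<Rightarrow> real"
    by (rule tendsto_sandwich[OF _ _ tendsto_const inverse_Suc_tendsto_0]) (use that in \<open>auto simp: less_imp_le\<close>)
  have \<Gamma>_conv: "Lpconv ?M p (\<lambda>j. \<Gamma> j u) (A u)" if u: "mi_order u \<le> k" for u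
    by (rule Lpconv_triangle[OF p(1) B_conv[OF u] c(3)[OF u]]) (intro small c(4)[OF u] Bochner_Integration.integral_nonneg powr_ge_zero)
  have \<Gamma>_conv': "Lpconv ?M p (\<lambda>j. \<Gamma> j u) (A u)" if "u \<in> ?U" for u
    using \<Gamma>_conv that by simp
  obtain r where r: "strict_mono r" "\<And>u. u \<in> ?U \<Longrightarrow> AE x in ?M. (\<lambda>j. \<Gamma> (r j) u x) \<longlonglongrightarrow> A u x"
    by (rule Lpconv_AE_subseq_finite) (rule finite_mi_order_le, rule p(1), erule \<Gamma>_conv', rule that)
  have fdb_conv: "Lpconv ?M q (\<lambda>j. fdb_sum is (\<Gamma> (r j))) (fdb_sum is A)" if "length is \<le> k" for "is"
    by (rule fdb_sum_Lpconv[OF t k q c(1,2) _ _ that]) (use Lpconv_subseq[OF \<Gamma>_conv r(1)] r(2) in auto)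
  have fdb_B_conv: "Lpconv ?M q (\<lambda>j. fdb_sum is (B (r j))) (fdb_sum is A)" if len: "length is \<le> k" for "is"
  proof (rule Lpconv_triangle[OF q0 fdb_conv[OF len]])
    show "fdb_sum is (B (r j)) \<in> Lspace ?M q" for j by (rule psi_chain_rule(1)[OF t k q B len])
    have "(\<lambda>j. LINT x|?M. \<bar>fdb_sum is (B j) x - fdb_sum is (\<Gamma> j) x\<bar> powr q) \<longlonglongrightarrow> 0"
      by (intro small c(5)[OF len] Bochner_Integration.integral_nonneg powr_ge_zero)
    from LIMSEQ_subseq_LIMSEQ[OF this r(1)]
    show "(\<lambda>j. LINT x|?M. \<bar>fdb_sum is (B (r j)) x - fdb_sum is (\<Gamma> (r j)) x\<bar> powr q) \<longlonglongrightarrow> 0" by (simp add: o_def)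
  qed
  \<comment> \<open>One list of directions is fixed for each multi-index, since norms are indexed by
    multi-indices but the chain rule by lists.\<close>
  obtain d where d: "\<And>s :: 'n \<Rightarrow> nat. mi_of (d s) = s" using mi_of_exists by metis
  have len_d: "length (d s) = mi_order s" for s using mi_order_mi_of[of "d s"] d[of s] by simp
  have norm_q: "sobolev_norm ?M k q (\<lambda>x. psi (b j x) - psi (a x))
      = (\<Sum>u\<in>?U. LINT x|?M. \<bar>fdb_sum (d u) (B j) x - fdb_sum (d u) A x\<bar> powr q) powr (1 / q)" for j
  proof (rule sobolev_norm_eq[OF sets_rho_measure AE_rho_measureI])
    fix u :: "'n \<Rightarrow> nat" assume "mi_order u \<le> k"
    then have "length (d u) \<le> k" by (simp add: len_d)
    from has_weak_deriv_diff[OF psi_chain_rule(2)[OF t k q B[of j] this] psi_chain_rule(2)[OF t k q A this]]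
    show "has_weak_deriv (\<lambda>x. psi (b j x) - psi (a x)) u (\<lambda>x. fdb_sum (d u) (B j) x - fdb_sum (d u) A x)"
      by (simp add: d)
  qed
  have "(\<lambda>j. \<Sum>u\<in>?U. LINT x|?M. \<bar>fdb_sum (d u) (B (r j)) x - fdb_sum (d u) A x\<bar> powr q) \<longlonglongrightarrow> (\<Sum>u\<in>?U. 0)"
    by (intro tendsto_sum LpconvD(3)[OF fdb_B_conv]) (simp add: len_d)
  then have "(\<lambda>j. \<bar>\<Sum>u\<in>?U. LINT x|?M. \<bar>fdb_sum (d u) (B (r j)) x - fdb_sum (d u) A x\<bar> powr q\<bar> powr (1 / q)) \<longlonglongrightarrow> 0"
    using q0 by (intro tendsto_abs_powr_zero) auto
  moreover have "\<bar>\<Sum>u\<in>?U. LINT x|?M. \<bar>fdb_sum (d u) (B j) x - fdb_sum (d u) A x\<bar> powr q\<bar>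
      = (\<Sum>u\<in>?U. LINT x|?M. \<bar>fdb_sum (d u) (B j) x - fdb_sum (d u) A x\<bar> powr q)" for j
    by (intro abs_of_nonneg sum_nonneg Bochner_Integration.integral_nonneg) auto
  ultimately have "(\<lambda>j. sobolev_norm ?M k q (\<lambda>x. psi (b (r j) x) - psi (a x))) \<longlonglongrightarrow> 0"
    by (simp add: norm_q)
  then have "\<forall>\<^sub>F j in sequentially. sobolev_norm ?M k q (\<lambda>x. psi (b (r j) x) - psi (a x)) < \<epsilon>"
    using order_tendstoD(2) \<epsilon> by blast
  then show False using b(3) by simp
qed

end

section \<open>Comparison of the reference measure with the smooth weight\<close>

lemma density_compare:
  fixes w v :: "real ^ 'n \<Rightarrow> real"
  assumes w: "w \<in> borel_measurable lebesgue" "\<And>x. 0 \<le> w x" and v: "v \<in> borel_measurable lebesgue" "\<And>x. 0 \<le> v x"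
    and le: "\<And>x. w x \<le> K * v x"
    and g: "g \<in> borel_measurable lebesgue" "\<And>x. 0 \<le> g x" "integrable (density lebesgue v) g"
  shows "integrable (density lebesgue w) g"
    "(LINT x|density lebesgue w. g x) \<le> K * (LINT x|density lebesgue v. g x)"
proof -
  have int: "integrable lebesgue (\<lambda>x. v x * g x)"
    using g(3) by (subst (asm) integrable_density) (use g v in auto)
  have le': "w x * g x \<le> K * (v x * g x)" for x
    using mult_right_mono[OF le g(2)] by (simp add: mult.assoc)
  have nn: "0 \<le> w x * g x" for x using w(2) g(2) by simp
  have int_w: "integrable lebesgue (\<lambda>x. w x * g x)"
    by (rule Bochner_Integration.integrable_bound[OF integrable_mult_right[OF int, of K]])
      (use w g nn le' order_trans[OF nn le'] in auto)
  then show "integrable (density lebesgue w) g"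
    by (subst integrable_density) (use g w in auto)
  have "(LINT x|density lebesgue w. g x) = (LINT x|lebesgue. w x * g x)"
    by (subst integral_density) (use g w in auto)
  also have "\<dots> \<le> (LINT x|lebesgue. K * (v x * g x))"
    by (rule integral_mono[OF int_w integrable_mult_right[OF int] le'])
  also have "\<dots> = K * (LINT x|density lebesgue v. g x)"
    by (subst integral_density) (use g v in auto)
  finally show "(LINT x|density lebesgue w. g x) \<le> K * (LINT x|density lebesgue v. g x)" .
qed

context
  fixes w v :: "real ^ 'n \<Rightarrow> real" and K :: real
  assumes w: "w \<in> borel_measurable lebesgue" "\<And>x. 0 \<le> w x" and v: "v \<in> borel_measurable lebesgue" "\<And>x. 0 \<le> v x"
    and le: "\<And>x. w x \<le> K * v x" and K: "0 < K"
begin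

lemma measurable_density_lebesgue: "borel_measurable (density lebesgue (\<lambda>x. ennreal (u x))) = borel_measurable lebesgue"
  by (rule measurable_cong_sets) auto

lemma Lspace_density_mono: "Lspace (density lebesgue v) p \<subseteq> Lspace (density lebesgue w) p"
proof
  fix f assume f: "f \<in> Lspace (density lebesgue v) p"
  then have m: "f \<in> borel_measurable lebesgue" using LspaceD(1)[OF f] by (simp add: measurable_density_lebesgue)
  then have "(\<lambda>x. \<bar>f x\<bar> powr p) \<in> borel_measurable lebesgue" by measurable
  then have "integrable (density lebesgue w) (\<lambda>x. \<bar>f x\<bar> powr p)"
    by (rule density_compare(1)[OF w v le _ _ LspaceD(2)[OF f]]) simp
  then show "f \<in> Lspace (density lebesgue w) p"
    using m by (intro LspaceI) (auto simp: measurable_density_lebesgue)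
qed

lemma sobolev_density_mono: "sobolev (density lebesgue v) k p \<subseteq> sobolev (density lebesgue w) k p"
  using Lspace_density_mono[of p] unfolding sobolev_def by blast

lemma AE_density_lebesgue: "(AE x in lebesgue. P x) \<Longrightarrow> u \<in> borel_measurable lebesgue \<Longrightarrow> AE x in density lebesgue (\<lambda>x. ennreal (u x)). P x"
  by (subst AE_density) auto

text \<open>Weak derivatives refer to Lebesgue measure, so the same functions \<open>A s\<close>
  compute both norms and only the densities are compared. The lemma is used in both directions with
  the densities exchanged.\<close>

lemma sobolev_norm_density_le:
  assumes p: "0 < p" and A: "\<And>s. mi_order s \<le> k \<Longrightarrow> A s \<in> Lspace (density lebesgue v) p"
    "\<And>s. mi_order s \<le> k \<Longrightarrow> has_weak_deriv a s (A s)"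
  shows "sobolev_norm (density lebesgue w) k p a \<le> K powr (1 / p) * sobolev_norm (density lebesgue v) k p a"
proof -
  have nn: "0 \<le> (\<Sum>s | mi_order s \<le> k. LINT x|density lebesgue u. \<bar>A s x\<bar> powr p)" for u
    by (intro sum_nonneg Bochner_Integration.integral_nonneg) auto
  have "(LINT x|density lebesgue w. \<bar>A s x\<bar> powr p) \<le> K * (LINT x|density lebesgue v. \<bar>A s x\<bar> powr p)"
    if s: "mi_order s \<le> k" for s
  proof (rule density_compare(2)[OF w v le _ _ LspaceD(2)[OF A(1)[OF s]]])
    show "(\<lambda>x. \<bar>A s x\<bar> powr p) \<in> borel_measurable lebesgue"
      using LspaceD(1)[OF A(1)[OF s]] unfolding measurable_density_lebesgue by measurable
  qed simp
  then have "(\<Sum>s | mi_order s \<le> k. LINT x|density lebesgue w. \<bar>A s x\<bar> powr p)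
      \<le> K * (\<Sum>s | mi_order s \<le> k. LINT x|density lebesgue v. \<bar>A s x\<bar> powr p)"
    unfolding sum_distrib_left by (intro sum_mono) auto
  then have "(\<Sum>s | mi_order s \<le> k. LINT x|density lebesgue w. \<bar>A s x\<bar> powr p) powr (1 / p)
      \<le> (K * (\<Sum>s | mi_order s \<le> k. LINT x|density lebesgue v. \<bar>A s x\<bar> powr p)) powr (1 / p)"
    using nn p by (intro powr_mono2) auto
  also have "\<dots> = K powr (1 / p) * (\<Sum>s | mi_order s \<le> k. LINT x|density lebesgue v. \<bar>A s x\<bar> powr p) powr (1 / p)"
    using K nn by (simp add: powr_mult)
  finally show ?thesis
    by (subst (1 2) sobolev_norm_eq[where A=A]) (use A(2) w(1) v(1) AE_density_lebesgue in auto)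
qed

end

text \<open>The numbers 1/(1 + u) and u/(1 + u) lie in the unit interval and add up to 1; raising
  each to a power s \<le> 1 can only increase it.\<close>

lemma powr_one_plus_le:
  fixes u s :: real
  assumes "0 \<le> u" "0 \<le> s" "s \<le> 1"
  shows "(1 + u) powr s \<le> 1 + u powr s"
proof (cases "u = 0")
  case False
  have "1 = 1 / (1 + u) + u / (1 + u)" using assms by (simp add: add_divide_distrib[symmetric])
  also have "\<dots> \<le> (1 / (1 + u)) powr s + (u / (1 + u)) powr s"
    using assms False powr_mono'[of s 1 "1 / (1 + u)"] powr_mono'[of s 1 "u / (1 + u)"] by (intro add_mono) auto
  also have "\<dots> = (1 + u powr s) / (1 + u) powr s"
    using assms by (simp add: powr_divide add_divide_distrib)
  finally show ?thesis using assms by (simp add: divide_simps split: if_splits)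
qed simp

text \<open>Near the origin monotonicity bounds \<theta>. In the tail both functions are |z|^t up to
  a constant, because t/2 \<le> 1 gives |z|^t \<le> \<open>jp t z\<close> \<le> 1 + |z|^t.\<close>

lemma admissible_theta_bounds:
  assumes t: "0 < t" "t \<le> 2" and \<theta>: "admissible_theta t \<theta>"
  obtains D where "\<And>z. \<bar>\<theta> \<bar>z\<bar> - jp t z\<bar> \<le> D"
proof -
  have mono: "strict_mono_on {0..} \<theta>" and \<theta>0: "\<theta> 0 = 0" using \<theta> by (auto simp: admissible_theta_def)
  obtain zt c where zt: "0 \<le> zt" "\<And>z. zt \<le> z \<Longrightarrow> 0 < z \<Longrightarrow> \<theta> z = c + z powr t"
    using \<theta> by (auto simp: admissible_theta_def)
  define Z where "Z = max zt 1"
  have le: "\<theta> x \<le> \<theta> y" if "0 \<le> x" "x \<le> y" for x y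
    using mono that unfolding strict_mono_on_def by (cases "x = y") (auto intro: less_imp_le)
  show ?thesis
  \<comment> \<open>The first two summands serve |z| \<le> Z, the last two serve the tail.\<close>
  proof (rule that[of "\<theta> Z + (1 + Z\<^sup>2) + \<bar>c\<bar> + 1"])
    fix z :: real
    have jp1: "1 \<le> jp t z" using t one_plus_sq_pos[of z] by (simp add: jp_def ge_one_powr_ge_zero)
    have \<theta>Z: "0 \<le> \<theta> Z" using le[of 0 Z] \<theta>0 by (simp add: Z_def)
    show "\<bar>\<theta> \<bar>z\<bar> - jp t z\<bar> \<le> \<theta> Z + (1 + Z\<^sup>2) + \<bar>c\<bar> + 1"
    proof (cases "\<bar>z\<bar> \<le> Z")
      case True
      have "0 \<le> \<theta> \<bar>z\<bar>" using le[of 0 "\<bar>z\<bar>"] \<theta>0 by simp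
      moreover have "\<theta> \<bar>z\<bar> \<le> \<theta> Z" using True by (intro le) auto
      moreover have "jp t z \<le> 1 + Z\<^sup>2"
      proof -
        have "jp t z \<le> (1 + z\<^sup>2) powr 1" unfolding jp_def using t one_plus_sq_pos[of z] by (intro powr_mono) auto
        also have "\<dots> \<le> 1 + Z\<^sup>2" using True one_plus_sq_pos[of z] abs_le_square_iff[of z Z] by (simp add: Z_def)
        finally show ?thesis .
      qed
      ultimately show ?thesis using jp1 by linarith
    next
      case False
      then have z: "zt \<le> \<bar>z\<bar>" "0 < \<bar>z\<bar>" by (auto simp: Z_def)
      have sq: "(z\<^sup>2) powr (t / 2) = \<bar>z\<bar> powr t"
      proof -
        have eq: "z\<^sup>2 = \<bar>z\<bar> powr 2" using z(2) by (simp add: powr_numeral)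
        show ?thesis unfolding eq powr_powr by simp
      qed
      have "\<bar>z\<bar> powr t \<le> jp t z"
        unfolding jp_def sq[symmetric] using t by (intro powr_mono2) auto
      moreover have "jp t z \<le> 1 + \<bar>z\<bar> powr t"
        unfolding jp_def sq[symmetric] using t by (intro powr_one_plus_le) auto
      moreover have "0 \<le> Z\<^sup>2" by simp
      ultimately show ?thesis unfolding zt(2)[OF z] using \<theta>Z by linarith
    qed
  qed
qed

lemma admissible_theta_measurable:
  assumes "admissible_theta t \<theta>"
  shows "(\<lambda>z. \<theta> \<bar>z\<bar>) \<in> borel_measurable borel"
proof -
  have "strict_mono_on {0..} \<theta>" using assms by (simp add: admissible_theta_def)
  then have "\<theta> x \<le> \<theta> y" if "0 \<le> x" "x \<le> y" for x y
    using that unfolding strict_mono_on_def by (cases "x = y") (auto intro: less_imp_le)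
  then have "mono (\<lambda>z. \<theta> (max 0 z))" by (auto simp: mono_def)
  then have [measurable]: "(\<lambda>z. \<theta> (max 0 z)) \<in> borel_measurable borel" by (rule borel_measurable_mono)
  have "(\<lambda>z::real. (\<lambda>z. \<theta> (max 0 z)) \<bar>z\<bar>) \<in> borel_measurable borel" by measurable
  then show ?thesis by simp
qed

theorem proposition4:
  fixes k :: nat and t C lam nu :: real and \<theta> :: "real \<Rightarrow> real"
    and \<mu> :: "(real ^ 'n) measure"
  assumes "0 < t" and "t \<le> 2"
    and "admissible_theta t \<theta>"
    and "has_bochner_integral lebesgue (\<lambda>z::real. exp (C - \<theta> \<bar>z\<bar>)) 1"
    and "\<mu> = ref_measure C \<theta>"
    and "2 \<le> k" and "real k - 1 \<le> lam" and "nu = (lam + 1) / real k"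
  shows "(\<forall>a \<in> sobolev \<mu> k lam. (\<lambda>x. psi (a x)) \<in> sobolev \<mu> k nu) \<and>
    (\<forall>a \<in> sobolev \<mu> k lam. \<forall>\<epsilon>>0. \<exists>\<delta>>0. \<forall>b \<in> sobolev \<mu> k lam.
       sobolev_norm \<mu> k lam (\<lambda>x. b x - a x) < \<delta> \<longrightarrow>
       sobolev_norm \<mu> k nu (\<lambda>x. psi (b x) - psi (a x)) < \<epsilon>)"
proof -
  note t = assms(1,2) and k = assms(6-8)
  define w :: "real ^ 'n \<Rightarrow> real" where "w x = exp (\<Sum>i\<in>UNIV. C - \<theta> \<bar>x $ i\<bar>)" for x
  define v :: "real ^ 'n \<Rightarrow> real" where "v = rho t"
  have \<mu>: "\<mu> = density lebesgue w" using assms(5) by (simp add: ref_measure_def w_def[abs_def])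
  have M: "rho_measure t = density lebesgue v" by (simp add: rho_measure_def v_def)
  have [measurable]: "(\<lambda>z. \<theta> \<bar>z\<bar>) \<in> borel_measurable borel" by (rule admissible_theta_measurable[OF assms(3)])
  have "(\<lambda>x. \<theta> \<bar>x $ i\<bar>) \<in> borel_measurable borel" for i :: 'n
    using measurable_compose[of "\<lambda>x. x $ i" borel borel "\<lambda>z. \<theta> \<bar>z\<bar>" borel] by simp
  then have "w \<in> borel_measurable borel" unfolding w_def[abs_def] by measurable
  then have wm: "w \<in> borel_measurable lebesgue" by (intro measurable_completion) simp
  have vm: "v \<in> borel_measurable lebesgue" by (simp add: v_def)
  have w0: "0 \<le> w x" and v0: "0 \<le> v x" for x by (simp_all add: w_def v_def)
  obtain D where D: "\<And>z. \<bar>\<theta> \<bar>z\<bar> - jp t z\<bar> \<le> D" using admissible_theta_bounds[OF t assms(3)] by blast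
  \<comment> \<open>Per coordinate the exponents of the two densities differ by at most |C| + D, in
    either direction.\<close>
  define K where "K = exp (real CARD('n) * (\<bar>C\<bar> + D))"
  have K: "0 < K" by (simp add: K_def)
  have wv: "w x \<le> K * v x" and vw: "v x \<le> K * w x" for x
  proof -
    have 1: "(\<Sum>i\<in>UNIV. C - \<theta> \<bar>x $ i\<bar>) \<le> (\<Sum>i\<in>(UNIV::'n set). (\<bar>C\<bar> + D) - jp t (x $ i))"
    proof (rule sum_mono)
      fix i
      show "C - \<theta> \<bar>x $ i\<bar> \<le> (\<bar>C\<bar> + D) - jp t (x $ i)" using D[of "x $ i"] by linarith
    qed
    have 2: "(\<Sum>i\<in>(UNIV::'n set). - jp t (x $ i)) \<le> (\<Sum>i\<in>UNIV. (\<bar>C\<bar> + D) + (C - \<theta> \<bar>x $ i\<bar>))"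
    proof (rule sum_mono)
      fix i
      show "- jp t (x $ i) \<le> (\<bar>C\<bar> + D) + (C - \<theta> \<bar>x $ i\<bar>)" using D[of "x $ i"] by linarith
    qed
    show "w x \<le> K * v x"
      using 1 by (simp add: w_def v_def rho_eq_exp K_def exp_add[symmetric] sum_subtractf)
    show "v x \<le> K * w x"
      using 2 by (simp add: w_def v_def rho_eq_exp K_def exp_add[symmetric] sum.distrib sum_negf)
  qed
  note to_w = wm w0 vm v0 wv K and to_v = vm v0 wm w0 vw K
  have sob: "sobolev \<mu> k p = sobolev (rho_measure t) k p" for p
    unfolding \<mu> M using sobolev_density_mono[OF to_w, of k p] sobolev_density_mono[OF to_v, of k p] by blast
  have Lsp: "Lspace \<mu> p = Lspace (rho_measure t) p" for p
    unfolding \<mu> M using Lspace_density_mono[OF to_w, of p] Lspace_density_mono[OF to_v, of p] by blast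
  have p: "1 \<le> lam" "1 \<le> nu" using p_ge_1[OF t k] q_ge_1[OF t k] by auto
  have diff: "\<exists>A. \<forall>s. mi_order s \<le> k \<longrightarrow> A s \<in> Lspace (rho_measure t) p \<and> has_weak_deriv (\<lambda>x. b x - a x) s (A s)"
    if "1 \<le> p" "a \<in> sobolev (rho_measure t) k p" "b \<in> sobolev (rho_measure t) k p" for p and a b :: "real ^ 'n \<Rightarrow> real"
  proof -
    note h = that
    obtain A where A: "sobolev_family (rho_measure t) k p a A" by (rule sobolev_family_exists[OF h(1,2)])
    obtain B where B: "sobolev_family (rho_measure t) k p b B" by (rule sobolev_family_exists[OF h(1,3)])
    show ?thesis
      using sobolev_familyD[OF A] sobolev_familyD[OF B] h(1)
      by (intro exI[of _ "\<lambda>s x. B s x - A s x"] allI impI conjI Lspace_diff has_weak_deriv_diff) auto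
  qed
  have norm_w: "sobolev_norm \<mu> k p (\<lambda>x. b x - a x) \<le> K powr (1 / p) * sobolev_norm (rho_measure t) k p (\<lambda>x. b x - a x)"
    and norm_v: "sobolev_norm (rho_measure t) k p (\<lambda>x. b x - a x) \<le> K powr (1 / p) * sobolev_norm \<mu> k p (\<lambda>x. b x - a x)"
    if "1 \<le> p" "a \<in> sobolev (rho_measure t) k p" "b \<in> sobolev (rho_measure t) k p" for p and a b :: "real ^ 'n \<Rightarrow> real"
  proof -
    note h = that
    obtain A where A: "\<And>s. mi_order s \<le> k \<Longrightarrow> A s \<in> Lspace (rho_measure t) p"
      "\<And>s. mi_order s \<le> k \<Longrightarrow> has_weak_deriv (\<lambda>x. b x - a x) s (A s)"
      using diff[OF h] by blast
    have p0: "0 < p" using h(1) by simp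
    show "sobolev_norm \<mu> k p (\<lambda>x. b x - a x) \<le> K powr (1 / p) * sobolev_norm (rho_measure t) k p (\<lambda>x. b x - a x)"
      unfolding \<mu> M by (rule sobolev_norm_density_le[OF to_w p0 A(1)[unfolded M] A(2)])
    show "sobolev_norm (rho_measure t) k p (\<lambda>x. b x - a x) \<le> K powr (1 / p) * sobolev_norm \<mu> k p (\<lambda>x. b x - a x)"
      unfolding \<mu> M by (rule sobolev_norm_density_le[OF to_v p0 A(1)[folded Lsp, unfolded \<mu>] A(2)])
  qed
  have psi_sob: "(\<lambda>x. psi (a x)) \<in> sobolev (rho_measure t) k nu" if "a \<in> sobolev (rho_measure t) k lam" for a :: "real ^ 'n \<Rightarrow> real"
    by (rule psi_in_sobolev[OF t k that])
  show ?thesis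
    unfolding sob
  proof (intro conjI ballI allI impI psi_sob)
    fix a :: "real ^ 'n \<Rightarrow> real" and \<epsilon> :: real
    assume a: "a \<in> sobolev (rho_measure t) k lam" and \<epsilon>: "0 < \<epsilon>"
    define K1 where "K1 = K powr (1 / lam)"
    define K2 where "K2 = K powr (1 / nu)"
    have K12: "0 < K1" "0 < K2" using K by (auto simp: K1_def K2_def)
    then have "0 < \<epsilon> / K2" using \<epsilon> by simp
    from psi_continuous_on_sobolev[OF t k a this] obtain \<delta> where \<delta>: "\<delta> > 0"
      "\<And>b. b \<in> sobolev (rho_measure t) k lam \<Longrightarrow> sobolev_norm (rho_measure t) k lam (\<lambda>x. b x - a x) < \<delta> \<Longrightarrow>
        sobolev_norm (rho_measure t) k nu (\<lambda>x. psi (b x) - psi (a x)) < \<epsilon> / K2" by blast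
    show "\<exists>\<delta>>0. \<forall>b \<in> sobolev (rho_measure t) k lam. sobolev_norm \<mu> k lam (\<lambda>x. b x - a x) < \<delta> \<longrightarrow>
        sobolev_norm \<mu> k nu (\<lambda>x. psi (b x) - psi (a x)) < \<epsilon>"
    \<comment> \<open>K1 and K2 are the norm equivalence constants for the exponents
      \<open>lam\<close> and \<open>nu\<close>.\<close>
    proof (intro exI[of _ "\<delta> / K1"] conjI ballI impI)
      show "0 < \<delta> / K1" using \<delta>(1) K12 by simp
      fix b :: "real ^ 'n \<Rightarrow> real"
      assume b: "b \<in> sobolev (rho_measure t) k lam" and less: "sobolev_norm \<mu> k lam (\<lambda>x. b x - a x) < \<delta> / K1"
      have "sobolev_norm (rho_measure t) k lam (\<lambda>x. b x - a x) \<le> K1 * sobolev_norm \<mu> k lam (\<lambda>x. b x - a x)"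
        unfolding K1_def by (rule norm_v[OF p(1) a b])
      also have "\<dots> < \<delta>" using less K12 by (simp add: field_simps)
      finally have "sobolev_norm (rho_measure t) k nu (\<lambda>x. psi (b x) - psi (a x)) < \<epsilon> / K2" by (rule \<delta>(2)[OF b])
      then have "K2 * sobolev_norm (rho_measure t) k nu (\<lambda>x. psi (b x) - psi (a x)) < \<epsilon>"
        using K12 by (simp add: field_simps)
      then show "sobolev_norm \<mu> k nu (\<lambda>x. psi (b x) - psi (a x)) < \<epsilon>"
        using norm_w[OF p(2) psi_sob[OF a] psi_sob[OF b]] unfolding K2_def by linarith
    qed
  qed
qed

end
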